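(* Let $\mathcal{E}$ be a category with finite limits. The category $\mathcal{E}$ is cartesian closed if and only if the $2$-category $\mathbf{Cat}(\mathcal{E})$ is cartesian closed. In this case, the functor $\mathbf{disc}:\mathcal{E}\to\mathbf{Cat}(\mathcal{E})_1$ preserves internal homs (up to isomorphism).
   Context: $\mathbf{Cat}(\mathcal{E})$ is the $2$-category of categories, functors and natural transformations internal to $\mathcal{E}$, and $\mathbf{Cat}(\mathcal{E})_1$ is its underlying category. The $2$-category $\mathbf{Cat}(\mathcal{E})$ is cartesian closed if each $2$-functor $-\times\mathbb{B}$ has a right $2$-adjoint $(-)^{\mathbb{B}}$. The functor $\mathbf{disc}$ sends $X\in\mathcal{E}$ to the discrete internal category on $X$ (object of objects and object of arrows both $X$, all structure maps identities). *)

theory Defs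
  imports Main
begin

section \<open>Categories, functors and limits\<close>

text \<open>Arrows and objects live on carrier sets; composition is in diagrammatically reversed
  (applicative) order, so \<open>g \<cdot> f\<close> means first \<open>f\<close>, then \<open>g\<close>.
  It is unspecified outside composable pairs.\<close>

record ('o, 'a) cat =
  Obj :: "'o set"
  Arr :: "'a set"
  Dom :: "'a \<Rightarrow> 'o"
  Cod :: "'a \<Rightarrow> 'o"
  Idt :: "'o \<Rightarrow> 'a"
  Comp :: "'a \<Rightarrow> 'a \<Rightarrow> 'a" (infixr "\<cdot>\<index>" 70)

definition hom :: "('o, 'a) cat \<Rightarrow> 'o \<Rightarrow> 'o \<Rightarrow> 'a set" where
  "hom C A B = {f \<in> Arr C. Dom C f = A \<and> Cod C f = B}"

definition category :: "('o, 'a) cat \<Rightarrow> bool" where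
  "category C \<longleftrightarrow>
     (\<forall>f\<in>Arr C. Dom C f \<in> Obj C \<and> Cod C f \<in> Obj C) \<and>
     (\<forall>A\<in>Obj C. Idt C A \<in> hom C A A) \<and>
     (\<forall>f\<in>Arr C. \<forall>g\<in>Arr C. Dom C g = Cod C f \<longrightarrow> g \<cdot>\<^bsub>C\<^esub> f \<in> hom C (Dom C f) (Cod C g)) \<and>
     (\<forall>f\<in>Arr C. f \<cdot>\<^bsub>C\<^esub> Idt C (Dom C f) = f \<and> Idt C (Cod C f) \<cdot>\<^bsub>C\<^esub> f = f) \<and>
     (\<forall>f\<in>Arr C. \<forall>g\<in>Arr C. \<forall>h\<in>Arr C. Dom C g = Cod C f \<longrightarrow> Dom C h = Cod C g \<longrightarrow>
        (h \<cdot>\<^bsub>C\<^esub> g) \<cdot>\<^bsub>C\<^esub> f = h \<cdot>\<^bsub>C\<^esub> (g \<cdot>\<^bsub>C\<^esub> f))"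

definition is_iso :: "('o, 'a) cat \<Rightarrow> 'a \<Rightarrow> bool" where
  "is_iso C f \<longleftrightarrow> f \<in> Arr C \<and>
     (\<exists>g \<in> hom C (Cod C f) (Dom C f).
        g \<cdot>\<^bsub>C\<^esub> f = Idt C (Dom C f) \<and> f \<cdot>\<^bsub>C\<^esub> g = Idt C (Cod C f))"

record ('o, 'a, 'p, 'b) fct =
  FOb :: "'o \<Rightarrow> 'p"
  FAr :: "'a \<Rightarrow> 'b"

definition is_functor :: "('o, 'a) cat \<Rightarrow> ('p, 'b) cat \<Rightarrow> ('o, 'a, 'p, 'b) fct \<Rightarrow> bool" where
  "is_functor C D F \<longleftrightarrow>
     (\<forall>A\<in>Obj C. FOb F A \<in> Obj D) \<and>
     (\<forall>f\<in>Arr C. FAr F f \<in> hom D (FOb F (Dom C f)) (FOb F (Cod C f))) \<and>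
     (\<forall>A\<in>Obj C. FAr F (Idt C A) = Idt D (FOb F A)) \<and>
     (\<forall>f\<in>Arr C. \<forall>g\<in>Arr C. Dom C g = Cod C f \<longrightarrow>
        FAr F (g \<cdot>\<^bsub>C\<^esub> f) = FAr F g \<cdot>\<^bsub>D\<^esub> FAr F f)"

definition is_cone ::
    "('i, 'j) cat \<Rightarrow> ('o, 'a) cat \<Rightarrow> ('i, 'j, 'o, 'a) fct \<Rightarrow> 'o \<Rightarrow> ('i \<Rightarrow> 'a) \<Rightarrow> bool" where
  "is_cone J C D L \<pi> \<longleftrightarrow> L \<in> Obj C \<and>
     (\<forall>i\<in>Obj J. \<pi> i \<in> hom C L (FOb D i)) \<and>
     (\<forall>k\<in>Arr J. FAr D k \<cdot>\<^bsub>C\<^esub> \<pi> (Dom J k) = \<pi> (Cod J k))"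

definition is_limit ::
    "('i, 'j) cat \<Rightarrow> ('o, 'a) cat \<Rightarrow> ('i, 'j, 'o, 'a) fct \<Rightarrow> 'o \<Rightarrow> ('i \<Rightarrow> 'a) \<Rightarrow> bool" where
  "is_limit J C D L \<pi> \<longleftrightarrow> is_cone J C D L \<pi> \<and>
     (\<forall>M \<mu>. is_cone J C D M \<mu> \<longrightarrow>
        (\<exists>!u. u \<in> hom C M L \<and> (\<forall>i\<in>Obj J. \<pi> i \<cdot>\<^bsub>C\<^esub> u = \<mu> i)))"

text \<open>Every finite category is isomorphic to one whose objects and arrows are natural numbers, so
  restricting the shapes to such categories loses no generality.\<close>

definition has_finite_limits :: "('o, 'a) cat \<Rightarrow> bool" where
  "has_finite_limits C \<longleftrightarrow>
     (\<forall>(J :: (nat, nat) cat) D.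
        category J \<and> finite (Obj J) \<and> finite (Arr J) \<and> is_functor J C D \<longrightarrow>
        (\<exists>L \<pi>. is_limit J C D L \<pi>))"

definition is_terminal :: "('o, 'a) cat \<Rightarrow> 'o \<Rightarrow> bool" where
  "is_terminal C T \<longleftrightarrow> T \<in> Obj C \<and> (\<forall>X\<in>Obj C. \<exists>!f. f \<in> hom C X T)"

definition is_product :: "('o, 'a) cat \<Rightarrow> 'o \<Rightarrow> 'o \<Rightarrow> 'o \<Rightarrow> 'a \<Rightarrow> 'a \<Rightarrow> bool" where
  "is_product C A B P p q \<longleftrightarrow> P \<in> Obj C \<and> p \<in> hom C P A \<and> q \<in> hom C P B \<and>
     (\<forall>X\<in>Obj C. \<forall>f\<in>hom C X A. \<forall>g\<in>hom C X B.
        \<exists>!u. u \<in> hom C X P \<and> p \<cdot>\<^bsub>C\<^esub> u = f \<and> q \<cdot>\<^bsub>C\<^esub> u = g)"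

definition is_pullback :: "('o, 'a) cat \<Rightarrow> 'a \<Rightarrow> 'a \<Rightarrow> 'o \<Rightarrow> 'a \<Rightarrow> 'a \<Rightarrow> bool" where
  "is_pullback C f g P p q \<longleftrightarrow> P \<in> Obj C \<and> p \<in> hom C P (Dom C f) \<and> q \<in> hom C P (Dom C g) \<and>
     f \<cdot>\<^bsub>C\<^esub> p = g \<cdot>\<^bsub>C\<^esub> q \<and>
     (\<forall>X\<in>Obj C. \<forall>a\<in>hom C X (Dom C f). \<forall>b\<in>hom C X (Dom C g). f \<cdot>\<^bsub>C\<^esub> a = g \<cdot>\<^bsub>C\<^esub> b \<longrightarrow>
        (\<exists>!u. u \<in> hom C X P \<and> p \<cdot>\<^bsub>C\<^esub> u = a \<and> q \<cdot>\<^bsub>C\<^esub> u = b))"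

text \<open>A fixed choice of binary products and of pullbacks, meaningful whenever they
  exist.\<close>

definition chosen_product :: "('o, 'a) cat \<Rightarrow> 'o \<Rightarrow> 'o \<Rightarrow> 'o \<times> 'a \<times> 'a" where
  "chosen_product C A B = (SOME (P, p, q). is_product C A B P p q)"

definition prod_ob :: "('o, 'a) cat \<Rightarrow> 'o \<Rightarrow> 'o \<Rightarrow> 'o" where
  "prod_ob C A B = fst (chosen_product C A B)"

definition prod_fst :: "('o, 'a) cat \<Rightarrow> 'o \<Rightarrow> 'o \<Rightarrow> 'a" where
  "prod_fst C A B = fst (snd (chosen_product C A B))"

definition prod_snd :: "('o, 'a) cat \<Rightarrow> 'o \<Rightarrow> 'o \<Rightarrow> 'a" where
  "prod_snd C A B = snd (snd (chosen_product C A B))"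

definition chosen_pullback :: "('o, 'a) cat \<Rightarrow> 'a \<Rightarrow> 'a \<Rightarrow> 'o \<times> 'a \<times> 'a" where
  "chosen_pullback C f g = (SOME (P, p, q). is_pullback C f g P p q)"

definition pb_ob :: "('o, 'a) cat \<Rightarrow> 'a \<Rightarrow> 'a \<Rightarrow> 'o" where
  "pb_ob C f g = fst (chosen_pullback C f g)"

definition pb_fst :: "('o, 'a) cat \<Rightarrow> 'a \<Rightarrow> 'a \<Rightarrow> 'a" where
  "pb_fst C f g = fst (snd (chosen_pullback C f g))"

definition pb_snd :: "('o, 'a) cat \<Rightarrow> 'a \<Rightarrow> 'a \<Rightarrow> 'a" where
  "pb_snd C f g = snd (snd (chosen_pullback C f g))"

text \<open>The arrow \<open>\<langle>f, g\<rangle>\<close> into the vertex of a product or pullback with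
  projections \<open>p\<close>, \<open>q\<close>.\<close>

definition lift :: "('o, 'a) cat \<Rightarrow> 'a \<Rightarrow> 'a \<Rightarrow> 'a \<Rightarrow> 'a \<Rightarrow> 'a" where
  "lift C p q f g =
     (THE u. u \<in> hom C (Dom C f) (Dom C p) \<and> p \<cdot>\<^bsub>C\<^esub> u = f \<and> q \<cdot>\<^bsub>C\<^esub> u = g)"


section \<open>Cartesian closed categories\<close>

text \<open>The endofunctor \<open>- \<times> B\<close>.\<close>

definition prod_functor :: "('o, 'a) cat \<Rightarrow> 'o \<Rightarrow> ('o, 'a, 'o, 'a) fct" where
  "prod_functor C B = \<lparr>
     FOb = (\<lambda>A. prod_ob C A B),
     FAr = (\<lambda>f. lift C (prod_fst C (Cod C f) B) (prod_snd C (Cod C f) B)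
                   (f \<cdot>\<^bsub>C\<^esub> prod_fst C (Dom C f) B) (prod_snd C (Dom C f) B)) \<rparr>"

definition id_functor :: "('o, 'a, 'o, 'a) fct" where
  "id_functor = \<lparr> FOb = (\<lambda>A. A), FAr = (\<lambda>f. f) \<rparr>"

definition comp_functor ::
    "('p, 'b, 'r, 'c) fct \<Rightarrow> ('o, 'a, 'p, 'b) fct \<Rightarrow> ('o, 'a, 'r, 'c) fct" where
  "comp_functor G F = \<lparr> FOb = (\<lambda>A. FOb G (FOb F A)), FAr = (\<lambda>f. FAr G (FAr F f)) \<rparr>"

definition is_nattrans :: "('o, 'a) cat \<Rightarrow> ('p, 'b) cat \<Rightarrow> ('o, 'a, 'p, 'b) fct \<Rightarrow>
    ('o, 'a, 'p, 'b) fct \<Rightarrow> ('o \<Rightarrow> 'b) \<Rightarrow> bool" where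
  "is_nattrans C D F G \<tau> \<longleftrightarrow>
     (\<forall>A\<in>Obj C. \<tau> A \<in> hom D (FOb F A) (FOb G A)) \<and>
     (\<forall>f\<in>Arr C. \<tau> (Cod C f) \<cdot>\<^bsub>D\<^esub> FAr F f = FAr G f \<cdot>\<^bsub>D\<^esub> \<tau> (Dom C f))"

text \<open>\<open>F : C \<rightarrow> D\<close> is left adjoint to \<open>G : D \<rightarrow> C\<close> with unit \<open>\<eta>\<close> and counit \<open>\<epsilon>\<close>.\<close>

definition is_adjunction :: "('o, 'a) cat \<Rightarrow> ('p, 'b) cat \<Rightarrow> ('o, 'a, 'p, 'b) fct \<Rightarrow>
    ('p, 'b, 'o, 'a) fct \<Rightarrow> ('o \<Rightarrow> 'a) \<Rightarrow> ('p \<Rightarrow> 'b) \<Rightarrow> bool" where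
  "is_adjunction C D F G \<eta> \<epsilon> \<longleftrightarrow>
     is_functor C D F \<and> is_functor D C G \<and>
     is_nattrans C C id_functor (comp_functor G F) \<eta> \<and>
     is_nattrans D D (comp_functor F G) id_functor \<epsilon> \<and>
     (\<forall>A\<in>Obj C. \<epsilon> (FOb F A) \<cdot>\<^bsub>D\<^esub> FAr F (\<eta> A) = Idt D (FOb F A)) \<and>
     (\<forall>B\<in>Obj D. FAr G (\<epsilon> B) \<cdot>\<^bsub>C\<^esub> \<eta> (FOb G B) = Idt C (FOb G B))"

definition cartesian_closed :: "('o, 'a) cat \<Rightarrow> bool" where
  "cartesian_closed C \<longleftrightarrow> category C \<and>
     (\<exists>T. is_terminal C T) \<and>
     (\<forall>A\<in>Obj C. \<forall>B\<in>Obj C. \<exists>P p q. is_product C A B P p q) \<and>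
     (\<forall>B\<in>Obj C. \<exists>G \<eta> \<epsilon>. is_adjunction C C (prod_functor C B) G \<eta> \<epsilon>)"

text \<open>For \<open>F\<close> preserving binary products, the canonical arrow
  \<open>F (Y\<^sup>A) \<rightarrow> (F Y)\<^sup>F\<^sup>A\<close>: the transpose of
  \<open>F (Y\<^sup>A) \<times> F A \<cong> F (Y\<^sup>A \<times> A) \<rightarrow> F Y\<close>, where the last arrow is \<open>F\<close> applied to
  evaluation. Here \<open>G\<close>, \<open>\<epsilon>\<close> are the right adjoint and counit for \<open>- \<times> A\<close>
  and \<open>G'\<close>, \<open>\<eta>'\<close> the right adjoint and unit for \<open>- \<times> F A\<close>.\<close>

definition hom_comparison :: "('o, 'a) cat \<Rightarrow> ('p, 'b) cat \<Rightarrow> ('o, 'a, 'p, 'b) fct \<Rightarrow> 'o \<Rightarrow>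
    ('o, 'a, 'o, 'a) fct \<Rightarrow> ('o \<Rightarrow> 'a) \<Rightarrow> ('p, 'b, 'p, 'b) fct \<Rightarrow> ('p \<Rightarrow> 'b) \<Rightarrow> 'o \<Rightarrow> 'b" where
  "hom_comparison C D F A G \<epsilon> G' \<eta>' Y =
     (let H = FOb G Y;
          \<theta> = lift D (FAr F (prod_fst C H A)) (FAr F (prod_snd C H A))
                (prod_fst D (FOb F H) (FOb F A)) (prod_snd D (FOb F H) (FOb F A))
      in FAr G' (FAr F (\<epsilon> Y) \<cdot>\<^bsub>D\<^esub> \<theta>) \<cdot>\<^bsub>D\<^esub> \<eta>' (FOb F H))"

text \<open>Preservation of internal homs up to isomorphism, for a functor between cartesian closed
  categories: the canonical comparison arrows are invertible, for every choice of the adjoints.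
  Preservation of binary products is what makes them well defined.\<close>

definition preserves_internal_homs ::
    "('o, 'a) cat \<Rightarrow> ('p, 'b) cat \<Rightarrow> ('o, 'a, 'p, 'b) fct \<Rightarrow> bool" where
  "preserves_internal_homs C D F \<longleftrightarrow>
     cartesian_closed C \<and> cartesian_closed D \<and> is_functor C D F \<and>
     (\<forall>A\<in>Obj C. \<forall>B\<in>Obj C. is_product D (FOb F A) (FOb F B) (FOb F (prod_ob C A B))
        (FAr F (prod_fst C A B)) (FAr F (prod_snd C A B))) \<and>
     (\<forall>A\<in>Obj C. \<forall>Y\<in>Obj C. \<forall>G \<eta> \<epsilon> G' \<eta>' \<epsilon>'.
        is_adjunction C C (prod_functor C A) G \<eta> \<epsilon> \<longrightarrow>
        is_adjunction D D (prod_functor D (FOb F A)) G' \<eta>' \<epsilon>' \<longrightarrow>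
        hom_comparison C D F A G \<epsilon> G' \<eta>' Y \<in> hom D (FOb F (FOb G Y)) (FOb G' (FOb F Y)) \<and>
        is_iso D (hom_comparison C D F A G \<epsilon> G' \<eta>' Y))"


section \<open>Cartesian closed 2-categories\<close>

text \<open>\<open>Und\<close> is the underlying category; \<open>CDom\<close>, \<open>CCod\<close> are the source and
  target 1-cells of a 2-cell. Both compositions of 2-cells are in applicative order.\<close>

record ('o, 'a, 't) twocat =
  Und :: "('o, 'a) cat"
  Cell :: "'t set"
  CDom :: "'t \<Rightarrow> 'a"
  CCod :: "'t \<Rightarrow> 'a"
  CIdt :: "'a \<Rightarrow> 't"
  VComp :: "'t \<Rightarrow> 't \<Rightarrow> 't"
  HComp :: "'t \<Rightarrow> 't \<Rightarrow> 't"

text \<open>The disjoint union of the hom-categories.\<close>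

definition vertical :: "('o, 'a, 't) twocat \<Rightarrow> ('a, 't) cat" where
  "vertical K = \<lparr> Obj = Arr (Und K), Arr = Cell K, Dom = CDom K, Cod = CCod K,
     Idt = CIdt K, Comp = VComp K \<rparr>"

definition cells :: "('o, 'a, 't) twocat \<Rightarrow> 'a \<Rightarrow> 'a \<Rightarrow> 't set" where
  "cells K f g = {\<alpha> \<in> Cell K. CDom K \<alpha> = f \<and> CCod K \<alpha> = g}"

definition hcomposable :: "('o, 'a, 't) twocat \<Rightarrow> 't \<Rightarrow> 't \<Rightarrow> bool" where
  "hcomposable K \<beta> \<alpha> \<longleftrightarrow> \<alpha> \<in> Cell K \<and> \<beta> \<in> Cell K \<and>
     Dom (Und K) (CDom K \<beta>) = Cod (Und K) (CDom K \<alpha>)"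

definition two_category :: "('o, 'a, 't) twocat \<Rightarrow> bool" where
  "two_category K \<longleftrightarrow> category (Und K) \<and> category (vertical K) \<and>
     (\<forall>\<alpha>\<in>Cell K. Dom (Und K) (CDom K \<alpha>) = Dom (Und K) (CCod K \<alpha>) \<and>
                  Cod (Und K) (CDom K \<alpha>) = Cod (Und K) (CCod K \<alpha>)) \<and>
     (\<forall>\<alpha> \<beta>. hcomposable K \<beta> \<alpha> \<longrightarrow>
        HComp K \<beta> \<alpha> \<in> cells K (CDom K \<beta> \<cdot>\<^bsub>Und K\<^esub> CDom K \<alpha>) (CCod K \<beta> \<cdot>\<^bsub>Und K\<^esub> CCod K \<alpha>)) \<and>
     (\<forall>\<alpha>\<in>Cell K. HComp K (CIdt K (Idt (Und K) (Cod (Und K) (CDom K \<alpha>)))) \<alpha> = \<alpha> \<and>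
                  HComp K \<alpha> (CIdt K (Idt (Und K) (Dom (Und K) (CDom K \<alpha>)))) = \<alpha>) \<and>
     (\<forall>\<alpha> \<beta> \<gamma>. hcomposable K \<beta> \<alpha> \<and> hcomposable K \<gamma> \<beta> \<longrightarrow>
        HComp K (HComp K \<gamma> \<beta>) \<alpha> = HComp K \<gamma> (HComp K \<beta> \<alpha>)) \<and>
     (\<forall>f\<in>Arr (Und K). \<forall>g\<in>Arr (Und K). Dom (Und K) g = Cod (Und K) f \<longrightarrow>
        HComp K (CIdt K g) (CIdt K f) = CIdt K (g \<cdot>\<^bsub>Und K\<^esub> f)) \<and>
     (\<forall>\<alpha>\<in>Cell K. \<forall>\<alpha>'\<in>Cell K. \<forall>\<beta>\<in>Cell K. \<forall>\<beta>'\<in>Cell K.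
        CDom K \<alpha>' = CCod K \<alpha> \<and> CDom K \<beta>' = CCod K \<beta> \<and> hcomposable K \<beta> \<alpha> \<longrightarrow>
        HComp K (VComp K \<beta>' \<beta>) (VComp K \<alpha>' \<alpha>) = VComp K (HComp K \<beta>' \<alpha>') (HComp K \<beta> \<alpha>))"

record ('o, 'a, 't, 'p, 'b, 's) twofct =
  FUnd :: "('o, 'a, 'p, 'b) fct"
  FCell :: "'t \<Rightarrow> 's"

definition is_2functor :: "('o, 'a, 't) twocat \<Rightarrow> ('p, 'b, 's) twocat \<Rightarrow>
    ('o, 'a, 't, 'p, 'b, 's) twofct \<Rightarrow> bool" where
  "is_2functor K L F \<longleftrightarrow> is_functor (Und K) (Und L) (FUnd F) \<and>
     is_functor (vertical K) (vertical L) \<lparr> FOb = FAr (FUnd F), FAr = FCell F \<rparr> \<and>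
     (\<forall>\<alpha> \<beta>. hcomposable K \<beta> \<alpha> \<longrightarrow>
        FCell F (HComp K \<beta> \<alpha>) = HComp L (FCell F \<beta>) (FCell F \<alpha>))"

definition id_2functor :: "('o, 'a, 't, 'o, 'a, 't) twofct" where
  "id_2functor = \<lparr> FUnd = id_functor, FCell = (\<lambda>\<alpha>. \<alpha>) \<rparr>"

definition comp_2functor :: "('p, 'b, 's, 'r, 'c, 'u) twofct \<Rightarrow>
    ('o, 'a, 't, 'p, 'b, 's) twofct \<Rightarrow> ('o, 'a, 't, 'r, 'c, 'u) twofct" where
  "comp_2functor G F =
     \<lparr> FUnd = comp_functor (FUnd G) (FUnd F), FCell = (\<lambda>\<alpha>. FCell G (FCell F \<alpha>)) \<rparr>"

definition is_2nattrans :: "('o, 'a, 't) twocat \<Rightarrow> ('p, 'b, 's) twocat \<Rightarrow>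
    ('o, 'a, 't, 'p, 'b, 's) twofct \<Rightarrow> ('o, 'a, 't, 'p, 'b, 's) twofct \<Rightarrow> ('o \<Rightarrow> 'b) \<Rightarrow> bool" where
  "is_2nattrans K L F G \<tau> \<longleftrightarrow> is_nattrans (Und K) (Und L) (FUnd F) (FUnd G) \<tau> \<and>
     (\<forall>\<alpha>\<in>Cell K.
        HComp L (CIdt L (\<tau> (Cod (Und K) (CDom K \<alpha>)))) (FCell F \<alpha>) =
        HComp L (FCell G \<alpha>) (CIdt L (\<tau> (Dom (Und K) (CDom K \<alpha>)))))"

text \<open>\<open>G\<close> is a right 2-adjoint of \<open>F : K \<rightarrow> L\<close>, with 2-natural unit and counit
  satisfying the (strict) triangle identities.\<close>

definition is_2adjunction :: "('o, 'a, 't) twocat \<Rightarrow> ('p, 'b, 's) twocat \<Rightarrow>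
    ('o, 'a, 't, 'p, 'b, 's) twofct \<Rightarrow> ('p, 'b, 's, 'o, 'a, 't) twofct \<Rightarrow>
    ('o \<Rightarrow> 'a) \<Rightarrow> ('p \<Rightarrow> 'b) \<Rightarrow> bool" where
  "is_2adjunction K L F G \<eta> \<epsilon> \<longleftrightarrow>
     is_2functor K L F \<and> is_2functor L K G \<and>
     is_2nattrans K K id_2functor (comp_2functor G F) \<eta> \<and>
     is_2nattrans L L (comp_2functor F G) id_2functor \<epsilon> \<and>
     (\<forall>A\<in>Obj (Und K).
        \<epsilon> (FOb (FUnd F) A) \<cdot>\<^bsub>Und L\<^esub> FAr (FUnd F) (\<eta> A) = Idt (Und L) (FOb (FUnd F) A)) \<and>
     (\<forall>B\<in>Obj (Und L).
        FAr (FUnd G) (\<epsilon> B) \<cdot>\<^bsub>Und K\<^esub> \<eta> (FOb (FUnd G) B) = Idt (Und K) (FOb (FUnd G) B))"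

definition is_2terminal :: "('o, 'a, 't) twocat \<Rightarrow> 'o \<Rightarrow> bool" where
  "is_2terminal K T \<longleftrightarrow> is_terminal (Und K) T \<and>
     (\<forall>X\<in>Obj (Und K). \<forall>f\<in>hom (Und K) X T. \<forall>g\<in>hom (Und K) X T. \<exists>!\<alpha>. \<alpha> \<in> cells K f g)"

definition is_2product ::
    "('o, 'a, 't) twocat \<Rightarrow> 'o \<Rightarrow> 'o \<Rightarrow> 'o \<Rightarrow> 'a \<Rightarrow> 'a \<Rightarrow> bool" where
  "is_2product K A B P p q \<longleftrightarrow> is_product (Und K) A B P p q \<and>
     (\<forall>X\<in>Obj (Und K). \<forall>u\<in>hom (Und K) X P. \<forall>v\<in>hom (Und K) X P.
        \<forall>\<alpha>\<in>cells K (p \<cdot>\<^bsub>Und K\<^esub> u) (p \<cdot>\<^bsub>Und K\<^esub> v). \<forall>\<beta>\<in>cells K (q \<cdot>\<^bsub>Und K\<^esub> u) (q \<cdot>\<^bsub>Und K\<^esub> v).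
          \<exists>!\<gamma>. \<gamma> \<in> cells K u v \<and> HComp K (CIdt K p) \<gamma> = \<alpha> \<and> HComp K (CIdt K q) \<gamma> = \<beta>)"

text \<open>The 2-functor \<open>- \<times> B\<close>. On objects and 1-cells it is formed with the products chosen in the
  underlying category; any such product is a 2-product as soon as the 2-product of the two objects
  exists, since it is then isomorphic to it. On a 2-cell \<open>\<alpha> : f \<Rightarrow> g\<close> it is the unique
  2-cell \<open>f \<times> B \<Rightarrow> g \<times> B\<close> lying over \<open>\<alpha>\<close> and over the identity of the
  second projection.\<close>

definition prod_2functor :: "('o, 'a, 't) twocat \<Rightarrow> 'o \<Rightarrow> ('o, 'a, 't, 'o, 'a, 't) twofct" where
  "prod_2functor K B = \<lparr>
     FUnd = prod_functor (Und K) B,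
     FCell = (\<lambda>\<alpha>.
       let A = Dom (Und K) (CDom K \<alpha>); A' = Cod (Und K) (CDom K \<alpha>);
           p = prod_fst (Und K) A B; q = prod_snd (Und K) A B;
           p' = prod_fst (Und K) A' B; q' = prod_snd (Und K) A' B
       in THE \<gamma>. \<gamma> \<in> cells K (FAr (prod_functor (Und K) B) (CDom K \<alpha>))
                             (FAr (prod_functor (Und K) B) (CCod K \<alpha>)) \<and>
            HComp K (CIdt K p') \<gamma> = HComp K \<alpha> (CIdt K p) \<and>
            HComp K (CIdt K q') \<gamma> = CIdt K q) \<rparr>"

definition two_cartesian_closed :: "('o, 'a, 't) twocat \<Rightarrow> bool" where
  "two_cartesian_closed K \<longleftrightarrow> two_category K \<and>
     (\<exists>T. is_2terminal K T) \<and>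
     (\<forall>A\<in>Obj (Und K). \<forall>B\<in>Obj (Und K). \<exists>P p q. is_2product K A B P p q) \<and>
     (\<forall>B\<in>Obj (Und K). \<exists>G \<eta> \<epsilon>. is_2adjunction K K (prod_2functor K B) G \<eta> \<epsilon>)"


section \<open>Internal categories\<close>

text \<open>The composition arrow \<open>Cmp\<close> is defined on the chosen pullback of \<open>Src\<close> along
  \<open>Tgt\<close>, the object of pairs \<open>(g, f)\<close> with \<open>Src g = Tgt f\<close>, and sends
  \<open>(g, f)\<close> to the composite of \<open>g\<close> after \<open>f\<close>.\<close>

record ('o, 'a) icat =
  IOb :: 'o
  IAr :: 'o
  Src :: 'a
  Tgt :: 'a
  Idn :: 'a
  Cmp :: 'a

definition cpair_ob :: "('o, 'a) cat \<Rightarrow> ('o, 'a) icat \<Rightarrow> 'o" where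
  "cpair_ob E X = pb_ob E (Src X) (Tgt X)"

definition cpair_fst :: "('o, 'a) cat \<Rightarrow> ('o, 'a) icat \<Rightarrow> 'a" where
  "cpair_fst E X = pb_fst E (Src X) (Tgt X)"

definition cpair_snd :: "('o, 'a) cat \<Rightarrow> ('o, 'a) icat \<Rightarrow> 'a" where
  "cpair_snd E X = pb_snd E (Src X) (Tgt X)"

definition cpair :: "('o, 'a) cat \<Rightarrow> ('o, 'a) icat \<Rightarrow> 'a \<Rightarrow> 'a \<Rightarrow> 'a" where
  "cpair E X g f = lift E (cpair_fst E X) (cpair_snd E X) g f"

text \<open>The associativity law lives on the object of composable triples \<open>((h, g), f)\<close>, the
  pullback of \<open>Src \<cdot> cpair_snd\<close> along \<open>Tgt\<close>, with projections \<open>u\<close> and \<open>v\<close>.\<close>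

definition is_icat :: "('o, 'a) cat \<Rightarrow> ('o, 'a) icat \<Rightarrow> bool" where
  "is_icat E X \<longleftrightarrow> IOb X \<in> Obj E \<and> IAr X \<in> Obj E \<and>
     Src X \<in> hom E (IAr X) (IOb X) \<and> Tgt X \<in> hom E (IAr X) (IOb X) \<and>
     Idn X \<in> hom E (IOb X) (IAr X) \<and> Cmp X \<in> hom E (cpair_ob E X) (IAr X) \<and>
     Src X \<cdot>\<^bsub>E\<^esub> Idn X = Idt E (IOb X) \<and> Tgt X \<cdot>\<^bsub>E\<^esub> Idn X = Idt E (IOb X) \<and>
     Src X \<cdot>\<^bsub>E\<^esub> Cmp X = Src X \<cdot>\<^bsub>E\<^esub> cpair_snd E X \<and>
     Tgt X \<cdot>\<^bsub>E\<^esub> Cmp X = Tgt X \<cdot>\<^bsub>E\<^esub> cpair_fst E X \<and>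
     Cmp X \<cdot>\<^bsub>E\<^esub> cpair E X (Idn X \<cdot>\<^bsub>E\<^esub> Tgt X) (Idt E (IAr X)) = Idt E (IAr X) \<and>
     Cmp X \<cdot>\<^bsub>E\<^esub> cpair E X (Idt E (IAr X)) (Idn X \<cdot>\<^bsub>E\<^esub> Src X) = Idt E (IAr X) \<and>
     (let u = pb_fst E (Src X \<cdot>\<^bsub>E\<^esub> cpair_snd E X) (Tgt X);
          v = pb_snd E (Src X \<cdot>\<^bsub>E\<^esub> cpair_snd E X) (Tgt X);
          h = cpair_fst E X \<cdot>\<^bsub>E\<^esub> u;
          g = cpair_snd E X \<cdot>\<^bsub>E\<^esub> u
      in Cmp X \<cdot>\<^bsub>E\<^esub> cpair E X (Cmp X \<cdot>\<^bsub>E\<^esub> u) v =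
         Cmp X \<cdot>\<^bsub>E\<^esub> cpair E X h (Cmp X \<cdot>\<^bsub>E\<^esub> cpair E X g v))"

record ('o, 'a) ifun =
  IDom :: "('o, 'a) icat"
  ICod :: "('o, 'a) icat"
  OnOb :: 'a
  OnAr :: 'a

definition is_ifun :: "('o, 'a) cat \<Rightarrow> ('o, 'a) ifun \<Rightarrow> bool" where
  "is_ifun E F \<longleftrightarrow>
     (let X = IDom F; Y = ICod F in
        is_icat E X \<and> is_icat E Y \<and>
        OnOb F \<in> hom E (IOb X) (IOb Y) \<and> OnAr F \<in> hom E (IAr X) (IAr Y) \<and>
        Src Y \<cdot>\<^bsub>E\<^esub> OnAr F = OnOb F \<cdot>\<^bsub>E\<^esub> Src X \<and>
        Tgt Y \<cdot>\<^bsub>E\<^esub> OnAr F = OnOb F \<cdot>\<^bsub>E\<^esub> Tgt X \<and>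
        OnAr F \<cdot>\<^bsub>E\<^esub> Idn X = Idn Y \<cdot>\<^bsub>E\<^esub> OnOb F \<and>
        OnAr F \<cdot>\<^bsub>E\<^esub> Cmp X =
          Cmp Y \<cdot>\<^bsub>E\<^esub> cpair E Y (OnAr F \<cdot>\<^bsub>E\<^esub> cpair_fst E X) (OnAr F \<cdot>\<^bsub>E\<^esub> cpair_snd E X))"

text \<open>An internal natural transformation \<open>F \<Rightarrow> G : X \<rightarrow> Y\<close> is an arrow from the objects of \<open>X\<close>
  to the arrows of \<open>Y\<close>; the last equation is the naturality square
  \<open>G f \<circ> \<alpha> (Src f) = \<alpha> (Tgt f) \<circ> F f\<close>.\<close>

record ('o, 'a) itrans =
  TDom :: "('o, 'a) ifun"
  TCod :: "('o, 'a) ifun"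
  Cmpt :: 'a

definition is_itrans :: "('o, 'a) cat \<Rightarrow> ('o, 'a) itrans \<Rightarrow> bool" where
  "is_itrans E \<alpha> \<longleftrightarrow>
     (let F = TDom \<alpha>; G = TCod \<alpha>; X = IDom F; Y = ICod F in
        is_ifun E F \<and> is_ifun E G \<and> IDom G = X \<and> ICod G = Y \<and>
        Cmpt \<alpha> \<in> hom E (IOb X) (IAr Y) \<and>
        Src Y \<cdot>\<^bsub>E\<^esub> Cmpt \<alpha> = OnOb F \<and> Tgt Y \<cdot>\<^bsub>E\<^esub> Cmpt \<alpha> = OnOb G \<and>
        Cmp Y \<cdot>\<^bsub>E\<^esub> cpair E Y (OnAr G) (Cmpt \<alpha> \<cdot>\<^bsub>E\<^esub> Src X) =
        Cmp Y \<cdot>\<^bsub>E\<^esub> cpair E Y (Cmpt \<alpha> \<cdot>\<^bsub>E\<^esub> Tgt X) (OnAr F))"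

definition Cat1 :: "('o, 'a) cat \<Rightarrow> (('o, 'a) icat, ('o, 'a) ifun) cat" where
  "Cat1 E = \<lparr>
     Obj = {X. is_icat E X},
     Arr = {F. is_ifun E F},
     Dom = IDom,
     Cod = ICod,
     Idt = (\<lambda>X. \<lparr> IDom = X, ICod = X, OnOb = Idt E (IOb X), OnAr = Idt E (IAr X) \<rparr>),
     Comp = (\<lambda>G F. \<lparr> IDom = IDom F, ICod = ICod G,
                      OnOb = OnOb G \<cdot>\<^bsub>E\<^esub> OnOb F, OnAr = OnAr G \<cdot>\<^bsub>E\<^esub> OnAr F \<rparr>) \<rparr>"

text \<open>For \<open>\<alpha> : F \<Rightarrow> G : X \<rightarrow> Y\<close> and \<open>\<beta> : H \<Rightarrow> K : Y \<rightarrow> Z\<close> the component of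
  the horizontal composite at \<open>x\<close> is \<open>\<beta> (G x) \<circ> H (\<alpha> x)\<close>.\<close>

definition Cat2 :: "('o, 'a) cat \<Rightarrow> (('o, 'a) icat, ('o, 'a) ifun, ('o, 'a) itrans) twocat" where
  "Cat2 E = \<lparr>
     Und = Cat1 E,
     Cell = {\<alpha>. is_itrans E \<alpha>},
     CDom = TDom,
     CCod = TCod,
     CIdt = (\<lambda>F. \<lparr> TDom = F, TCod = F, Cmpt = Idn (ICod F) \<cdot>\<^bsub>E\<^esub> OnOb F \<rparr>),
     VComp = (\<lambda>\<beta> \<alpha>. \<lparr> TDom = TDom \<alpha>, TCod = TCod \<beta>,
        Cmpt = Cmp (ICod (TDom \<alpha>)) \<cdot>\<^bsub>E\<^esub> cpair E (ICod (TDom \<alpha>)) (Cmpt \<beta>) (Cmpt \<alpha>) \<rparr>),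
     HComp = (\<lambda>\<beta> \<alpha>. \<lparr>
        TDom = TDom \<beta> \<cdot>\<^bsub>Cat1 E\<^esub> TDom \<alpha>,
        TCod = TCod \<beta> \<cdot>\<^bsub>Cat1 E\<^esub> TCod \<alpha>,
        Cmpt = Cmp (ICod (TDom \<beta>)) \<cdot>\<^bsub>E\<^esub>
          cpair E (ICod (TDom \<beta>)) (Cmpt \<beta> \<cdot>\<^bsub>E\<^esub> OnOb (TCod \<alpha>)) (OnAr (TDom \<beta>) \<cdot>\<^bsub>E\<^esub> Cmpt \<alpha>) \<rparr>) \<rparr>"

text \<open>The composable pairs of the discrete category on \<open>X\<close> form the pullback of the identity of
  \<open>X\<close> along itself. Its two projections to \<open>X\<close> are equal and invertible, and identify it with
  \<open>X\<close>; under this identification the composition is the identity.\<close>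

definition disc_ob :: "('o, 'a) cat \<Rightarrow> 'o \<Rightarrow> ('o, 'a) icat" where
  "disc_ob E X = \<lparr> IOb = X, IAr = X, Src = Idt E X, Tgt = Idt E X, Idn = Idt E X,
     Cmp = pb_fst E (Idt E X) (Idt E X) \<rparr>"

definition disc :: "('o, 'a) cat \<Rightarrow> ('o, 'a, ('o, 'a) icat, ('o, 'a) ifun) fct" where
  "disc E = \<lparr>
     FOb = disc_ob E,
     FAr = (\<lambda>f. \<lparr> IDom = disc_ob E (Dom E f), ICod = disc_ob E (Cod E f), OnOb = f, OnAr = f \<rparr>) \<rparr>"

end

theory Submission
  imports Defs
begin

text \<open>Exponentials are treated as universal arrows from \<open>- \<times> B\<close>. Arrows of an internal category are
  handled as generalized elements, so that at every stage it is an ordinary category.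

  If \<open>E\<close> is cartesian closed, then for internal categories \<open>B\<close>, \<open>Y\<close> the functor sending \<open>Z\<close> to the
  set of internal functors \<open>disc Z \<times> B \<rightarrow> Y\<close> is representable: it is cut out of the power
  \<open>Y\<^sub>0\<^bsup>B\<^sub>0\<^esup> \<times> Y\<^sub>1\<^bsup>B\<^sub>1\<^esup>\<close> by equations between natural families, and each such
  equation defines an equalizer of transposes. The same holds for internal transformations. The two
  representing objects are the objects and the arrows of the internal category \<open>Y\<^bsup>B\<^esup>\<close>. An
  internal functor \<open>F : X \<times> B \<rightarrow> Y\<close> is recovered from its values on the arrows \<open>(n, 1)\<close> and \<open>(1, f)\<close>,
  since \<open>(n, f) = (n, 1) \<circ> (1, f)\<close>; this gives the universal property.

  Conversely \<open>disc\<close> is fully faithful, preserves products and is left adjoint to the functor of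
  objects, so the objects of \<open>(disc Y)\<^bsup>disc B\<^esup>\<close> form the exponential \<open>Y\<^sup>B\<close> in \<open>E\<close>. Finally an
  internal functor \<open>Z \<times> disc A \<rightarrow> disc Y\<close> is an arrow \<open>Z\<^sub>0 \<times> A \<rightarrow> Y\<close> coequalizing source and target;
  its transpose \<open>Z\<^sub>0 \<rightarrow> Y\<^sup>A\<close> coequalizes them too, so \<open>disc (Y\<^sup>A)\<close> has the universal property of
  \<open>(disc Y)\<^bsup>disc A\<^esup>\<close> and the comparison arrow is invertible.\<close>

text \<open>Two features of the encoding make generalized elements convenient. The products of
  \<open>E\<close> and of \<open>Cat1 E\<close> are chosen independently, so the objects of
  \<open>prod_ob (Cat1 E) X Y\<close> form a product of \<open>IOb X\<close> and
  \<open>IOb Y\<close> that need not be the one chosen in \<open>E\<close>; families indexed by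
  pairs of elements can be evaluated on either one without naming the isomorphism. Moreover
  \<open>icmp\<close> has a meaning only on composable pairs, so the equations that define a functor
  or a transformation cannot be imposed all at once: those on source and target must hold before
  those that compose can be stated, and the representing objects are cut out in stages.

  The object of transformations serves twice: as the arrows of the exponential, and as the reason
  why evaluation is universal for 2-cells too, a cell between functors into the exponential being an
  arrow into that object. Invertibility of the comparison is obtained for all choices of adjoints at
  once, because \<open>hom_comparison\<close> transposes a universal arrow and so mediates between
  two universal arrows to the same object.\<close>

lemma hom_iff: "f \<in> hom C A B \<longleftrightarrow> f \<in> Arr C \<and> Dom C f = A \<and> Cod C f = B"
  by (simp add: hom_def)

section \<open>Categories with chosen binary products\<close>

locale cat_base =
  fixes C :: "('o, 'a) cat" (structure)
  assumes category: "category C"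
begin

lemma dom_obj [simp]: "f \<in> Arr C \<Longrightarrow> Dom C f \<in> Obj C"
  and cod_obj [simp]: "f \<in> Arr C \<Longrightarrow> Cod C f \<in> Obj C"
  and idt_arr [simp]: "A \<in> Obj C \<Longrightarrow> Idt C A \<in> Arr C"
  and dom_idt [simp]: "A \<in> Obj C \<Longrightarrow> Dom C (Idt C A) = A"
  and cod_idt [simp]: "A \<in> Obj C \<Longrightarrow> Cod C (Idt C A) = A"
  and comp_arr [simp]: "\<lbrakk>f \<in> Arr C; g \<in> Arr C; Dom C g = Cod C f\<rbrakk> \<Longrightarrow> g \<cdot> f \<in> Arr C"
  and dom_comp [simp]: "\<lbrakk>f \<in> Arr C; g \<in> Arr C; Dom C g = Cod C f\<rbrakk> \<Longrightarrow> Dom C (g \<cdot> f) = Dom C f"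
  and cod_comp [simp]: "\<lbrakk>f \<in> Arr C; g \<in> Arr C; Dom C g = Cod C f\<rbrakk> \<Longrightarrow> Cod C (g \<cdot> f) = Cod C g"
  and comp_idt [simp]: "\<lbrakk>f \<in> Arr C; Dom C f = A\<rbrakk> \<Longrightarrow> f \<cdot> Idt C A = f"
  and idt_comp [simp]: "\<lbrakk>f \<in> Arr C; Cod C f = A\<rbrakk> \<Longrightarrow> Idt C A \<cdot> f = f"
  and comp_assoc [simp]: "\<lbrakk>f \<in> Arr C; g \<in> Arr C; h \<in> Arr C; Dom C g = Cod C f; Dom C h = Cod C g\<rbrakk>
    \<Longrightarrow> (h \<cdot> g) \<cdot> f = h \<cdot> (g \<cdot> f)"
  using category by (auto simp: category_def hom_iff)

text \<open>Turns a commuting square into a rewrite rule for right-associated composites.\<close>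

lemma comp_ext:
  assumes "g \<cdot> f = k" "f \<in> Arr C" "g \<in> Arr C" "Dom C g = Cod C f" "x \<in> Arr C" "Cod C x = Dom C f"
  shows "g \<cdot> (f \<cdot> x) = k \<cdot> x"
  using assms comp_assoc[of x f g] by auto

lemma lift_props:
  assumes "is_product C A B P p q" "f \<in> Arr C" "g \<in> Arr C" "Dom C g = Dom C f"
    "Cod C f = A" "Cod C g = B"
  shows lift_arr: "lift C p q f g \<in> Arr C"
    and dom_lift: "Dom C (lift C p q f g) = Dom C f"
    and cod_lift: "Cod C (lift C p q f g) = P"
    and fst_lift: "p \<cdot> lift C p q f g = f"
    and snd_lift: "q \<cdot> lift C p q f g = g"
proof -
  have P: "Dom C p = P" using assms(1) by (auto simp: is_product_def hom_iff)
  have "\<exists>!u. u \<in> hom C (Dom C f) P \<and> p \<cdot> u = f \<and> q \<cdot> u = g"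
    using assms unfolding is_product_def by (auto simp: hom_iff)
  from theI'[OF this, folded P, folded lift_def] P
  show "lift C p q f g \<in> Arr C" "Dom C (lift C p q f g) = Dom C f" "Cod C (lift C p q f g) = P"
    "p \<cdot> lift C p q f g = f" "q \<cdot> lift C p q f g = g"
    by (auto simp: hom_iff)
qed

lemma product_proj:
  assumes "is_product C A B P p q"
  shows "P \<in> Obj C" "p \<in> Arr C" "Dom C p = P" "Cod C p = A" "q \<in> Arr C" "Dom C q = P" "Cod C q = B"
  using assms by (auto simp: is_product_def hom_iff)

lemma product_eqI:
  assumes "is_product C A B P p q" "u \<in> Arr C" "v \<in> Arr C" "Dom C v = Dom C u"
    "Cod C u = P" "Cod C v = P" "p \<cdot> u = p \<cdot> v" "q \<cdot> u = q \<cdot> v"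
  shows "u = v"
proof -
  have "\<exists>!w. w \<in> hom C (Dom C u) P \<and> p \<cdot> w = p \<cdot> u \<and> q \<cdot> w = q \<cdot> u"
    using assms unfolding is_product_def by (auto simp: hom_iff)
  with assms show ?thesis by (auto simp: hom_iff)
qed

lemma lift_comp:
  assumes pr: "is_product C A B P p q" and "f \<in> Arr C" "g \<in> Arr C" "Dom C g = Dom C f"
    "Cod C f = A" "Cod C g = B" "w \<in> Arr C" "Cod C w = Dom C f"
  shows "lift C p q f g \<cdot> w = lift C p q (f \<cdot> w) (g \<cdot> w)"
proof -
  note [simp] = product_proj[OF pr] lift_props[OF pr] comp_ext[OF fst_lift[OF pr]]
    comp_ext[OF snd_lift[OF pr]] assms(2-)
  show ?thesis by - (rule product_eqI[OF pr], simp_all)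
qed

lemma fst_lift_comp:
  assumes pr: "is_product C A B P p q" and "f \<in> Arr C" "g \<in> Arr C" "Dom C g = Dom C f"
    "Cod C f = A" "Cod C g = B" "w \<in> Arr C" "Cod C w = Dom C f"
  shows "p \<cdot> (lift C p q f g \<cdot> w) = f \<cdot> w" and "q \<cdot> (lift C p q f g \<cdot> w) = g \<cdot> w"
  using assms(2-) by (simp_all add: lift_props[OF pr] lift_comp[OF pr])

lemma is_productI:
  assumes "P \<in> Obj C" "p \<in> hom C P A" "q \<in> hom C P B"
    and "\<And>X f g. \<lbrakk>f \<in> hom C X A; g \<in> hom C X B\<rbrakk> \<Longrightarrow> \<exists>u \<in> hom C X P. p \<cdot> u = f \<and> q \<cdot> u = g"
    and "\<And>X u v. \<lbrakk>u \<in> hom C X P; v \<in> hom C X P; p \<cdot> u = p \<cdot> v; q \<cdot> u = q \<cdot> v\<rbrakk> \<Longrightarrow> u = v"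
  shows "is_product C A B P p q"
  unfolding is_product_def
proof (intro conjI ballI ex_ex1I)
  fix X f g assume "f \<in> hom C X A" "g \<in> hom C X B"
  with assms(4) show "\<exists>u. u \<in> hom C X P \<and> p \<cdot> u = f \<and> q \<cdot> u = g" by blast
next
  fix X f g u v
  assume "u \<in> hom C X P \<and> p \<cdot> u = f \<and> q \<cdot> u = g" "v \<in> hom C X P \<and> p \<cdot> v = f \<and> q \<cdot> v = g"
  with assms(5) show "u = v" by metis
qed (use assms in auto)

text \<open>Each composite of the two mutual lifts has the same projections as an identity. It
  serves to relate an arbitrary product of \<open>Cat1 E\<close> to the levelwise one.\<close>

lemma product_comparison:
  assumes pr: "is_product C A B P p q" and pr': "is_product C A B P' p' q'"
  obtains k l where "k \<in> hom C P P'" "l \<in> hom C P' P" "p' \<cdot> k = p" "q' \<cdot> k = q" "p \<cdot> l = p'" "q \<cdot> l = q'"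
    "l \<cdot> k = Idt C P" "k \<cdot> l = Idt C P'"
proof -
  note [simp] = product_proj[OF pr] product_proj[OF pr']
    lift_props[OF pr] lift_props[OF pr'] lift_comp[OF pr] lift_comp[OF pr']
  let ?k = "lift C p' q' p q" and ?l = "lift C p q p' q'"
  have "lift C p q p q = Idt C P" by - (rule product_eqI[OF pr], simp_all)
  moreover have "lift C p' q' p' q' = Idt C P'" by (rule product_eqI[OF pr']) simp_all
  ultimately show thesis by (intro that[of ?k ?l]) (auto simp: hom_iff)
qed

lemma product_transport:
  assumes pr: "is_product C A B P p q"
    and k: "k \<in> hom C P' P" "l \<in> hom C P P'" "l \<cdot> k = Idt C P'" "k \<cdot> l = Idt C P"
  shows "is_product C A B P' (p \<cdot> k) (q \<cdot> k)"
proof -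
  have [simp]: "k \<in> Arr C" "l \<in> Arr C" "Dom C k = P'" "Cod C k = P" "Dom C l = P" "Cod C l = P'"
    using k by (auto simp: hom_iff)
  have [simp]: "P' \<in> Obj C" using dom_obj[of k] by simp
  note [simp] = product_proj[OF pr] lift_props[OF pr] k(3,4) comp_ext[OF k(3)] comp_ext[OF k(4)]
  show ?thesis
  proof (rule is_productI)
    fix X f g assume "f \<in> hom C X A" "g \<in> hom C X B"
    then show "\<exists>u\<in>hom C X P'. (p \<cdot> k) \<cdot> u = f \<and> (q \<cdot> k) \<cdot> u = g"
      by (intro bexI[of _ "l \<cdot> lift C p q f g"]) (auto simp: hom_iff)
  next
    fix X u v assume uv: "u \<in> hom C X P'" "v \<in> hom C X P'" "(p \<cdot> k) \<cdot> u = (p \<cdot> k) \<cdot> v" "(q \<cdot> k) \<cdot> u = (q \<cdot> k) \<cdot> v"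
    then have "k \<cdot> u = k \<cdot> v" by - (rule product_eqI[OF pr], (auto simp: hom_iff))
    then have "l \<cdot> (k \<cdot> u) = l \<cdot> (k \<cdot> v)" by simp
    then show "u = v" using uv by (simp add: hom_iff)
  qed (auto simp: hom_iff)
qed

end

locale prod_cat = cat_base C for C :: "('o, 'a) cat" (structure) +
  assumes products: "\<lbrakk>A \<in> Obj C; B \<in> Obj C\<rbrakk> \<Longrightarrow> \<exists>P p q. is_product C A B P p q"
begin

lemma prod_is_product:
  assumes "A \<in> Obj C" "B \<in> Obj C"
  shows "is_product C A B (prod_ob C A B) (prod_fst C A B) (prod_snd C A B)"
proof -
  have "\<exists>x. case x of (P, p, q) \<Rightarrow> is_product C A B P p q" using products[OF assms] by auto
  from someI_ex[OF this] show ?thesis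
    by (auto simp: prod_ob_def prod_fst_def prod_snd_def chosen_product_def split: prod.splits)
qed

lemmas prod_simps [simp] = product_proj[OF prod_is_product]
lemmas pair_simps [simp] = lift_props[OF prod_is_product] fst_lift_comp[OF prod_is_product]
lemmas pair_comp = lift_comp[OF prod_is_product]
lemmas prod_eqI = product_eqI[OF prod_is_product]

lemma FOb_prod [simp]: "FOb (prod_functor C B) A = prod_ob C A B"
  by (simp add: prod_functor_def)

lemma FAr_prod:
  assumes "u \<in> Arr C" "B \<in> Obj C"
  shows "FAr (prod_functor C B) u \<in> Arr C"
    and "Dom C (FAr (prod_functor C B) u) = prod_ob C (Dom C u) B"
    and "Cod C (FAr (prod_functor C B) u) = prod_ob C (Cod C u) B"
  using assms by (simp_all add: prod_functor_def)

lemma proj_FAr_prod: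
  assumes "u \<in> Arr C" "B \<in> Obj C" "Cod C u = A"
  shows "prod_fst C A B \<cdot> FAr (prod_functor C B) u = u \<cdot> prod_fst C (Dom C u) B"
    and "prod_snd C A B \<cdot> FAr (prod_functor C B) u = prod_snd C (Dom C u) B"
  using assms by (auto simp: prod_functor_def)

declare FAr_prod [simp] proj_FAr_prod [simp]

lemma proj_FAr_prod_comp [simp]:
  assumes "u \<in> Arr C" "B \<in> Obj C" "Cod C u = A" "x \<in> Arr C" "Cod C x = prod_ob C (Dom C u) B"
  shows "prod_fst C A B \<cdot> (FAr (prod_functor C B) u \<cdot> x) = u \<cdot> (prod_fst C (Dom C u) B \<cdot> x)"
    and "prod_snd C A B \<cdot> (FAr (prod_functor C B) u \<cdot> x) = prod_snd C (Dom C u) B \<cdot> x"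
  using assms comp_ext[OF proj_FAr_prod(1)[of u B A], of x] comp_ext[OF proj_FAr_prod(2)[of u B A], of x]
  by auto

lemma is_functor_prod:
  assumes "B \<in> Obj C"
  shows "is_functor C C (prod_functor C B)"
  unfolding is_functor_def
proof (intro conjI ballI impI)
  fix A assume "A \<in> Obj C"
  with assms show "FAr (prod_functor C B) (Idt C A) = Idt C (FOb (prod_functor C B) A)"
    by - (rule prod_eqI[of A B], simp_all)
next
  fix f g assume "f \<in> Arr C" "g \<in> Arr C" "Dom C g = Cod C f"
  with assms show "FAr (prod_functor C B) (g \<cdot> f) = FAr (prod_functor C B) g \<cdot> FAr (prod_functor C B) f"
    by - (rule prod_eqI[of "Cod C g" B], simp_all)
qed (use assms in \<open>simp_all add: hom_iff\<close>)

end

section \<open>Universal arrows and adjunctions\<close>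

text \<open>\<open>(H, e)\<close> is a terminal object of the comma category of \<open>F\<close>
  over \<open>Y\<close>. Unlike an adjunction, this can be produced for one \<open>Y\<close> at a
  time.\<close>

definition is_universal :: "('o, 'a) cat \<Rightarrow> ('p, 'b) cat \<Rightarrow> ('o, 'a, 'p, 'b) fct \<Rightarrow> 'p \<Rightarrow> 'o \<Rightarrow> 'b \<Rightarrow> bool" where
  "is_universal C D F Y H e \<longleftrightarrow> H \<in> Obj C \<and> e \<in> hom D (FOb F H) Y \<and>
     (\<forall>Z\<in>Obj C. \<forall>f\<in>hom D (FOb F Z) Y. \<exists>!u. u \<in> hom C Z H \<and> e \<cdot>\<^bsub>D\<^esub> FAr F u = f)"

locale functor_loc = C: cat_base C + D: cat_base D
  for C :: "('o, 'a) cat" and D :: "('p, 'b) cat" and F :: "('o, 'a, 'p, 'b) fct" +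
  assumes is_functor: "is_functor C D F"
begin

lemma functor_simps [simp]:
  shows "A \<in> Obj C \<Longrightarrow> FOb F A \<in> Obj D"
    and "f \<in> Arr C \<Longrightarrow> FAr F f \<in> Arr D"
    and "f \<in> Arr C \<Longrightarrow> Dom D (FAr F f) = FOb F (Dom C f)"
    and "f \<in> Arr C \<Longrightarrow> Cod D (FAr F f) = FOb F (Cod C f)"
    and "A \<in> Obj C \<Longrightarrow> FAr F (Idt C A) = Idt D (FOb F A)"
    and "\<lbrakk>f \<in> Arr C; g \<in> Arr C; Dom C g = Cod C f\<rbrakk> \<Longrightarrow> FAr F (g \<cdot>\<^bsub>C\<^esub> f) = FAr F g \<cdot>\<^bsub>D\<^esub> FAr F f"
  using is_functor by (auto simp: is_functor_def hom_iff)

text \<open>Naturality of the counit at \<open>f\<close> brings \<open>f\<close> to the front, and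
  the first triangle identity removes the rest. The formula for the transpose is the one by which
  \<open>hom_comparison\<close> is defined.\<close>

lemma adjunction_transpose:
  assumes adj: "is_adjunction C D F G \<eta> \<epsilon>" and Z: "Z \<in> Obj C" and f: "f \<in> hom D (FOb F Z) Y"
  shows "FAr G f \<cdot>\<^bsub>C\<^esub> \<eta> Z \<in> hom C Z (FOb G Y)"
    and "\<epsilon> Y \<cdot>\<^bsub>D\<^esub> FAr F (FAr G f \<cdot>\<^bsub>C\<^esub> \<eta> Z) = f"
proof -
  interpret G: functor_loc D C G
    using adj by unfold_locales (simp add: is_adjunction_def)
  note [simp] = Z f[unfolded hom_iff]
  have \<eta>: "\<And>A. A \<in> Obj C \<Longrightarrow> \<eta> A \<in> hom C A (FOb G (FOb F A))"
    and \<epsilon>: "\<And>B. B \<in> Obj D \<Longrightarrow> \<epsilon> B \<in> hom D (FOb F (FOb G B)) B"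
    and \<epsilon>nat: "\<And>g. g \<in> Arr D \<Longrightarrow> \<epsilon> (Cod D g) \<cdot>\<^bsub>D\<^esub> FAr F (FAr G g) = g \<cdot>\<^bsub>D\<^esub> \<epsilon> (Dom D g)"
    and tri: "\<And>A. A \<in> Obj C \<Longrightarrow> \<epsilon> (FOb F A) \<cdot>\<^bsub>D\<^esub> FAr F (\<eta> A) = Idt D (FOb F A)"
    using adj by (auto simp: is_adjunction_def is_nattrans_def id_functor_def comp_functor_def)
  note [simp] = \<eta>[unfolded hom_iff] \<epsilon>[unfolded hom_iff]
  have Y: "Y \<in> Obj D" using D.cod_obj[of f] by simp
  show "FAr G f \<cdot>\<^bsub>C\<^esub> \<eta> Z \<in> hom C Z (FOb G Y)" by (simp add: hom_iff)
  have "\<epsilon> Y \<cdot>\<^bsub>D\<^esub> FAr F (FAr G f \<cdot>\<^bsub>C\<^esub> \<eta> Z) = (\<epsilon> Y \<cdot>\<^bsub>D\<^esub> FAr F (FAr G f)) \<cdot>\<^bsub>D\<^esub> FAr F (\<eta> Z)"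
    using Y by simp
  also have "\<dots> = f \<cdot>\<^bsub>D\<^esub> (\<epsilon> (FOb F Z) \<cdot>\<^bsub>D\<^esub> FAr F (\<eta> Z))" using \<epsilon>nat[of f] by simp
  also have "\<dots> = f" by (simp add: tri)
  finally show "\<epsilon> Y \<cdot>\<^bsub>D\<^esub> FAr F (FAr G f \<cdot>\<^bsub>C\<^esub> \<eta> Z) = f" .
qed

text \<open>Existence is the transpose; any solution \<open>u\<close> equals it by naturality of the
  unit at \<open>u\<close> and the second triangle identity.\<close>

lemma adjunction_universal:
  assumes adj: "is_adjunction C D F G \<eta> \<epsilon>" and Y: "Y \<in> Obj D"
  shows "is_universal C D F Y (FOb G Y) (\<epsilon> Y)"
  unfolding is_universal_def
proof (intro conjI ballI)
  interpret G: functor_loc D C G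
    using adj by unfold_locales (simp add: is_adjunction_def)
  have \<eta>: "\<And>A. A \<in> Obj C \<Longrightarrow> \<eta> A \<in> hom C A (FOb G (FOb F A))"
    and \<epsilon>: "\<And>B. B \<in> Obj D \<Longrightarrow> \<epsilon> B \<in> hom D (FOb F (FOb G B)) B"
    and \<eta>nat: "\<And>g. g \<in> Arr C \<Longrightarrow> \<eta> (Cod C g) \<cdot>\<^bsub>C\<^esub> g = FAr G (FAr F g) \<cdot>\<^bsub>C\<^esub> \<eta> (Dom C g)"
    and tri: "\<And>B. B \<in> Obj D \<Longrightarrow> FAr G (\<epsilon> B) \<cdot>\<^bsub>C\<^esub> \<eta> (FOb G B) = Idt C (FOb G B)"
    using adj by (auto simp: is_adjunction_def is_nattrans_def id_functor_def comp_functor_def)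
  note [simp] = \<eta>[unfolded hom_iff] \<epsilon>[unfolded hom_iff] Y
  show "FOb G Y \<in> Obj C" "\<epsilon> Y \<in> hom D (FOb F (FOb G Y)) Y" by (simp_all add: hom_iff)
  fix Z f assume Z: "Z \<in> Obj C" and f: "f \<in> hom D (FOb F Z) Y"
  show "\<exists>!u. u \<in> hom C Z (FOb G Y) \<and> \<epsilon> Y \<cdot>\<^bsub>D\<^esub> FAr F u = f"
  proof (rule ex1I)
    show "FAr G f \<cdot>\<^bsub>C\<^esub> \<eta> Z \<in> hom C Z (FOb G Y) \<and> \<epsilon> Y \<cdot>\<^bsub>D\<^esub> FAr F (FAr G f \<cdot>\<^bsub>C\<^esub> \<eta> Z) = f"
      using adjunction_transpose[OF adj Z f] by simp
    fix u assume u: "u \<in> hom C Z (FOb G Y) \<and> \<epsilon> Y \<cdot>\<^bsub>D\<^esub> FAr F u = f"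
    then have [simp]: "u \<in> Arr C" "Dom C u = Z" "Cod C u = FOb G Y" by (auto simp: hom_iff)
    have "FAr G f \<cdot>\<^bsub>C\<^esub> \<eta> Z = FAr G (\<epsilon> Y) \<cdot>\<^bsub>C\<^esub> (FAr G (FAr F u) \<cdot>\<^bsub>C\<^esub> \<eta> Z)"
      using u Z by auto
    also have "\<dots> = (FAr G (\<epsilon> Y) \<cdot>\<^bsub>C\<^esub> \<eta> (FOb G Y)) \<cdot>\<^bsub>C\<^esub> u"
      using \<eta>nat[of u] by simp
    also have "\<dots> = u" by (simp add: tri)
    finally show "u = FAr G f \<cdot>\<^bsub>C\<^esub> \<eta> Z" by simp
  qed
qed

lemma universal_unique:
  assumes "is_universal C D F Y H e" "u \<in> Arr C" "v \<in> Arr C" "Dom C v = Dom C u" "Cod C u = H" "Cod C v = H"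
    "e \<cdot>\<^bsub>D\<^esub> FAr F u = e \<cdot>\<^bsub>D\<^esub> FAr F v"
  shows "u = v"
proof -
  have "e \<cdot>\<^bsub>D\<^esub> FAr F u \<in> hom D (FOb F (Dom C u)) Y"
    using assms by (auto simp: is_universal_def hom_iff)
  then have "\<exists>!w. w \<in> hom C (Dom C u) H \<and> e \<cdot>\<^bsub>D\<^esub> FAr F w = e \<cdot>\<^bsub>D\<^esub> FAr F u"
    using assms by (auto simp: is_universal_def)
  with assms show ?thesis by (auto simp: hom_iff)
qed

text \<open>Terminal objects of a comma category are isomorphic: \<open>v\<close> comes from the
  universal property of \<open>e\<close>, and the composites of \<open>u\<close> and
  \<open>v\<close> become identities after cancelling \<open>e\<close> and
  \<open>e'\<close>.\<close>

lemma universal_iso: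
  assumes U: "is_universal C D F Y H e" and U': "is_universal C D F Y H' e'"
    and u: "u \<in> hom C H H'" "e' \<cdot>\<^bsub>D\<^esub> FAr F u = e"
  shows "is_iso C u"
proof -
  have [simp]: "H \<in> Obj C" "H' \<in> Obj C" "e \<in> Arr D" "e' \<in> Arr D" "Dom D e = FOb F H" "Dom D e' = FOb F H'"
      "Cod D e = Y" "Cod D e' = Y" "u \<in> Arr C" "Dom C u = H" "Cod C u = H'"
    using U U' u by (auto simp: is_universal_def hom_iff)
  obtain v where v: "v \<in> hom C H' H" "e \<cdot>\<^bsub>D\<^esub> FAr F v = e'"
    using U U' unfolding is_universal_def by metis
  have [simp]: "v \<in> Arr C" "Dom C v = H'" "Cod C v = H" using v by (auto simp: hom_iff)
  note ext = D.comp_ext[OF u(2)] D.comp_ext[OF v(2)]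
  have "v \<cdot>\<^bsub>C\<^esub> u = Idt C H" by (rule universal_unique[OF U]) (simp_all add: ext u v)
  moreover have "u \<cdot>\<^bsub>C\<^esub> v = Idt C H'" by (rule universal_unique[OF U']) (simp_all add: ext u v)
  ultimately show ?thesis using v by (auto simp: is_iso_def)
qed

end

locale universal_arrows = functor_loc C D F
  for C :: "('o, 'a) cat" and D :: "('p, 'b) cat" and F :: "('o, 'a, 'p, 'b) fct" +
  fixes H :: "'p \<Rightarrow> 'o" and e :: "'p \<Rightarrow> 'b"
  assumes universal: "Y \<in> Obj D \<Longrightarrow> is_universal C D F Y (H Y) (e Y)"
begin

definition transpose :: "'o \<Rightarrow> 'b \<Rightarrow> 'a" where
  "transpose Z f = (THE u. u \<in> hom C Z (H (Cod D f)) \<and> e (Cod D f) \<cdot>\<^bsub>D\<^esub> FAr F u = f)"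

lemma universal_simps [simp]:
  assumes "Y \<in> Obj D"
  shows "H Y \<in> Obj C" "e Y \<in> Arr D" "Dom D (e Y) = FOb F (H Y)" "Cod D (e Y) = Y"
  using universal[OF assms] by (auto simp: is_universal_def hom_iff)

lemma transpose [simp]:
  assumes "f \<in> Arr D" "Z \<in> Obj C" "Dom D f = FOb F Z"
  shows "transpose Z f \<in> Arr C" "Dom C (transpose Z f) = Z" "Cod C (transpose Z f) = H (Cod D f)"
  and e_transpose: "Y = Cod D f \<Longrightarrow> e Y \<cdot>\<^bsub>D\<^esub> FAr F (transpose Z f) = f"
proof -
  have "\<exists>!u. u \<in> hom C Z (H (Cod D f)) \<and> e (Cod D f) \<cdot>\<^bsub>D\<^esub> FAr F u = f"
    using universal[of "Cod D f"] assms by (auto simp: is_universal_def hom_iff)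
  from theI'[OF this, folded transpose_def]
  show "transpose Z f \<in> Arr C" "Dom C (transpose Z f) = Z" "Cod C (transpose Z f) = H (Cod D f)"
    "Y = Cod D f \<Longrightarrow> e Y \<cdot>\<^bsub>D\<^esub> FAr F (transpose Z f) = f"
    by (auto simp: hom_iff)
qed

lemma e_transpose_comp [simp]:
  assumes "f \<in> Arr D" "Z \<in> Obj C" "Dom D f = FOb F Z" "Y = Cod D f" "x \<in> Arr D" "Cod D x = FOb F Z"
  shows "e Y \<cdot>\<^bsub>D\<^esub> (FAr F (transpose Z f) \<cdot>\<^bsub>D\<^esub> x) = f \<cdot>\<^bsub>D\<^esub> x"
  using assms D.comp_ext[OF e_transpose[of f Z Y], of x] by simp

lemmas arrow_eqI = universal_unique[OF universal]

text \<open>The action on arrows is forced: it is the only one for which \<open>e\<close> is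
  natural.\<close>

definition right_adjoint :: "('p, 'b, 'o, 'a) fct" where
  "right_adjoint = \<lparr> FOb = H, FAr = (\<lambda>f. transpose (H (Dom D f)) (f \<cdot>\<^bsub>D\<^esub> e (Dom D f))) \<rparr>"

definition adj_unit :: "'o \<Rightarrow> 'a" where
  "adj_unit Z = transpose Z (Idt D (FOb F Z))"

lemma right_adjoint_simps [simp]:
  "FOb right_adjoint = H"
  "FAr right_adjoint = (\<lambda>f. transpose (H (Dom D f)) (f \<cdot>\<^bsub>D\<^esub> e (Dom D f)))"
  by (simp_all add: right_adjoint_def)

text \<open>An arrow into \<open>H Y\<close> is determined by what it becomes under
  \<open>e Y\<close>, so every law in \<open>C\<close> is checked after applying \<open>e\<close>,
  where the transposes cancel.\<close>

lemma is_adjunction: "is_adjunction C D F right_adjoint adj_unit e"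
  unfolding is_adjunction_def
proof (intro conjI)
  show "is_functor D C right_adjoint"
    unfolding is_functor_def
  proof (intro conjI ballI impI)
    fix B assume "B \<in> Obj D"
    then show "FAr right_adjoint (Idt D B) = Idt C (FOb right_adjoint B)"
      by - (rule arrow_eqI[of B], simp_all)
  next
    fix f g assume "f \<in> Arr D" "g \<in> Arr D" "Dom D g = Cod D f"
    then show "FAr right_adjoint (g \<cdot>\<^bsub>D\<^esub> f) = FAr right_adjoint g \<cdot>\<^bsub>C\<^esub> FAr right_adjoint f"
      by - (rule arrow_eqI[of "Cod D g"], simp_all)
  qed (simp_all add: hom_iff)
  show "is_nattrans C C id_functor (comp_functor right_adjoint F) adj_unit"
    unfolding is_nattrans_def id_functor_def comp_functor_def
  proof (intro conjI ballI)
    fix f assume "f \<in> Arr C"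
    then show "adj_unit (Cod C f) \<cdot>\<^bsub>C\<^esub> FAr \<lparr>FOb = \<lambda>A. A, FAr = \<lambda>f. f\<rparr> f =
        FAr \<lparr>FOb = \<lambda>A. FOb right_adjoint (FOb F A), FAr = \<lambda>f. FAr right_adjoint (FAr F f)\<rparr> f \<cdot>\<^bsub>C\<^esub> adj_unit (Dom C f)"
      by - (rule arrow_eqI[of "FOb F (Cod C f)"], simp_all add: adj_unit_def)
  qed (simp add: adj_unit_def hom_iff)
  show "is_nattrans D D (comp_functor F right_adjoint) id_functor e"
    by (simp add: is_nattrans_def id_functor_def comp_functor_def hom_iff)
  show "\<forall>A\<in>Obj C. e (FOb F A) \<cdot>\<^bsub>D\<^esub> FAr F (adj_unit A) = Idt D (FOb F A)"
    by (simp add: adj_unit_def)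
  show "\<forall>B\<in>Obj D. FAr right_adjoint (e B) \<cdot>\<^bsub>C\<^esub> adj_unit (FOb right_adjoint B) = Idt C (FOb right_adjoint B)"
  proof
    fix B assume "B \<in> Obj D"
    then show "FAr right_adjoint (e B) \<cdot>\<^bsub>C\<^esub> adj_unit (FOb right_adjoint B) = Idt C (FOb right_adjoint B)"
      by - (rule arrow_eqI[of B], simp_all add: adj_unit_def)
  qed
qed (rule is_functor)

end

section \<open>2-categories with 2-products and 2-universal arrows\<close>

locale twocat =
  fixes K :: "('o, 'a, 't) twocat"
  assumes two_category: "two_category K"
begin

sublocale U: cat_base "Und K"
  using two_category by unfold_locales (simp add: two_category_def)

abbreviation hcomp (infixr "\<star>" 70) where "\<beta> \<star> \<alpha> \<equiv> HComp K \<beta> \<alpha>"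
abbreviation vcomp (infixr "\<bullet>" 70) where "\<beta> \<bullet> \<alpha> \<equiv> VComp K \<beta> \<alpha>"

lemma cell_arr [simp]: "\<alpha> \<in> Cell K \<Longrightarrow> CDom K \<alpha> \<in> Arr (Und K)" "\<alpha> \<in> Cell K \<Longrightarrow> CCod K \<alpha> \<in> Arr (Und K)"
  and cidt_cell [simp]: "f \<in> Arr (Und K) \<Longrightarrow> CIdt K f \<in> Cell K"
  and cdom_cidt [simp]: "f \<in> Arr (Und K) \<Longrightarrow> CDom K (CIdt K f) = f"
  and ccod_cidt [simp]: "f \<in> Arr (Und K) \<Longrightarrow> CCod K (CIdt K f) = f"
  and vcomp_cell [simp]: "\<lbrakk>\<alpha> \<in> Cell K; \<beta> \<in> Cell K; CDom K \<beta> = CCod K \<alpha>\<rbrakk> \<Longrightarrow> \<beta> \<bullet> \<alpha> \<in> Cell K"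
  and cdom_vcomp [simp]: "\<lbrakk>\<alpha> \<in> Cell K; \<beta> \<in> Cell K; CDom K \<beta> = CCod K \<alpha>\<rbrakk> \<Longrightarrow> CDom K (\<beta> \<bullet> \<alpha>) = CDom K \<alpha>"
  and ccod_vcomp [simp]: "\<lbrakk>\<alpha> \<in> Cell K; \<beta> \<in> Cell K; CDom K \<beta> = CCod K \<alpha>\<rbrakk> \<Longrightarrow> CCod K (\<beta> \<bullet> \<alpha>) = CCod K \<beta>"
  and vcomp_idt: "f \<in> Arr (Und K) \<Longrightarrow> CIdt K f \<bullet> CIdt K f = CIdt K f"
proof -
  have V: "cat_base (vertical K)"
    using two_category by unfold_locales (simp add: two_category_def)
  interpret V: cat_base "vertical K" by (rule V)
  show "\<alpha> \<in> Cell K \<Longrightarrow> CDom K \<alpha> \<in> Arr (Und K)" "\<alpha> \<in> Cell K \<Longrightarrow> CCod K \<alpha> \<in> Arr (Und K)"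
    using V.dom_obj[of \<alpha>] V.cod_obj[of \<alpha>] by (simp_all add: vertical_def)
  show "f \<in> Arr (Und K) \<Longrightarrow> CIdt K f \<in> Cell K" "f \<in> Arr (Und K) \<Longrightarrow> CDom K (CIdt K f) = f"
    "f \<in> Arr (Und K) \<Longrightarrow> CCod K (CIdt K f) = f"
    using V.idt_arr[of f] V.dom_idt[of f] V.cod_idt[of f] by (simp_all add: vertical_def)
  show "f \<in> Arr (Und K) \<Longrightarrow> CIdt K f \<bullet> CIdt K f = CIdt K f"
    using V.comp_idt[of "Idt (vertical K) f" f] V.idt_arr[of f] V.dom_idt[of f] by (simp add: vertical_def)
  assume "\<alpha> \<in> Cell K" "\<beta> \<in> Cell K" "CDom K \<beta> = CCod K \<alpha>"
  then show "\<beta> \<bullet> \<alpha> \<in> Cell K" "CDom K (\<beta> \<bullet> \<alpha>) = CDom K \<alpha>" "CCod K (\<beta> \<bullet> \<alpha>) = CCod K \<beta>"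
    using V.comp_arr[of \<alpha> \<beta>] V.dom_comp[of \<alpha> \<beta>] V.cod_comp[of \<alpha> \<beta>] by (simp_all add: vertical_def)
qed

lemma ccod_dom [simp]: "\<alpha> \<in> Cell K \<Longrightarrow> Dom (Und K) (CCod K \<alpha>) = Dom (Und K) (CDom K \<alpha>)"
  and ccod_cod [simp]: "\<alpha> \<in> Cell K \<Longrightarrow> Cod (Und K) (CCod K \<alpha>) = Cod (Und K) (CDom K \<alpha>)"
  using two_category by (auto simp: two_category_def)

lemma hcomp_simps [simp]:
  assumes "\<alpha> \<in> Cell K" "\<beta> \<in> Cell K" "Dom (Und K) (CDom K \<beta>) = Cod (Und K) (CDom K \<alpha>)"
  shows "\<beta> \<star> \<alpha> \<in> Cell K"
    and "CDom K (\<beta> \<star> \<alpha>) = CDom K \<beta> \<cdot>\<^bsub>Und K\<^esub> CDom K \<alpha>"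
    and "CCod K (\<beta> \<star> \<alpha>) = CCod K \<beta> \<cdot>\<^bsub>Und K\<^esub> CCod K \<alpha>"
proof -
  have "\<beta> \<star> \<alpha> \<in> cells K (CDom K \<beta> \<cdot>\<^bsub>Und K\<^esub> CDom K \<alpha>) (CCod K \<beta> \<cdot>\<^bsub>Und K\<^esub> CCod K \<alpha>)"
    using assms two_category by (simp add: two_category_def hcomposable_def)
  then show "\<beta> \<star> \<alpha> \<in> Cell K" "CDom K (\<beta> \<star> \<alpha>) = CDom K \<beta> \<cdot>\<^bsub>Und K\<^esub> CDom K \<alpha>"
    "CCod K (\<beta> \<star> \<alpha>) = CCod K \<beta> \<cdot>\<^bsub>Und K\<^esub> CCod K \<alpha>"
    by (auto simp: cells_def)
qed

lemma hcomp_idt [simp]: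
  "\<lbrakk>\<alpha> \<in> Cell K; Cod (Und K) (CDom K \<alpha>) = A\<rbrakk> \<Longrightarrow> CIdt K (Idt (Und K) A) \<star> \<alpha> = \<alpha>"
  "\<lbrakk>\<alpha> \<in> Cell K; Dom (Und K) (CDom K \<alpha>) = A\<rbrakk> \<Longrightarrow> \<alpha> \<star> CIdt K (Idt (Und K) A) = \<alpha>"
  and hcomp_cidt [simp]: "\<lbrakk>f \<in> Arr (Und K); g \<in> Arr (Und K); Dom (Und K) g = Cod (Und K) f\<rbrakk>
    \<Longrightarrow> CIdt K g \<star> CIdt K f = CIdt K (g \<cdot>\<^bsub>Und K\<^esub> f)"
  using two_category by (auto simp: two_category_def)

lemma hcomp_assoc [simp]:
  assumes "\<alpha> \<in> Cell K" "\<beta> \<in> Cell K" "\<gamma> \<in> Cell K" "Dom (Und K) (CDom K \<beta>) = Cod (Und K) (CDom K \<alpha>)"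
    "Dom (Und K) (CDom K \<gamma>) = Cod (Und K) (CDom K \<beta>)"
  shows "(\<gamma> \<star> \<beta>) \<star> \<alpha> = \<gamma> \<star> (\<beta> \<star> \<alpha>)"
proof -
  have "hcomposable K \<beta> \<alpha> \<and> hcomposable K \<gamma> \<beta>" using assms by (simp add: hcomposable_def)
  then show ?thesis using two_category unfolding two_category_def by blast
qed

lemma hcomp_cidt_ext [simp]:
  assumes "f \<in> Arr (Und K)" "g \<in> Arr (Und K)" "Dom (Und K) g = Cod (Und K) f" "\<alpha> \<in> Cell K"
    "Dom (Und K) f = Cod (Und K) (CDom K \<alpha>)"
  shows "CIdt K g \<star> (CIdt K f \<star> \<alpha>) = CIdt K (g \<cdot>\<^bsub>Und K\<^esub> f) \<star> \<alpha>"
  using assms hcomp_assoc[of \<alpha> "CIdt K f" "CIdt K g"] by simp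

lemma hcomp_ext:
  assumes "\<beta> \<star> \<alpha> = \<delta>" "\<alpha> \<in> Cell K" "\<beta> \<in> Cell K" "Dom (Und K) (CDom K \<beta>) = Cod (Und K) (CDom K \<alpha>)"
    "\<xi> \<in> Cell K" "Cod (Und K) (CDom K \<xi>) = Dom (Und K) (CDom K \<alpha>)"
  shows "\<beta> \<star> (\<alpha> \<star> \<xi>) = \<delta> \<star> \<xi>"
  using assms hcomp_assoc[of \<xi> \<alpha> \<beta>] by auto

lemma interchange:
  assumes "\<alpha> \<in> Cell K" "\<alpha>' \<in> Cell K" "\<beta> \<in> Cell K" "\<beta>' \<in> Cell K" "CDom K \<alpha>' = CCod K \<alpha>"
    "CDom K \<beta>' = CCod K \<beta>" "Dom (Und K) (CDom K \<beta>) = Cod (Und K) (CDom K \<alpha>)"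
  shows "(\<beta>' \<bullet> \<beta>) \<star> (\<alpha>' \<bullet> \<alpha>) = (\<beta>' \<star> \<alpha>') \<bullet> (\<beta> \<star> \<alpha>)"
proof -
  have "hcomposable K \<beta> \<alpha>" using assms by (simp add: hcomposable_def)
  then show ?thesis using assms two_category unfolding two_category_def by blast
qed

text \<open>Interchange, with the identity cell of \<open>f\<close> written as its own vertical
  square.\<close>

lemma whisker_left:
  assumes "\<alpha> \<in> Cell K" "\<alpha>' \<in> Cell K" "CDom K \<alpha>' = CCod K \<alpha>" "f \<in> Arr (Und K)"
    "Dom (Und K) f = Cod (Und K) (CDom K \<alpha>)"
  shows "CIdt K f \<star> (\<alpha>' \<bullet> \<alpha>) = (CIdt K f \<star> \<alpha>') \<bullet> (CIdt K f \<star> \<alpha>)"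
  using interchange[of \<alpha> \<alpha>' "CIdt K f" "CIdt K f"] assms by (simp add: vcomp_idt)

lemma whisker_right:
  assumes "\<alpha> \<in> Cell K" "\<alpha>' \<in> Cell K" "CDom K \<alpha>' = CCod K \<alpha>" "f \<in> Arr (Und K)"
    "Dom (Und K) (CDom K \<alpha>) = Cod (Und K) f"
  shows "(\<alpha>' \<bullet> \<alpha>) \<star> CIdt K f = (\<alpha>' \<star> CIdt K f) \<bullet> (\<alpha> \<star> CIdt K f)"
  using interchange[of "CIdt K f" "CIdt K f" \<alpha> \<alpha>'] assms by (simp add: vcomp_idt)

lemma is_2product_ex1:
  assumes "is_2product K A B P p q" "u \<in> Arr (Und K)" "v \<in> Arr (Und K)" "Dom (Und K) v = Dom (Und K) u"
    "Cod (Und K) u = P" "Cod (Und K) v = P"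
    "\<alpha> \<in> cells K (p \<cdot>\<^bsub>Und K\<^esub> u) (p \<cdot>\<^bsub>Und K\<^esub> v)" "\<beta> \<in> cells K (q \<cdot>\<^bsub>Und K\<^esub> u) (q \<cdot>\<^bsub>Und K\<^esub> v)"
  shows "\<exists>!\<gamma>. \<gamma> \<in> cells K u v \<and> CIdt K p \<star> \<gamma> = \<alpha> \<and> CIdt K q \<star> \<gamma> = \<beta>"
proof -
  have "Dom (Und K) u \<in> Obj (Und K)" "u \<in> hom (Und K) (Dom (Und K) u) P" "v \<in> hom (Und K) (Dom (Und K) u) P"
    using assms by (simp_all add: hom_iff)
  with assms(1,7,8) show ?thesis unfolding is_2product_def by blast
qed

end

locale two_functor_loc = K: twocat K + L: twocat L
  for K :: "('o, 'a, 't) twocat" and L :: "('p, 'b, 's) twocat"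
    and F :: "('o, 'a, 't, 'p, 'b, 's) twofct" +
  assumes is_2functor: "is_2functor K L F"
begin

sublocale functor_loc "Und K" "Und L" "FUnd F"
  using is_2functor by unfold_locales (simp add: is_2functor_def)

lemma FCell_simps [simp]:
  shows "\<alpha> \<in> Cell K \<Longrightarrow> FCell F \<alpha> \<in> Cell L"
    and "\<alpha> \<in> Cell K \<Longrightarrow> CDom L (FCell F \<alpha>) = FAr (FUnd F) (CDom K \<alpha>)"
    and "\<alpha> \<in> Cell K \<Longrightarrow> CCod L (FCell F \<alpha>) = FAr (FUnd F) (CCod K \<alpha>)"
    and "f \<in> Arr (Und K) \<Longrightarrow> FCell F (CIdt K f) = CIdt L (FAr (FUnd F) f)"
    and "\<lbrakk>\<alpha> \<in> Cell K; \<beta> \<in> Cell K; CDom K \<beta> = CCod K \<alpha>\<rbrakk>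
      \<Longrightarrow> FCell F (VComp K \<beta> \<alpha>) = VComp L (FCell F \<beta>) (FCell F \<alpha>)"
    and "\<lbrakk>\<alpha> \<in> Cell K; \<beta> \<in> Cell K; Dom (Und K) (CDom K \<beta>) = Cod (Und K) (CDom K \<alpha>)\<rbrakk>
      \<Longrightarrow> FCell F (HComp K \<beta> \<alpha>) = HComp L (FCell F \<beta>) (FCell F \<alpha>)"
  using is_2functor by (auto simp: is_2functor_def is_functor_def vertical_def hom_iff hcomposable_def)

end

text \<open>\<open>prod_2functor\<close> is built on the products chosen in the underlying category,
  so its action on cells makes sense only if those are 2-products; the second assumption asks this
  of every product.\<close>

locale twoprod = twocat K for K :: "('o, 'a, 't) twocat" +
  assumes products: "\<lbrakk>A \<in> Obj (Und K); B \<in> Obj (Und K)\<rbrakk> \<Longrightarrow> \<exists>P p q. is_product (Und K) A B P p q"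
    and product_2product: "is_product (Und K) A B P p q \<Longrightarrow> is_2product K A B P p q"
begin

sublocale U: prod_cat "Und K"
  using products by unfold_locales

lemma prod_cell_eqI:
  assumes "A \<in> Obj (Und K)" "B \<in> Obj (Und K)" "\<gamma> \<in> Cell K" "\<delta> \<in> Cell K" "CDom K \<gamma> = CDom K \<delta>"
    "CCod K \<gamma> = CCod K \<delta>" "Cod (Und K) (CDom K \<delta>) = prod_ob (Und K) A B"
    "CIdt K (prod_fst (Und K) A B) \<star> \<gamma> = CIdt K (prod_fst (Und K) A B) \<star> \<delta>"
    "CIdt K (prod_snd (Und K) A B) \<star> \<gamma> = CIdt K (prod_snd (Und K) A B) \<star> \<delta>"
  shows "\<gamma> = \<delta>"
proof -
  let ?p = "prod_fst (Und K) A B" and ?q = "prod_snd (Und K) A B"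
  have "\<exists>!\<gamma>'. \<gamma>' \<in> cells K (CDom K \<delta>) (CCod K \<delta>) \<and> CIdt K ?p \<star> \<gamma>' = CIdt K ?p \<star> \<delta> \<and> CIdt K ?q \<star> \<gamma>' = CIdt K ?q \<star> \<delta>"
    using assms by (intro is_2product_ex1[OF product_2product[OF U.prod_is_product[OF assms(1,2)]]])
      (simp_all add: cells_def)
  with assms show ?thesis by (auto simp: cells_def)
qed

text \<open>The two prescribed whiskerings have the boundaries required by the 2-product property,
  which gives exactly one cell; hence the \<open>THE\<close> in \<open>prod_2functor\<close> is
  meaningful.\<close>

lemma prod_FCell:
  assumes "B \<in> Obj (Und K)" "\<alpha> \<in> Cell K"
  shows "FCell (prod_2functor K B) \<alpha> \<in> Cell K"
    and "CDom K (FCell (prod_2functor K B) \<alpha>) = FAr (prod_functor (Und K) B) (CDom K \<alpha>)"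
    and "CCod K (FCell (prod_2functor K B) \<alpha>) = FAr (prod_functor (Und K) B) (CCod K \<alpha>)"
    and "Cod (Und K) (CDom K \<alpha>) = A \<Longrightarrow> CIdt K (prod_fst (Und K) A B) \<star> FCell (prod_2functor K B) \<alpha>
          = \<alpha> \<star> CIdt K (prod_fst (Und K) (Dom (Und K) (CDom K \<alpha>)) B)"
    and "Cod (Und K) (CDom K \<alpha>) = A \<Longrightarrow> CIdt K (prod_snd (Und K) A B) \<star> FCell (prod_2functor K B) \<alpha>
          = CIdt K (prod_snd (Und K) (Dom (Und K) (CDom K \<alpha>)) B)"
proof -
  let ?A = "Dom (Und K) (CDom K \<alpha>)" and ?A' = "Cod (Und K) (CDom K \<alpha>)"
  let ?P = "\<lambda>\<gamma>. \<gamma> \<in> cells K (FAr (prod_functor (Und K) B) (CDom K \<alpha>)) (FAr (prod_functor (Und K) B) (CCod K \<alpha>)) \<and>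
    CIdt K (prod_fst (Und K) ?A' B) \<star> \<gamma> = \<alpha> \<star> CIdt K (prod_fst (Und K) ?A B) \<and>
    CIdt K (prod_snd (Und K) ?A' B) \<star> \<gamma> = CIdt K (prod_snd (Und K) ?A B)"
  have A: "?A \<in> Obj (Und K)" "?A' \<in> Obj (Und K)" using assms by simp_all
  have ex1: "\<exists>!\<gamma>. ?P \<gamma>"
    using assms A by (intro is_2product_ex1[OF product_2product[OF U.prod_is_product[OF A(2) assms(1)]]])
      (simp_all add: cells_def)
  have the: "FCell (prod_2functor K B) \<alpha> = (THE \<gamma>. ?P \<gamma>)"
    by (simp add: prod_2functor_def Let_def)
  have "?P (FCell (prod_2functor K B) \<alpha>)" unfolding the by (rule theI'[OF ex1])
  then show "FCell (prod_2functor K B) \<alpha> \<in> Cell K"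
    "CDom K (FCell (prod_2functor K B) \<alpha>) = FAr (prod_functor (Und K) B) (CDom K \<alpha>)"
    "CCod K (FCell (prod_2functor K B) \<alpha>) = FAr (prod_functor (Und K) B) (CCod K \<alpha>)"
    "?A' = A \<Longrightarrow> CIdt K (prod_fst (Und K) A B) \<star> FCell (prod_2functor K B) \<alpha>
          = \<alpha> \<star> CIdt K (prod_fst (Und K) (Dom (Und K) (CDom K \<alpha>)) B)"
    "?A' = A \<Longrightarrow> CIdt K (prod_snd (Und K) A B) \<star> FCell (prod_2functor K B) \<alpha>
          = CIdt K (prod_snd (Und K) (Dom (Und K) (CDom K \<alpha>)) B)"
    by (auto simp: cells_def)
qed

declare prod_FCell [simp]

lemma prod_FCell_ext [simp]:
  assumes "B \<in> Obj (Und K)" "\<alpha> \<in> Cell K" "Cod (Und K) (CDom K \<alpha>) = A" "\<xi> \<in> Cell K"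
    "Cod (Und K) (CDom K \<xi>) = prod_ob (Und K) (Dom (Und K) (CDom K \<alpha>)) B"
  shows "CIdt K (prod_fst (Und K) A B) \<star> (FCell (prod_2functor K B) \<alpha> \<star> \<xi>)
          = \<alpha> \<star> (CIdt K (prod_fst (Und K) (Dom (Und K) (CDom K \<alpha>)) B) \<star> \<xi>)"
    and "CIdt K (prod_snd (Und K) A B) \<star> (FCell (prod_2functor K B) \<alpha> \<star> \<xi>)
          = CIdt K (prod_snd (Und K) (Dom (Und K) (CDom K \<alpha>)) B) \<star> \<xi>"
  using assms(1,2,4,5) hcomp_ext[OF prod_FCell(4)[of B \<alpha> A], of \<xi>] hcomp_ext[OF prod_FCell(5)[of B \<alpha> A], of \<xi>]
  by (simp_all add: assms(3)[symmetric])

lemma FUnd_prod [simp]: "FUnd (prod_2functor K B) = prod_functor (Und K) B"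
  by (simp add: prod_2functor_def)

lemma is_2functor_prod:
  assumes B: "B \<in> Obj (Und K)"
  shows "is_2functor K K (prod_2functor K B)"
  unfolding is_2functor_def
proof (intro conjI allI impI)
  show "is_functor (Und K) (Und K) (FUnd (prod_2functor K B))"
    using U.is_functor_prod[OF B] by simp
next
  show "is_functor (vertical K) (vertical K) \<lparr>FOb = FAr (FUnd (prod_2functor K B)), FAr = FCell (prod_2functor K B)\<rparr>"
    unfolding is_functor_def vertical_def
  proof (simp add: hom_iff B, intro conjI ballI impI)
    fix f assume "f \<in> Arr (Und K)"
    with B show "FCell (prod_2functor K B) (CIdt K f) = CIdt K (FAr (prod_functor (Und K) B) f)"
      by - (rule prod_cell_eqI[of "Cod (Und K) f" B], simp_all)
  next
    fix \<alpha> \<beta> assume "\<alpha> \<in> Cell K" "\<beta> \<in> Cell K" "CDom K \<beta> = CCod K \<alpha>"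
    with B show "FCell (prod_2functor K B) (\<beta> \<bullet> \<alpha>) = FCell (prod_2functor K B) \<beta> \<bullet> FCell (prod_2functor K B) \<alpha>"
      by - (rule prod_cell_eqI[of "Cod (Und K) (CDom K \<alpha>)" B], simp_all add: whisker_left whisker_right vcomp_idt)
  qed
next
  fix \<alpha> \<beta> assume "hcomposable K \<beta> \<alpha>"
  then have "\<alpha> \<in> Cell K" "\<beta> \<in> Cell K" "Dom (Und K) (CDom K \<beta>) = Cod (Und K) (CDom K \<alpha>)"
    by (simp_all add: hcomposable_def)
  with B show "FCell (prod_2functor K B) (\<beta> \<star> \<alpha>) = FCell (prod_2functor K B) \<beta> \<star> FCell (prod_2functor K B) \<alpha>"
    by - (rule prod_cell_eqI[of "Cod (Und K) (CDom K \<beta>)" B],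
        simp_all add: U.is_functor_prod[OF B, unfolded is_functor_def])
qed

end

text \<open>The second clause makes composition with \<open>e\<close> bijective on 2-cells, so that
  the bijection of hom-sets becomes an isomorphism of hom-categories.\<close>

definition is_2universal :: "('o, 'a, 't) twocat \<Rightarrow> ('p, 'b, 's) twocat \<Rightarrow>
    ('o, 'a, 't, 'p, 'b, 's) twofct \<Rightarrow> 'p \<Rightarrow> 'o \<Rightarrow> 'b \<Rightarrow> bool" where
  "is_2universal K L F Y H e \<longleftrightarrow> is_universal (Und K) (Und L) (FUnd F) Y H e \<and>
     (\<forall>Z\<in>Obj (Und K). \<forall>u\<in>hom (Und K) Z H. \<forall>v\<in>hom (Und K) Z H.
        \<forall>\<beta>\<in>cells L (e \<cdot>\<^bsub>Und L\<^esub> FAr (FUnd F) u) (e \<cdot>\<^bsub>Und L\<^esub> FAr (FUnd F) v).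
          \<exists>!\<alpha>. \<alpha> \<in> cells K u v \<and> HComp L (CIdt L e) (FCell F \<alpha>) = \<beta>)"

locale two_universal_arrows = two_functor_loc K L F
  for K :: "('o, 'a, 't) twocat" and L :: "('p, 'b, 's) twocat"
    and F :: "('o, 'a, 't, 'p, 'b, 's) twofct" +
  fixes H :: "'p \<Rightarrow> 'o" and e :: "'p \<Rightarrow> 'b"
  assumes two_universal: "Y \<in> Obj (Und L) \<Longrightarrow> is_2universal K L F Y (H Y) (e Y)"
begin

sublocale universal_arrows "Und K" "Und L" "FUnd F" H e
  using two_universal by unfold_locales (simp add: is_2universal_def)

lemma arrow_cell_eqI:
  assumes "Y \<in> Obj (Und L)" "\<gamma> \<in> Cell K" "\<delta> \<in> Cell K" "CDom K \<gamma> = CDom K \<delta>" "CCod K \<gamma> = CCod K \<delta>"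
    "Cod (Und K) (CDom K \<delta>) = H Y" "HComp L (CIdt L (e Y)) (FCell F \<gamma>) = HComp L (CIdt L (e Y)) (FCell F \<delta>)"
  shows "\<gamma> = \<delta>"
proof -
  have "\<exists>!\<gamma>'. \<gamma>' \<in> cells K (CDom K \<delta>) (CCod K \<delta>) \<and> HComp L (CIdt L (e Y)) (FCell F \<gamma>') = HComp L (CIdt L (e Y)) (FCell F \<delta>)"
  proof -
    have "Dom (Und K) (CDom K \<delta>) \<in> Obj (Und K)" "CDom K \<delta> \<in> hom (Und K) (Dom (Und K) (CDom K \<delta>)) (H Y)"
      "CCod K \<delta> \<in> hom (Und K) (Dom (Und K) (CDom K \<delta>)) (H Y)"
      "HComp L (CIdt L (e Y)) (FCell F \<delta>)
        \<in> cells L (e Y \<cdot>\<^bsub>Und L\<^esub> FAr (FUnd F) (CDom K \<delta>)) (e Y \<cdot>\<^bsub>Und L\<^esub> FAr (FUnd F) (CCod K \<delta>))"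
      using assms by (simp_all add: hom_iff cells_def)
    with two_universal[OF assms(1)] show ?thesis unfolding is_2universal_def by blast
  qed
  with assms show ?thesis by (auto simp: cells_def)
qed

text \<open>The equation is 2-naturality of \<open>e\<close> at \<open>\<alpha>\<close>, which
  leaves a single candidate for the action of the right adjoint on cells.\<close>

definition adj_cell :: "'s \<Rightarrow> 't" where
  "adj_cell \<alpha> = (THE \<gamma>. \<gamma> \<in> cells K (FAr right_adjoint (CDom L \<alpha>)) (FAr right_adjoint (CCod L \<alpha>)) \<and>
     HComp L (CIdt L (e (Cod (Und L) (CDom L \<alpha>)))) (FCell F \<gamma>) =
     HComp L \<alpha> (CIdt L (e (Dom (Und L) (CDom L \<alpha>)))))"

lemma adj_cell [simp]:
  assumes "\<alpha> \<in> Cell L"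
  shows "adj_cell \<alpha> \<in> Cell K"
    and "CDom K (adj_cell \<alpha>) = transpose (H (Dom (Und L) (CDom L \<alpha>))) (CDom L \<alpha> \<cdot>\<^bsub>Und L\<^esub> e (Dom (Und L) (CDom L \<alpha>)))"
    and "CCod K (adj_cell \<alpha>) = transpose (H (Dom (Und L) (CDom L \<alpha>))) (CCod L \<alpha> \<cdot>\<^bsub>Und L\<^esub> e (Dom (Und L) (CDom L \<alpha>)))"
    and e_adj_cell: "Y = Cod (Und L) (CDom L \<alpha>) \<Longrightarrow> HComp L (CIdt L (e Y)) (FCell F (adj_cell \<alpha>))
       = HComp L \<alpha> (CIdt L (e (Dom (Und L) (CDom L \<alpha>))))"
proof -
  let ?Y = "Dom (Und L) (CDom L \<alpha>)" and ?Y' = "Cod (Und L) (CDom L \<alpha>)"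
  let ?u = "transpose (H ?Y) (CDom L \<alpha> \<cdot>\<^bsub>Und L\<^esub> e ?Y)" and ?v = "transpose (H ?Y) (CCod L \<alpha> \<cdot>\<^bsub>Und L\<^esub> e ?Y)"
  have Y: "?Y \<in> Obj (Und L)" "?Y' \<in> Obj (Und L)" using assms by simp_all
  let ?P = "\<lambda>\<gamma>. \<gamma> \<in> cells K ?u ?v \<and> HComp L (CIdt L (e ?Y')) (FCell F \<gamma>) = HComp L \<alpha> (CIdt L (e ?Y))"
  have uv: "?u \<in> hom (Und K) (H ?Y) (H ?Y')" "?v \<in> hom (Und K) (H ?Y) (H ?Y')"
    using assms Y by (simp_all add: hom_iff)
  have c: "HComp L \<alpha> (CIdt L (e ?Y)) \<in> cells L (e ?Y' \<cdot>\<^bsub>Und L\<^esub> FAr (FUnd F) ?u) (e ?Y' \<cdot>\<^bsub>Und L\<^esub> FAr (FUnd F) ?v)"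
    using assms Y by (simp add: cells_def)
  have "H ?Y \<in> Obj (Und K)" using Y by simp
  with two_universal[OF Y(2)] uv c have ex1: "\<exists>!\<gamma>. ?P \<gamma>" unfolding is_2universal_def by blast
  have the: "adj_cell \<alpha> = (THE \<gamma>. ?P \<gamma>)"
    using assms by (simp add: adj_cell_def)
  have "?P (adj_cell \<alpha>)" unfolding the by (rule theI'[OF ex1])
  then show "adj_cell \<alpha> \<in> Cell K" "CDom K (adj_cell \<alpha>) = ?u" "CCod K (adj_cell \<alpha>) = ?v"
    "Y = ?Y' \<Longrightarrow> HComp L (CIdt L (e Y)) (FCell F (adj_cell \<alpha>)) = HComp L \<alpha> (CIdt L (e ?Y))"
    by (auto simp: cells_def)
qed

lemma e_adj_cell_ext [simp]:
  assumes "\<alpha> \<in> Cell L" "Y = Cod (Und L) (CDom L \<alpha>)" "\<xi> \<in> Cell L"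
    "Cod (Und L) (CDom L \<xi>) = FOb (FUnd F) (H (Dom (Und L) (CDom L \<alpha>)))"
  shows "HComp L (CIdt L (e Y)) (HComp L (FCell F (adj_cell \<alpha>)) \<xi>)
       = HComp L \<alpha> (HComp L (CIdt L (e (Dom (Und L) (CDom L \<alpha>)))) \<xi>)"
  using assms(1,3,4) L.hcomp_ext[OF e_adj_cell[of \<alpha> Y], of \<xi>] by (simp add: assms(2))

definition right_2adjoint :: "('p, 'b, 's, 'o, 'a, 't) twofct" where
  "right_2adjoint = \<lparr> FUnd = right_adjoint, FCell = adj_cell \<rparr>"

lemma right_2adjoint_simps [simp]:
  "FUnd right_2adjoint = right_adjoint" "FCell right_2adjoint = adj_cell"
  by (simp_all add: right_2adjoint_def)

lemma is_2functor_right_2adjoint: "is_2functor L K right_2adjoint"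
  unfolding is_2functor_def
proof (intro conjI allI impI)
  interpret G: functor_loc "Und L" "Und K" right_adjoint
    using is_adjunction by unfold_locales (simp add: is_adjunction_def)
  show "is_functor (Und L) (Und K) (FUnd right_2adjoint)" using G.is_functor by simp
  show "is_functor (vertical L) (vertical K) \<lparr>FOb = FAr (FUnd right_2adjoint), FAr = FCell right_2adjoint\<rparr>"
    unfolding is_functor_def vertical_def
  proof (simp add: hom_iff, intro conjI ballI impI)
    fix f assume "f \<in> Arr (Und L)"
    then show "adj_cell (CIdt L f) = CIdt K (transpose (H (Dom (Und L) f)) (f \<cdot>\<^bsub>Und L\<^esub> e (Dom (Und L) f)))"
      by - (rule arrow_cell_eqI[of "Cod (Und L) f"], simp_all)
  next
    fix \<alpha> \<beta> assume "\<alpha> \<in> Cell L" "\<beta> \<in> Cell L" "CDom L \<beta> = CCod L \<alpha>"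
    then show "adj_cell (VComp L \<beta> \<alpha>) = VComp K (adj_cell \<beta>) (adj_cell \<alpha>)"
      by - (rule arrow_cell_eqI[of "Cod (Und L) (CDom L \<alpha>)"], simp_all add: L.whisker_left L.whisker_right)
  qed
  fix \<alpha> \<beta> assume "hcomposable L \<beta> \<alpha>"
  then have ab: "\<alpha> \<in> Cell L" "\<beta> \<in> Cell L" "Dom (Und L) (CDom L \<beta>) = Cod (Und L) (CDom L \<alpha>)"
    by (simp_all add: hcomposable_def)
  \<comment> \<open>Cells can be compared by \<open>arrow_cell_eqI\<close> only when they are
    parallel, which takes functoriality of the right adjoint at both boundary 1-cells.\<close>
  then have "CDom L \<alpha> \<in> Arr (Und L)" "CCod L \<alpha> \<in> Arr (Und L)" "CDom L \<beta> \<in> Arr (Und L)" "CCod L \<beta> \<in> Arr (Und L)"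
    by simp_all
  note G.functor_simps(6)[OF this(1,3)] G.functor_simps(6)[OF this(2,4)]
  with ab show "FCell right_2adjoint (HComp L \<beta> \<alpha>) = HComp K (FCell right_2adjoint \<beta>) (FCell right_2adjoint \<alpha>)"
    by - (simp, rule arrow_cell_eqI[of "Cod (Und L) (CDom L \<beta>)"], simp_all)
qed

lemma is_2adjunction: "is_2adjunction K L F right_2adjoint adj_unit e"
  unfolding is_2adjunction_def
proof (intro conjI)
  note adj = is_adjunction[unfolded is_adjunction_def]
  show "is_2nattrans K K id_2functor (comp_2functor right_2adjoint F) adj_unit"
    unfolding is_2nattrans_def
  proof (intro conjI ballI)
    show "is_nattrans (Und K) (Und K) (FUnd id_2functor) (FUnd (comp_2functor right_2adjoint F)) adj_unit"
      using adj by (simp add: id_2functor_def comp_2functor_def)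
    fix \<alpha> assume \<alpha>: "\<alpha> \<in> Cell K"
    \<comment> \<open>Applied at both boundaries of the cell, so that the two sides are parallel
      before they are compared.\<close>
    have nat: "adj_unit (Cod (Und K) f) \<cdot>\<^bsub>Und K\<^esub> f = FAr right_adjoint (FAr (FUnd F) f) \<cdot>\<^bsub>Und K\<^esub> adj_unit (Dom (Und K) f)"
      if "f \<in> Arr (Und K)" for f
      using adj that by (simp add: is_nattrans_def id_functor_def comp_functor_def)
    show "HComp K (CIdt K (adj_unit (Cod (Und K) (CDom K \<alpha>)))) (FCell id_2functor \<alpha>) =
      HComp K (FCell (comp_2functor right_2adjoint F) \<alpha>) (CIdt K (adj_unit (Dom (Und K) (CDom K \<alpha>))))"
      using \<alpha> nat[of "CDom K \<alpha>"] nat[of "CCod K \<alpha>"]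
      by - (rule arrow_cell_eqI[of "FOb (FUnd F) (Cod (Und K) (CDom K \<alpha>))"],
          simp_all add: id_2functor_def comp_2functor_def adj_unit_def)
  qed
  show "is_2nattrans L L (comp_2functor F right_2adjoint) id_2functor e"
    unfolding is_2nattrans_def using adj by (simp add: id_2functor_def comp_2functor_def)
qed (use is_adjunction is_2functor is_2functor_right_2adjoint in \<open>simp_all add: is_adjunction_def\<close>)

end

text \<open>Each two-dimensional notion contains its one-dimensional counterpart as a conjunct, and
  forgetting the cells of a 2-adjunction leaves an adjunction.\<close>

lemma two_cartesian_closed_underlying:
  assumes "two_cartesian_closed K"
  shows "cartesian_closed (Und K)"
proof -
  have "is_adjunction (Und K) (Und K) (prod_functor (Und K) B) (FUnd G) \<eta> \<epsilon>"
    if "is_2adjunction K K (prod_2functor K B) G \<eta> \<epsilon>" for B G \<eta> \<epsilon>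
    using that
    by (simp add: is_2adjunction_def is_adjunction_def is_2functor_def is_2nattrans_def
        prod_2functor_def id_2functor_def comp_2functor_def)
  with assms show ?thesis
    unfolding two_cartesian_closed_def cartesian_closed_def is_2terminal_def is_2product_def two_category_def
    by meson
qed

section \<open>Finite limits\<close>

locale fincat = cat_base E for E :: "('o, 'a) cat" (structure) +
  assumes finite_limits: "has_finite_limits E"
begin

lemma limit_exists:
  fixes J :: "(nat, nat) cat"
  assumes "category J" "finite (Obj J)" "finite (Arr J)" "is_functor J E D"
  obtains L \<pi> where "is_limit J E D L \<pi>"
  using assms finite_limits unfolding has_finite_limits_def by blast

lemma terminal_exists: "\<exists>T. is_terminal E T"
proof -
  let ?J = "\<lparr>Obj = {}, Arr = {}, Dom = id, Cod = id, Idt = id, Comp = \<lambda>g f. f\<rparr> :: (nat, nat) cat"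
  let ?D = "undefined :: (nat, nat, 'o, 'a) fct"
  obtain L \<pi> where L: "is_limit ?J E ?D L \<pi>"
    by (rule limit_exists[of ?J ?D]) (simp_all add: category_def is_functor_def)
  then have "is_terminal E L"
    by (simp add: is_limit_def is_cone_def is_terminal_def)
  then show ?thesis ..
qed

lemma product_exists:
  assumes "A \<in> Obj E" "B \<in> Obj E"
  shows "\<exists>P p q. is_product E A B P p q"
proof -
  \<comment> \<open>The discrete shape on two objects: each arrow is the identity of the object with
    the same number.\<close>
  let ?J = "\<lparr>Obj = {0, 1}, Arr = {0, 1}, Dom = id, Cod = id, Idt = id, Comp = \<lambda>g f. f\<rparr> :: (nat, nat) cat"
  let ?D = "\<lparr>FOb = \<lambda>i. if i = 0 then A else B, FAr = \<lambda>i. Idt E (if i = 0 then A else B)\<rparr> :: (nat, nat, 'o, 'a) fct"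
  obtain L \<pi> where L: "is_limit ?J E ?D L \<pi>"
    by (rule limit_exists[of ?J ?D]) (use assms in \<open>simp_all add: category_def is_functor_def hom_iff\<close>)
  then have \<pi>: "L \<in> Obj E" "\<pi> 0 \<in> hom E L A" "\<pi> 1 \<in> hom E L B"
    by (simp_all add: is_limit_def is_cone_def)
  have u: "\<exists>!u. u \<in> hom E X L \<and> \<pi> 0 \<cdot> u = f \<and> \<pi> 1 \<cdot> u = g"
    if "X \<in> Obj E" "f \<in> hom E X A" "g \<in> hom E X B" for X f g
  proof -
    have "is_cone ?J E ?D X (\<lambda>i. if i = 0 then f else g)"
      using that by (simp add: is_cone_def hom_iff)
    with L have "\<exists>!u. u \<in> hom E X L \<and> (\<forall>i\<in>Obj ?J. \<pi> i \<cdot> u = (if i = 0 then f else g))"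
      unfolding is_limit_def by blast
    then show ?thesis by simp
  qed
  have "is_product E A B L (\<pi> 0) (\<pi> 1)"
    using \<pi> u by (auto simp: is_product_def)
  then show ?thesis by blast
qed

sublocale prod_cat E
  by unfold_locales (rule product_exists)

lemma pullback_exists:
  assumes "f \<in> Arr E" "g \<in> Arr E" "Cod E f = Cod E g"
  shows "\<exists>P p q. is_pullback E f g P p q"
proof -
  \<comment> \<open>The cospan: 0, 1, 2 are the identities, arrow 3 goes from 0 to 2 and arrow 4
    from 1 to 2. In a composable pair at most one arrow is not an identity, and \<open>Comp\<close>
    returns that one.\<close>
  let ?J = "\<lparr>Obj = {0, 1, 2}, Arr = {0, 1, 2, 3, 4},
    Dom = \<lambda>a. if a = 3 then 0 else if a = 4 then 1 else a, Cod = \<lambda>a. if a = 3 \<or> a = 4 then 2 else a,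
    Idt = id, Comp = \<lambda>g f. if g = 3 \<or> g = 4 then g else f\<rparr> :: (nat, nat) cat"
  let ?D = "\<lparr>FOb = \<lambda>i. if i = 0 then Dom E f else if i = 1 then Dom E g else Cod E f,
    FAr = \<lambda>a. if a = 3 then f else if a = 4 then g else
      Idt E (if a = 0 then Dom E f else if a = 1 then Dom E g else Cod E f)\<rparr> :: (nat, nat, 'o, 'a) fct"
  obtain L \<pi> where L: "is_limit ?J E ?D L \<pi>"
    by (rule limit_exists[of ?J ?D]) (use assms in \<open>simp_all add: category_def is_functor_def hom_iff\<close>)
  then have \<pi>: "L \<in> Obj E" "\<pi> 0 \<in> hom E L (Dom E f)" "\<pi> 1 \<in> hom E L (Dom E g)"
    "f \<cdot> \<pi> 0 = g \<cdot> \<pi> 1" and \<pi>2: "\<pi> 2 = f \<cdot> \<pi> 0"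
    by (simp_all add: is_limit_def is_cone_def)
  have u: "\<exists>!u. u \<in> hom E X L \<and> \<pi> 0 \<cdot> u = a \<and> \<pi> 1 \<cdot> u = b"
    if "X \<in> Obj E" "a \<in> hom E X (Dom E f)" "b \<in> hom E X (Dom E g)" "f \<cdot> a = g \<cdot> b" for X a b
  proof -
    have "is_cone ?J E ?D X (\<lambda>i. if i = 0 then a else if i = 1 then b else f \<cdot> a)"
      using that assms by (simp add: is_cone_def hom_iff)
    with L have "\<exists>!u. u \<in> hom E X L \<and> (\<forall>i\<in>Obj ?J. \<pi> i \<cdot> u = (if i = 0 then a else if i = 1 then b else f \<cdot> a))"
      unfolding is_limit_def by blast
    then have "\<exists>!u. u \<in> hom E X L \<and> \<pi> 0 \<cdot> u = a \<and> \<pi> 1 \<cdot> u = b \<and> \<pi> 2 \<cdot> u = f \<cdot> a" by simp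
    moreover have "\<pi> 2 \<cdot> u = f \<cdot> a" if "u \<in> hom E X L" "\<pi> 0 \<cdot> u = a" for u
      using that \<pi>(2) \<pi>2 assms by (auto simp: hom_iff)
    ultimately show ?thesis by blast
  qed
  have "is_pullback E f g L (\<pi> 0) (\<pi> 1)"
    using \<pi> u by (auto simp: is_pullback_def)
  then show ?thesis by blast
qed

lemma pb_is_pullback:
  assumes "f \<in> Arr E" "g \<in> Arr E" "Cod E f = Cod E g"
  shows "is_pullback E f g (pb_ob E f g) (pb_fst E f g) (pb_snd E f g)"
proof -
  have "\<exists>x. case x of (P, p, q) \<Rightarrow> is_pullback E f g P p q" using pullback_exists[OF assms] by auto
  from someI_ex[OF this] show ?thesis
    by (auto simp: pb_ob_def pb_fst_def pb_snd_def chosen_pullback_def split: prod.splits)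
qed

lemma pb_simps [simp]:
  assumes "f \<in> Arr E" "g \<in> Arr E" "Cod E f = Cod E g"
  shows "pb_ob E f g \<in> Obj E" "pb_fst E f g \<in> Arr E" "Dom E (pb_fst E f g) = pb_ob E f g"
    "Cod E (pb_fst E f g) = Dom E f" "pb_snd E f g \<in> Arr E" "Dom E (pb_snd E f g) = pb_ob E f g"
    "Cod E (pb_snd E f g) = Dom E g"
  using pb_is_pullback[OF assms] by (auto simp: is_pullback_def hom_iff)

lemma pb_square:
  assumes "f \<in> Arr E" "g \<in> Arr E" "Cod E f = Cod E g"
  shows "f \<cdot> pb_fst E f g = g \<cdot> pb_snd E f g"
  using pb_is_pullback[OF assms] by (auto simp: is_pullback_def hom_iff)

lemma pb_eqI:
  assumes "f \<in> Arr E" "g \<in> Arr E" "Cod E f = Cod E g" "u \<in> Arr E" "v \<in> Arr E" "Dom E v = Dom E u"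
    "Cod E u = pb_ob E f g" "Cod E v = pb_ob E f g"
    "pb_fst E f g \<cdot> u = pb_fst E f g \<cdot> v" "pb_snd E f g \<cdot> u = pb_snd E f g \<cdot> v"
  shows "u = v"
proof -
  have "f \<cdot> (pb_fst E f g \<cdot> u) = g \<cdot> (pb_snd E f g \<cdot> u)"
    using assms by (simp add: comp_ext[OF pb_square])
  moreover have "pb_fst E f g \<cdot> u \<in> hom E (Dom E u) (Dom E f)" "pb_snd E f g \<cdot> u \<in> hom E (Dom E u) (Dom E g)"
    "Dom E u \<in> Obj E" using assms by (simp_all add: hom_iff)
  ultimately have "\<exists>!w. w \<in> hom E (Dom E u) (pb_ob E f g) \<and>
      pb_fst E f g \<cdot> w = pb_fst E f g \<cdot> u \<and> pb_snd E f g \<cdot> w = pb_snd E f g \<cdot> u"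
    using pb_is_pullback[OF assms(1-3)] unfolding is_pullback_def by blast
  with assms show ?thesis by (auto simp: hom_iff)
qed

lemma pb_lift [simp]:
  assumes "f \<in> Arr E" "g \<in> Arr E" "Cod E f = Cod E g" "a \<in> Arr E" "b \<in> Arr E" "Dom E a = Dom E b"
    "Cod E a = Dom E f" "Cod E b = Dom E g" "f \<cdot> a = g \<cdot> b"
  defines "k \<equiv> lift E (pb_fst E f g) (pb_snd E f g) a b"
  shows "k \<in> Arr E" "Dom E k = Dom E b" "Cod E k = pb_ob E f g" "pb_fst E f g \<cdot> k = a" "pb_snd E f g \<cdot> k = b"
proof -
  have "\<exists>!u. u \<in> hom E (Dom E a) (Dom E (pb_fst E f g)) \<and> pb_fst E f g \<cdot> u = a \<and> pb_snd E f g \<cdot> u = b"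
    using pb_is_pullback[OF assms(1-3)] assms(1-9) unfolding is_pullback_def by (simp add: hom_iff)
  from theI'[OF this, folded lift_def] assms(1-9)
  show "k \<in> Arr E" "Dom E k = Dom E b" "Cod E k = pb_ob E f g" "pb_fst E f g \<cdot> k = a" "pb_snd E f g \<cdot> k = b"
    by (simp_all add: k_def hom_iff)
qed

lemma pb_lift_comp:
  assumes "f \<in> Arr E" "g \<in> Arr E" "Cod E f = Cod E g" "a \<in> Arr E" "b \<in> Arr E" "Dom E a = Dom E b"
    "Cod E a = Dom E f" "Cod E b = Dom E g" "f \<cdot> a = g \<cdot> b" "w \<in> Arr E" "Cod E w = Dom E b"
  shows "lift E (pb_fst E f g) (pb_snd E f g) a b \<cdot> w = lift E (pb_fst E f g) (pb_snd E f g) (a \<cdot> w) (b \<cdot> w)"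
proof -
  have "f \<cdot> (a \<cdot> w) = g \<cdot> (b \<cdot> w)" using assms comp_ext[OF assms(9), of w] by simp
  then show ?thesis using assms
    by - (rule pb_eqI[of f g], simp_all add: comp_ext[OF pb_lift(4)] comp_ext[OF pb_lift(5)])
qed

text \<open>The equalizer is the pullback of the graphs \<open>(1, f)\<close> and
  \<open>(1, g)\<close>: the first coordinates force the two projections to agree, the second ones
  give the equation. The last clause has the form in which \<open>represents\<close> is later
  stated.\<close>

lemma equalizer_exists:
  assumes "f \<in> Arr E" "g \<in> Arr E" "Dom E g = Dom E f" "Cod E g = Cod E f"
  obtains K j where "j \<in> hom E K (Dom E f)"
    "\<And>u v. \<lbrakk>u \<in> Arr E; v \<in> Arr E; Dom E u = Dom E v; Cod E u = K; Cod E v = K; j \<cdot> u = j \<cdot> v\<rbrakk> \<Longrightarrow> u = v"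
    "\<And>x. \<lbrakk>x \<in> Arr E; Cod E x = Dom E f\<rbrakk> \<Longrightarrow> f \<cdot> x = g \<cdot> x \<longleftrightarrow> (\<exists>y \<in> hom E (Dom E x) K. x = j \<cdot> y)"
proof -
  let ?A = "Dom E f" and ?B = "Cod E f"
  let ?pair = "lift E (prod_fst E ?A ?B) (prod_snd E ?A ?B)"
  let ?f = "?pair (Idt E ?A) f" and ?g = "?pair (Idt E ?A) g"
  have AB: "?A \<in> Obj E" "?B \<in> Obj E" using assms by simp_all
  note [simp] = assms AB
  have fg: "?f \<in> Arr E" "?g \<in> Arr E" "Cod E ?f = Cod E ?g" by simp_all
  let ?K = "pb_ob E ?f ?g" and ?j = "pb_fst E ?f ?g" and ?j' = "pb_snd E ?f ?g"
  have sq: "?f \<cdot> ?j = ?g \<cdot> ?j'" using pb_square[OF fg] .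
  from arg_cong[OF sq, of "\<lambda>x. prod_fst E ?A ?B \<cdot> x"] have jj: "?j = ?j'" by simp
  from arg_cong[OF sq, of "\<lambda>x. prod_snd E ?A ?B \<cdot> x"] have fj: "f \<cdot> ?j = g \<cdot> ?j'" by simp
  show thesis
  proof (rule that)
    show "?j \<in> hom E ?K (Dom E f)" by (simp add: hom_iff)
    fix u v assume "u \<in> Arr E" "v \<in> Arr E" "Dom E u = Dom E v" "Cod E u = ?K" "Cod E v = ?K" "?j \<cdot> u = ?j \<cdot> v"
    then show "u = v" by - (rule pb_eqI[OF fg], simp_all add: jj)
  next
    fix x assume x: "x \<in> Arr E" "Cod E x = Dom E f"
    show "f \<cdot> x = g \<cdot> x \<longleftrightarrow> (\<exists>y \<in> hom E (Dom E x) ?K. x = ?j \<cdot> y)"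
    proof
      assume "f \<cdot> x = g \<cdot> x"
      then have "?f \<cdot> x = ?g \<cdot> x" using x by (simp add: pair_comp)
      then show "\<exists>y \<in> hom E (Dom E x) ?K. x = ?j \<cdot> y" using x
        by (intro bexI[of _ "lift E ?j ?j' x x"]) (simp_all add: hom_iff)
    next
      assume "\<exists>y \<in> hom E (Dom E x) ?K. x = ?j \<cdot> y"
      then obtain y where "y \<in> Arr E" "Cod E y = ?K" "x = ?j \<cdot> y" by (auto simp: hom_iff)
      then show "f \<cdot> x = g \<cdot> x" using comp_ext[OF fj, of y] by (simp add: jj)
    qed
  qed
qed

end

section \<open>Internal categories through generalized elements\<close>

text \<open>The composite of two generalized elements \<open>g\<close>, \<open>f\<close> of the object of arrows, given at the
  same stage. In these terms the laws of an internal category, functor or transformation are the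
  usual ones, required at every stage.\<close>

definition icmp :: "('o, 'a) cat \<Rightarrow> ('o, 'a) icat \<Rightarrow> 'a \<Rightarrow> 'a \<Rightarrow> 'a" where
  "icmp E X g f = Cmp X \<cdot>\<^bsub>E\<^esub> cpair E X g f"

context fincat
begin

lemma icat_simps [simp]:
  assumes "is_icat E X"
  shows "IOb X \<in> Obj E" "IAr X \<in> Obj E" "Src X \<in> Arr E" "Dom E (Src X) = IAr X" "Cod E (Src X) = IOb X"
    "Tgt X \<in> Arr E" "Dom E (Tgt X) = IAr X" "Cod E (Tgt X) = IOb X"
    "Idn X \<in> Arr E" "Dom E (Idn X) = IOb X" "Cod E (Idn X) = IAr X"
    "Cmp X \<in> Arr E" "Dom E (Cmp X) = cpair_ob E X" "Cod E (Cmp X) = IAr X"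
    "Src X \<cdot> Idn X = Idt E (IOb X)" "Tgt X \<cdot> Idn X = Idt E (IOb X)"
    and Src_Cmp: "Src X \<cdot> Cmp X = Src X \<cdot> cpair_snd E X"
    and Tgt_Cmp: "Tgt X \<cdot> Cmp X = Tgt X \<cdot> cpair_fst E X"
  using assms by (auto simp: is_icat_def hom_iff)

lemma Src_Idn_comp [simp]:
  assumes "is_icat E X" "x \<in> Arr E" "Cod E x = IOb X"
  shows "Src X \<cdot> (Idn X \<cdot> x) = x" "Tgt X \<cdot> (Idn X \<cdot> x) = x"
  using assms comp_ext[OF icat_simps(15)] comp_ext[OF icat_simps(16)] by simp_all

lemma cpair_simps [simp]:
  assumes "is_icat E X"
  shows "cpair_ob E X \<in> Obj E" "cpair_fst E X \<in> Arr E" "Dom E (cpair_fst E X) = cpair_ob E X"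
    "Cod E (cpair_fst E X) = IAr X" "cpair_snd E X \<in> Arr E" "Dom E (cpair_snd E X) = cpair_ob E X"
    "Cod E (cpair_snd E X) = IAr X" "Src X \<cdot> cpair_fst E X = Tgt X \<cdot> cpair_snd E X"
  using assms pb_square[of "Src X" "Tgt X"]
  by (simp_all add: cpair_ob_def cpair_fst_def cpair_snd_def)

lemma cpair_square_comp [simp]:
  assumes "is_icat E X" "x \<in> Arr E" "Cod E x = cpair_ob E X"
  shows "Src X \<cdot> (cpair_fst E X \<cdot> x) = Tgt X \<cdot> (cpair_snd E X \<cdot> x)"
  using assms comp_ext[OF cpair_simps(8)] by simp

definition composable :: "('o, 'a) icat \<Rightarrow> 'a \<Rightarrow> 'a \<Rightarrow> bool" where
  "composable X g f \<longleftrightarrow> g \<in> Arr E \<and> f \<in> Arr E \<and> Dom E g = Dom E f \<and> Cod E g = IAr X \<and> Cod E f = IAr X \<and>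
     Src X \<cdot> g = Tgt X \<cdot> f"

lemma cpair_lift:
  assumes "is_icat E X" "composable X g f"
  shows "cpair E X g f \<in> Arr E" "Dom E (cpair E X g f) = Dom E f" "Cod E (cpair E X g f) = cpair_ob E X"
    "cpair_fst E X \<cdot> cpair E X g f = g" "cpair_snd E X \<cdot> cpair E X g f = f"
  using assms by (simp_all add: cpair_def cpair_fst_def cpair_snd_def cpair_ob_def composable_def)

lemma cpair_comp:
  assumes "is_icat E X" "composable X g f" "w \<in> Arr E" "Cod E w = Dom E f"
  shows "cpair E X g f \<cdot> w = cpair E X (g \<cdot> w) (f \<cdot> w)"
  using assms by (simp add: cpair_def cpair_fst_def cpair_snd_def composable_def pb_lift_comp)

lemma cpair_eta:
  assumes "is_icat E X" "k \<in> Arr E" "Cod E k = cpair_ob E X"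
  shows "cpair E X (cpair_fst E X \<cdot> k) (cpair_snd E X \<cdot> k) = k"
proof -
  have "composable X (cpair_fst E X \<cdot> k) (cpair_snd E X \<cdot> k)"
    using assms by (simp add: composable_def)
  note c = cpair_lift[OF assms(1) this]
  show ?thesis
    by (rule pb_eqI[of "Src X" "Tgt X"])
      (use assms c in \<open>simp_all add: cpair_fst_def cpair_snd_def cpair_ob_def\<close>)
qed

lemma icmp_simps:
  assumes "is_icat E X" "composable X g f"
  shows "icmp E X g f \<in> Arr E" "Dom E (icmp E X g f) = Dom E f" "Cod E (icmp E X g f) = IAr X"
    "Src X \<cdot> icmp E X g f = Src X \<cdot> f" "Tgt X \<cdot> icmp E X g f = Tgt X \<cdot> g"
    "\<lbrakk>w \<in> Arr E; Cod E w = Dom E f\<rbrakk> \<Longrightarrow> icmp E X g f \<cdot> w = icmp E X (g \<cdot> w) (f \<cdot> w)"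
  using assms cpair_lift[OF assms] cpair_comp[OF assms]
  by (simp_all add: icmp_def comp_ext[OF Src_Cmp] comp_ext[OF Tgt_Cmp])

lemma Cmp_comp:
  assumes "is_icat E X" "k \<in> Arr E" "Cod E k = cpair_ob E X"
  shows "Cmp X \<cdot> k = icmp E X (cpair_fst E X \<cdot> k) (cpair_snd E X \<cdot> k)"
  using assms cpair_eta[OF assms] by (simp add: icmp_def)

text \<open>The unit laws of \<open>is_icat\<close> speak of the generic arrow
  \<open>Idt E (IAr X)\<close>; precomposition with \<open>f\<close> carries them to every
  stage.\<close>

lemma icmp_idn:
  assumes X: "is_icat E X" and f: "f \<in> Arr E" "Cod E f = IAr X"
  shows "icmp E X (Idn X \<cdot> (Tgt X \<cdot> f)) f = f" "icmp E X f (Idn X \<cdot> (Src X \<cdot> f)) = f"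
proof -
  have "Cmp X \<cdot> cpair E X (Idn X \<cdot> Tgt X) (Idt E (IAr X)) = Idt E (IAr X)"
    "Cmp X \<cdot> cpair E X (Idt E (IAr X)) (Idn X \<cdot> Src X) = Idt E (IAr X)"
    using X unfolding is_icat_def by blast+
  then have "icmp E X (Idn X \<cdot> Tgt X) (Idt E (IAr X)) \<cdot> f = f" "icmp E X (Idt E (IAr X)) (Idn X \<cdot> Src X) \<cdot> f = f"
    using f by (simp_all add: icmp_def)
  moreover have "composable X (Idn X \<cdot> Tgt X) (Idt E (IAr X))" "composable X (Idt E (IAr X)) (Idn X \<cdot> Src X)"
    using X by (simp_all add: composable_def)
  ultimately show "icmp E X (Idn X \<cdot> (Tgt X \<cdot> f)) f = f" "icmp E X f (Idn X \<cdot> (Src X \<cdot> f)) = f"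
    using X f by (simp_all add: icmp_simps)
qed

text \<open>The law of \<open>is_icat\<close> speaks of the generic composable triple. The arrow
  \<open>k\<close> names the triple \<open>((h, g), f)\<close>, and the law is precomposed with
  it.\<close>

lemma icmp_assoc_composable:
  assumes X: "is_icat E X" and hg: "composable X h g" and gf: "composable X g f"
  shows "icmp E X (icmp E X h g) f = icmp E X h (icmp E X g f)"
proof -
  let ?s = "Src X \<cdot> cpair_snd E X"
  let ?u = "pb_fst E ?s (Tgt X)" and ?v = "pb_snd E ?s (Tgt X)"
  have fg: "?s \<in> Arr E" "Tgt X \<in> Arr E" "Cod E ?s = Cod E (Tgt X)" using X by simp_all
  have hg': "h \<in> Arr E" "Cod E h = IAr X" "g \<in> Arr E" "Cod E g = IAr X" "Dom E h = Dom E g" "Src X \<cdot> h = Tgt X \<cdot> g"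
    and gf': "f \<in> Arr E" "Cod E f = IAr X" "Dom E g = Dom E f" "Src X \<cdot> g = Tgt X \<cdot> f"
    using hg gf by (auto simp: composable_def)
  note [simp] = X hg' gf' cpair_lift[OF X hg]
  have uv: "?u \<in> Arr E" "?v \<in> Arr E" "Dom E ?u = pb_ob E ?s (Tgt X)" "Dom E ?v = pb_ob E ?s (Tgt X)"
    "Cod E ?u = cpair_ob E X" "Cod E ?v = IAr X" "Src X \<cdot> (cpair_snd E X \<cdot> ?u) = Tgt X \<cdot> ?v"
    using fg trans[OF comp_assoc[symmetric] pb_square[OF fg]] by simp_all
  define k where "k = lift E ?u ?v (cpair E X h g) f"
  have k: "k \<in> Arr E" "Dom E k = Dom E f" "Cod E k = pb_ob E ?s (Tgt X)" "?u \<cdot> k = cpair E X h g" "?v \<cdot> k = f"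
    unfolding k_def using fg by simp_all
  note [simp] = uv k
  have c1: "composable X (Cmp X \<cdot> ?u) ?v"
    by (simp add: composable_def comp_ext[OF Src_Cmp])
  have c2: "composable X (cpair_snd E X \<cdot> ?u) ?v"
    by (simp add: composable_def)
  note [simp] = icmp_simps[OF X c1] icmp_simps[OF X c2]
  have c3: "composable X (cpair_fst E X \<cdot> ?u) (icmp E X (cpair_snd E X \<cdot> ?u) ?v)"
    by (simp add: composable_def)
  have "icmp E X (Cmp X \<cdot> ?u) ?v = icmp E X (cpair_fst E X \<cdot> ?u) (icmp E X (cpair_snd E X \<cdot> ?u) ?v)"
    using X unfolding is_icat_def Let_def icmp_def by blast
  from arg_cong[OF this, of "\<lambda>x. x \<cdot> k"] show ?thesis
    using icmp_simps(6)[OF X c3, of k] icmp_simps(6)[OF X c2, of k] icmp_simps(6)[OF X c1, of k]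
    by (simp add: icmp_def[of E X h g])
qed

lemma icmp_arr [simp]:
  assumes "is_icat E X" "g \<in> Arr E" "f \<in> Arr E" "Dom E g = Dom E f" "Cod E g = IAr X" "Cod E f = IAr X"
    "Src X \<cdot> g = Tgt X \<cdot> f"
  shows "icmp E X g f \<in> Arr E" "Dom E (icmp E X g f) = Dom E f" "Cod E (icmp E X g f) = IAr X"
    "Src X \<cdot> icmp E X g f = Src X \<cdot> f" "Tgt X \<cdot> icmp E X g f = Tgt X \<cdot> g"
  using icmp_simps[of X g f] assms by (auto simp: composable_def)

lemma icmp_comp [simp]:
  assumes "is_icat E X" "g \<in> Arr E" "f \<in> Arr E" "Dom E g = Dom E f" "Cod E g = IAr X" "Cod E f = IAr X"
    "Src X \<cdot> g = Tgt X \<cdot> f" "w \<in> Arr E" "Cod E w = Dom E f"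
  shows "icmp E X g f \<cdot> w = icmp E X (g \<cdot> w) (f \<cdot> w)"
  using icmp_simps(6)[of X g f w] assms by (auto simp: composable_def)

lemma icmp_left_unit [simp]:
  "\<lbrakk>is_icat E X; f \<in> Arr E; Cod E f = IAr X; x = Tgt X \<cdot> f\<rbrakk> \<Longrightarrow> icmp E X (Idn X \<cdot> x) f = f"
  and icmp_right_unit [simp]:
  "\<lbrakk>is_icat E X; f \<in> Arr E; Cod E f = IAr X; x = Src X \<cdot> f\<rbrakk> \<Longrightarrow> icmp E X f (Idn X \<cdot> x) = f"
  by (simp_all add: icmp_idn)

lemma icmp_assoc [simp]:
  assumes "is_icat E X" "h \<in> Arr E" "g \<in> Arr E" "f \<in> Arr E" "Dom E h = Dom E f" "Dom E g = Dom E f"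
    "Cod E h = IAr X" "Cod E g = IAr X" "Cod E f = IAr X" "Src X \<cdot> h = Tgt X \<cdot> g" "Src X \<cdot> g = Tgt X \<cdot> f"
  shows "icmp E X (icmp E X h g) f = icmp E X h (icmp E X g f)"
  using icmp_assoc_composable[of X h g f] assms by (auto simp: composable_def)

text \<open>The arrow \<open>Cmp\<close> is the value of the natural family \<open>m\<close> at the generic composable pair.\<close>

lemma icatI:
  assumes st: "s \<in> hom E A X" "t \<in> hom E A X" "i \<in> hom E X A" "s \<cdot> i = Idt E X" "t \<cdot> i = Idt E X"
  and m: "\<And>g f. \<lbrakk>g \<in> Arr E; f \<in> Arr E; Dom E g = Dom E f; Cod E g = A; Cod E f = A; s \<cdot> g = t \<cdot> f\<rbrakk> \<Longrightarrow>
    m g f \<in> hom E (Dom E f) A \<and> s \<cdot> m g f = s \<cdot> f \<and> t \<cdot> m g f = t \<cdot> g"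
  and m_comp: "\<And>g f w. \<lbrakk>g \<in> Arr E; f \<in> Arr E; Dom E g = Dom E f; Cod E g = A; Cod E f = A; s \<cdot> g = t \<cdot> f;
    w \<in> Arr E; Cod E w = Dom E f\<rbrakk> \<Longrightarrow> m g f \<cdot> w = m (g \<cdot> w) (f \<cdot> w)"
  and m_idn: "m (i \<cdot> t) (Idt E A) = Idt E A" "m (Idt E A) (i \<cdot> s) = Idt E A"
  and m_assoc: "\<And>h g f. \<lbrakk>h \<in> Arr E; g \<in> Arr E; f \<in> Arr E; Dom E h = Dom E f; Dom E g = Dom E f; Cod E h = A;
    Cod E g = A; Cod E f = A; s \<cdot> h = t \<cdot> g; s \<cdot> g = t \<cdot> f\<rbrakk> \<Longrightarrow> m (m h g) f = m h (m g f)"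
  defines "C \<equiv> \<lparr>IOb = X, IAr = A, Src = s, Tgt = t, Idn = i, Cmp = m (pb_fst E s t) (pb_snd E s t)\<rparr>"
  shows "is_icat E C"
    and "\<And>g f. \<lbrakk>g \<in> Arr E; f \<in> Arr E; Dom E g = Dom E f; Cod E g = A; Cod E f = A; s \<cdot> g = t \<cdot> f\<rbrakk>
      \<Longrightarrow> icmp E C g f = m g f"
proof -
  have [simp]: "s \<in> Arr E" "Dom E s = A" "Cod E s = X" "t \<in> Arr E" "Dom E t = A" "Cod E t = X"
    "i \<in> Arr E" "Dom E i = X" "Cod E i = A" using st by (auto simp: hom_iff)
  have [simp]: "A \<in> Obj E" "X \<in> Obj E" using dom_obj[of s] cod_obj[of s] by simp_all
  have C [simp]: "IOb C = X" "IAr C = A" "Src C = s" "Tgt C = t" "Idn C = i"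
    "Cmp C = m (pb_fst E s t) (pb_snd E s t)"
    "cpair_fst E C = pb_fst E s t" "cpair_snd E C = pb_snd E s t" "cpair_ob E C = pb_ob E s t"
    by (simp_all add: C_def cpair_fst_def cpair_snd_def cpair_ob_def)
  note [simp] = pb_square[of s t] comp_ext[OF pb_square[of s t]] st(4,5) comp_ext[OF st(4)] comp_ext[OF st(5)]
  have m' [simp]: "m g f \<in> Arr E" "Dom E (m g f) = Dom E f" "Cod E (m g f) = A" "s \<cdot> m g f = s \<cdot> f" "t \<cdot> m g f = t \<cdot> g"
    if "g \<in> Arr E" "f \<in> Arr E" "Dom E g = Dom E f" "Cod E g = A" "Cod E f = A" "s \<cdot> g = t \<cdot> f" for g f
    using m[OF that] by (auto simp: hom_iff)
  have cp: "Cmp C \<cdot> cpair E C g f = m g f"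
    if "g \<in> Arr E" "f \<in> Arr E" "Dom E g = Dom E f" "Cod E g = A" "Cod E f = A" "s \<cdot> g = t \<cdot> f" for g f
    using that by (simp add: cpair_def m_comp)
  then show "icmp E C g f = m g f"
    if "g \<in> Arr E" "f \<in> Arr E" "Dom E g = Dom E f" "Cod E g = A" "Cod E f = A" "s \<cdot> g = t \<cdot> f" for g f
    using that unfolding icmp_def by blast
  let ?s = "s \<cdot> pb_snd E s t"
  let ?u = "pb_fst E ?s t" and ?v = "pb_snd E ?s t"
  have fg: "?s \<in> Arr E" "t \<in> Arr E" "Cod E ?s = Cod E t" by simp_all
  have uv [simp]: "?u \<in> Arr E" "?v \<in> Arr E" "Dom E ?u = pb_ob E ?s t" "Dom E ?v = pb_ob E ?s t"
    "Cod E ?u = pb_ob E s t" "Cod E ?v = A" "s \<cdot> (pb_snd E s t \<cdot> ?u) = t \<cdot> ?v"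
    using fg trans[OF comp_assoc[symmetric] pb_square[OF fg]] by simp_all
  show "is_icat E C"
    unfolding is_icat_def Let_def
  proof (intro conjI)
    show "Cmp C \<cdot> cpair E C (Idn C \<cdot> Tgt C) (Idt E (IAr C)) = Idt E (IAr C)"
      using m_idn by (subst cp) (simp_all del: C add: C(1-5))
    show "Cmp C \<cdot> cpair E C (Idt E (IAr C)) (Idn C \<cdot> Src C) = Idt E (IAr C)"
      using m_idn by (subst cp) (simp_all del: C add: C(1-5))
    show "Cmp C \<cdot> cpair E C (Cmp C \<cdot> pb_fst E (Src C \<cdot> cpair_snd E C) (Tgt C)) (pb_snd E (Src C \<cdot> cpair_snd E C) (Tgt C)) =
      Cmp C \<cdot> cpair E C (cpair_fst E C \<cdot> pb_fst E (Src C \<cdot> cpair_snd E C) (Tgt C))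
        (Cmp C \<cdot> cpair E C (cpair_snd E C \<cdot> pb_fst E (Src C \<cdot> cpair_snd E C) (Tgt C))
          (pb_snd E (Src C \<cdot> cpair_snd E C) (Tgt C)))"
    proof -
      \<comment> \<open>At the generic triple, 1 to 4 rewrite each of the four composites in terms
        of \<open>m\<close>; what remains is associativity of \<open>m\<close>.\<close>
      have 1: "Cmp C \<cdot> ?u = m (pb_fst E s t \<cdot> ?u) (pb_snd E s t \<cdot> ?u)"
        by (simp add: m_comp)
      have 2: "Cmp C \<cdot> cpair E C (pb_snd E s t \<cdot> ?u) ?v = m (pb_snd E s t \<cdot> ?u) ?v"
        by (rule cp) simp_all
      have 3: "Cmp C \<cdot> cpair E C (m (pb_fst E s t \<cdot> ?u) (pb_snd E s t \<cdot> ?u)) ?v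
          = m (m (pb_fst E s t \<cdot> ?u) (pb_snd E s t \<cdot> ?u)) ?v"
        by (rule cp) simp_all
      have 4: "Cmp C \<cdot> cpair E C (pb_fst E s t \<cdot> ?u) (m (pb_snd E s t \<cdot> ?u) ?v)
          = m (pb_fst E s t \<cdot> ?u) (m (pb_snd E s t \<cdot> ?u) ?v)"
        by (rule cp) simp_all
      have 5: "m (m (pb_fst E s t \<cdot> ?u) (pb_snd E s t \<cdot> ?u)) ?v = m (pb_fst E s t \<cdot> ?u) (m (pb_snd E s t \<cdot> ?u) ?v)"
        by (rule m_assoc) simp_all
      show ?thesis unfolding C(3,4,7,8) 1 2 3 4 by (rule 5)
    qed
  qed (use st in \<open>simp_all add: hom_iff\<close>)
qed

section \<open>Internal functors and transformations at generalized elements\<close>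

lemma ifun_simps [simp]:
  assumes "is_ifun E F"
  shows "is_icat E (IDom F)" "is_icat E (ICod F)" "OnOb F \<in> Arr E" "Dom E (OnOb F) = IOb (IDom F)"
    "Cod E (OnOb F) = IOb (ICod F)" "OnAr F \<in> Arr E" "Dom E (OnAr F) = IAr (IDom F)"
    "Cod E (OnAr F) = IAr (ICod F)"
    and Src_OnAr: "ICod F = Y \<Longrightarrow> Src Y \<cdot> OnAr F = OnOb F \<cdot> Src (IDom F)"
    and Tgt_OnAr: "ICod F = Y \<Longrightarrow> Tgt Y \<cdot> OnAr F = OnOb F \<cdot> Tgt (IDom F)"
    and OnAr_Idn: "IDom F = X \<Longrightarrow> OnAr F \<cdot> Idn X = Idn (ICod F) \<cdot> OnOb F"
  using assms by (auto simp: is_ifun_def hom_iff Let_def)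

lemma ifun_comp_simps [simp]:
  assumes "is_ifun E F" "IDom F = X" "ICod F = Y"
  shows "\<lbrakk>x \<in> Arr E; Cod E x = IAr X\<rbrakk> \<Longrightarrow> Src Y \<cdot> (OnAr F \<cdot> x) = OnOb F \<cdot> (Src X \<cdot> x)"
    and "\<lbrakk>x \<in> Arr E; Cod E x = IAr X\<rbrakk> \<Longrightarrow> Tgt Y \<cdot> (OnAr F \<cdot> x) = OnOb F \<cdot> (Tgt X \<cdot> x)"
    and "\<lbrakk>x \<in> Arr E; Cod E x = IOb X\<rbrakk> \<Longrightarrow> OnAr F \<cdot> (Idn X \<cdot> x) = Idn Y \<cdot> (OnOb F \<cdot> x)"
  using assms comp_ext[OF Src_OnAr[of F Y], of x] comp_ext[OF Tgt_OnAr[of F Y], of x]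
    comp_ext[OF OnAr_Idn[of F X], of x] by auto

lemma OnAr_icmp [simp]:
  assumes F: "is_ifun E F" "IDom F = X" and gf: "g \<in> Arr E" "f \<in> Arr E" "Dom E g = Dom E f" "Cod E g = IAr X"
    "Cod E f = IAr X" "Src X \<cdot> g = Tgt X \<cdot> f"
  shows "OnAr F \<cdot> icmp E X g f = icmp E (ICod F) (OnAr F \<cdot> g) (OnAr F \<cdot> f)"
proof -
  let ?Y = "ICod F"
  have X: "is_icat E X" using ifun_simps(1)[OF F(1)] F(2) by simp
  note [simp] = F X gf
  have c: "composable X g f" by (simp add: composable_def)
  note [simp] = cpair_lift[OF X c]
  have "OnAr F \<cdot> Cmp X = icmp E ?Y (OnAr F \<cdot> cpair_fst E X) (OnAr F \<cdot> cpair_snd E X)"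
    using F unfolding is_ifun_def Let_def icmp_def by blast
  from arg_cong[OF this, of "\<lambda>x. x \<cdot> cpair E X g f"] show ?thesis
    by (simp add: icmp_def[of E X])
qed

text \<open>The law in \<open>is_ifun\<close> is the instance of the last premise at the generic
  composable pair, whose composite is \<open>Cmp\<close> itself.\<close>

lemma is_ifunI:
  assumes "is_icat E (IDom F)" "is_icat E (ICod F)" "OnOb F \<in> hom E (IOb (IDom F)) (IOb (ICod F))"
    "OnAr F \<in> hom E (IAr (IDom F)) (IAr (ICod F))"
    "Src (ICod F) \<cdot> OnAr F = OnOb F \<cdot> Src (IDom F)" "Tgt (ICod F) \<cdot> OnAr F = OnOb F \<cdot> Tgt (IDom F)"
    "OnAr F \<cdot> Idn (IDom F) = Idn (ICod F) \<cdot> OnOb F"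
    and icmp: "\<And>g f. \<lbrakk>g \<in> Arr E; f \<in> Arr E; Dom E g = Dom E f; Cod E g = IAr (IDom F); Cod E f = IAr (IDom F);
      Src (IDom F) \<cdot> g = Tgt (IDom F) \<cdot> f\<rbrakk>
      \<Longrightarrow> OnAr F \<cdot> icmp E (IDom F) g f = icmp E (ICod F) (OnAr F \<cdot> g) (OnAr F \<cdot> f)"
  shows "is_ifun E F"
proof -
  let ?X = "IDom F"
  have "OnAr F \<cdot> Cmp ?X = icmp E (ICod F) (OnAr F \<cdot> cpair_fst E ?X) (OnAr F \<cdot> cpair_snd E ?X)"
    using icmp[of "cpair_fst E ?X" "cpair_snd E ?X"] assms(1) Cmp_comp[of ?X "Idt E (cpair_ob E ?X)"] by simp
  then show ?thesis using assms(1-7) unfolding is_ifun_def Let_def icmp_def by blast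
qed

lemma itrans_simps [simp]:
  assumes "is_itrans E \<alpha>"
  shows "is_ifun E (TDom \<alpha>)" "is_ifun E (TCod \<alpha>)" "IDom (TCod \<alpha>) = IDom (TDom \<alpha>)" "ICod (TCod \<alpha>) = ICod (TDom \<alpha>)"
    "Cmpt \<alpha> \<in> Arr E" "Dom E (Cmpt \<alpha>) = IOb (IDom (TDom \<alpha>))" "Cod E (Cmpt \<alpha>) = IAr (ICod (TDom \<alpha>))"
    and Src_Cmpt: "ICod (TDom \<alpha>) = Y \<Longrightarrow> Src Y \<cdot> Cmpt \<alpha> = OnOb (TDom \<alpha>)"
    and Tgt_Cmpt: "ICod (TDom \<alpha>) = Y \<Longrightarrow> Tgt Y \<cdot> Cmpt \<alpha> = OnOb (TCod \<alpha>)"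
  using assms by (auto simp: is_itrans_def hom_iff Let_def)

lemma itrans_comp_simps [simp]:
  assumes "is_itrans E \<alpha>" "ICod (TDom \<alpha>) = Y" "x \<in> Arr E" "Cod E x = IOb (IDom (TDom \<alpha>))"
  shows "Src Y \<cdot> (Cmpt \<alpha> \<cdot> x) = OnOb (TDom \<alpha>) \<cdot> x" "Tgt Y \<cdot> (Cmpt \<alpha> \<cdot> x) = OnOb (TCod \<alpha>) \<cdot> x"
  using assms comp_ext[OF Src_Cmpt[of \<alpha> Y], of x] comp_ext[OF Tgt_Cmpt[of \<alpha> Y], of x] by auto

lemma itrans_natural:
  assumes \<alpha>: "is_itrans E \<alpha>" and f: "f \<in> Arr E" "Cod E f = IAr (IDom (TDom \<alpha>))"
  shows "icmp E (ICod (TDom \<alpha>)) (OnAr (TCod \<alpha>) \<cdot> f) (Cmpt \<alpha> \<cdot> (Src (IDom (TDom \<alpha>)) \<cdot> f)) =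
    icmp E (ICod (TDom \<alpha>)) (Cmpt \<alpha> \<cdot> (Tgt (IDom (TDom \<alpha>)) \<cdot> f)) (OnAr (TDom \<alpha>) \<cdot> f)"
proof -
  let ?X = "IDom (TDom \<alpha>)" and ?Y = "ICod (TDom \<alpha>)"
  have "icmp E ?Y (OnAr (TCod \<alpha>)) (Cmpt \<alpha> \<cdot> Src ?X) = icmp E ?Y (Cmpt \<alpha> \<cdot> Tgt ?X) (OnAr (TDom \<alpha>))"
    using \<alpha> unfolding is_itrans_def Let_def icmp_def by blast
  from arg_cong[OF this, of "\<lambda>x. x \<cdot> f"] show ?thesis
    using \<alpha> f by simp
qed

lemma is_itransI:
  assumes FG: "is_ifun E (TDom \<alpha>)" "is_ifun E (TCod \<alpha>)" "IDom (TDom \<alpha>) = X" "IDom (TCod \<alpha>) = X"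
    "ICod (TDom \<alpha>) = Y" "ICod (TCod \<alpha>) = Y"
    "Cmpt \<alpha> \<in> hom E (IOb X) (IAr Y)" "Src Y \<cdot> Cmpt \<alpha> = OnOb (TDom \<alpha>)" "Tgt Y \<cdot> Cmpt \<alpha> = OnOb (TCod \<alpha>)"
    and nat: "icmp E Y (OnAr (TCod \<alpha>)) (Cmpt \<alpha> \<cdot> Src X) = icmp E Y (Cmpt \<alpha> \<cdot> Tgt X) (OnAr (TDom \<alpha>))"
  shows "is_itrans E \<alpha>"
  using assms unfolding is_itrans_def Let_def icmp_def by blast

lemma ifun_eqI:
  fixes F G :: "('o, 'a) ifun"
  assumes "IDom F = IDom G" "ICod F = ICod G" "OnOb F = OnOb G" "OnAr F = OnAr G"
  shows "F = G"
  using assms by simp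

lemma itrans_eqI:
  fixes \<alpha> \<beta> :: "('o, 'a) itrans"
  assumes "TDom \<alpha> = TDom \<beta>" "TCod \<alpha> = TCod \<beta>" "Cmpt \<alpha> = Cmpt \<beta>"
  shows "\<alpha> = \<beta>"
  using assms by simp

section \<open>The 2-category of internal categories\<close>

abbreviation ifun_comp (infixr "\<odot>" 70) where
  "G \<odot> F \<equiv> G \<cdot>\<^bsub>Cat1 E\<^esub> F"

lemma Cat1_simps [simp]:
  "X \<in> Obj (Cat1 E) \<longleftrightarrow> is_icat E X"
  "F \<in> Arr (Cat1 E) \<longleftrightarrow> is_ifun E F"
  "Dom (Cat1 E) = IDom" "Cod (Cat1 E) = ICod"
  "IDom (Idt (Cat1 E) X) = X" "ICod (Idt (Cat1 E) X) = X"
  "OnOb (Idt (Cat1 E) X) = Idt E (IOb X)" "OnAr (Idt (Cat1 E) X) = Idt E (IAr X)"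
  "IDom (G \<odot> F) = IDom F" "ICod (G \<odot> F) = ICod G"
  "OnOb (G \<odot> F) = OnOb G \<cdot> OnOb F" "OnAr (G \<odot> F) = OnAr G \<cdot> OnAr F"
  by (simp_all add: Cat1_def)

lemma is_ifun_Idt [simp]: "is_icat E X \<Longrightarrow> is_ifun E (Idt (Cat1 E) X)"
  by (rule is_ifunI) (simp_all add: hom_iff)

lemma is_ifun_comp [simp]:
  assumes "is_ifun E F" "is_ifun E G" "IDom G = ICod F"
  shows "is_ifun E (G \<odot> F)"
  by (rule is_ifunI) (use assms in \<open>simp_all add: hom_iff\<close>)

lemma category_Cat1: "category (Cat1 E)"
  unfolding category_def
proof (intro conjI ballI impI)
  fix f g h assume "f \<in> Arr (Cat1 E)" "g \<in> Arr (Cat1 E)" "h \<in> Arr (Cat1 E)"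
    "Dom (Cat1 E) g = Cod (Cat1 E) f" "Dom (Cat1 E) h = Cod (Cat1 E) g"
  then show "(h \<odot> g) \<odot> f = h \<odot> (g \<odot> f)"
    by - (rule ifun_eqI, simp_all)
next
  fix f assume "f \<in> Arr (Cat1 E)"
  then show "f \<odot> Idt (Cat1 E) (Dom (Cat1 E) f) = f"
    by - (rule ifun_eqI, simp_all)
next
  fix f assume "f \<in> Arr (Cat1 E)"
  then show "Idt (Cat1 E) (Cod (Cat1 E) f) \<odot> f = f"
    by - (rule ifun_eqI, simp_all)
qed (simp_all add: hom_iff)

sublocale Cat: cat_base "Cat1 E"
  by unfold_locales (rule category_Cat1)

lemma Cat2_simps [simp]:
  "Und (Cat2 E) = Cat1 E"
  "\<alpha> \<in> Cell (Cat2 E) \<longleftrightarrow> is_itrans E \<alpha>"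
  "CDom (Cat2 E) = TDom" "CCod (Cat2 E) = TCod"
  "TDom (CIdt (Cat2 E) F) = F" "TCod (CIdt (Cat2 E) F) = F"
  "Cmpt (CIdt (Cat2 E) F) = Idn (ICod F) \<cdot> OnOb F"
  "TDom (VComp (Cat2 E) \<beta> \<alpha>) = TDom \<alpha>" "TCod (VComp (Cat2 E) \<beta> \<alpha>) = TCod \<beta>"
  "Cmpt (VComp (Cat2 E) \<beta> \<alpha>) = icmp E (ICod (TDom \<alpha>)) (Cmpt \<beta>) (Cmpt \<alpha>)"
  "TDom (HComp (Cat2 E) \<beta> \<alpha>) = TDom \<beta> \<odot> TDom \<alpha>"
  "TCod (HComp (Cat2 E) \<beta> \<alpha>) = TCod \<beta> \<odot> TCod \<alpha>"
  "Cmpt (HComp (Cat2 E) \<beta> \<alpha>) =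
     icmp E (ICod (TDom \<beta>)) (Cmpt \<beta> \<cdot> OnOb (TCod \<alpha>)) (OnAr (TDom \<beta>) \<cdot> Cmpt \<alpha>)"
  by (simp_all add: Cat2_def icmp_def)

lemma is_itrans_CIdt [simp]: "is_ifun E F \<Longrightarrow> is_itrans E (CIdt (Cat2 E) F)"
  by (rule is_itransI[where X = "IDom F" and Y = "ICod F"]) (simp_all add: hom_iff)

text \<open>The naturality square of \<open>\<beta>\<close> is pasted onto that of
  \<open>\<alpha>\<close>; reassociation exposes one square at a time.\<close>

lemma is_itrans_VComp [simp]:
  assumes \<alpha>: "is_itrans E \<alpha>" and \<beta>: "is_itrans E \<beta>" and c: "TDom \<beta> = TCod \<alpha>"
  shows "is_itrans E (VComp (Cat2 E) \<beta> \<alpha>)"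
proof (rule is_itransI)
  let ?X = "IDom (TDom \<alpha>)" and ?Y = "ICod (TDom \<alpha>)"
  note [simp] = \<alpha> \<beta> c
  have "icmp E ?Y (OnAr (TCod \<beta>)) (Cmpt \<beta> \<cdot> Src ?X) = icmp E ?Y (Cmpt \<beta> \<cdot> Tgt ?X) (OnAr (TCod \<alpha>))"
    and "icmp E ?Y (OnAr (TCod \<alpha>)) (Cmpt \<alpha> \<cdot> Src ?X) = icmp E ?Y (Cmpt \<alpha> \<cdot> Tgt ?X) (OnAr (TDom \<alpha>))"
    using itrans_natural[OF \<beta>, of "Idt E (IAr ?X)"] itrans_natural[OF \<alpha>, of "Idt E (IAr ?X)"] by simp_all
  note n = this
  have "icmp E ?Y (icmp E ?Y (OnAr (TCod \<beta>)) (Cmpt \<beta> \<cdot> Src ?X)) (Cmpt \<alpha> \<cdot> Src ?X)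
      = icmp E ?Y (Cmpt \<beta> \<cdot> Tgt ?X) (icmp E ?Y (OnAr (TCod \<alpha>)) (Cmpt \<alpha> \<cdot> Src ?X))"
    unfolding n(1) by simp
  then show "icmp E ?Y (OnAr (TCod (VComp (Cat2 E) \<beta> \<alpha>))) (Cmpt (VComp (Cat2 E) \<beta> \<alpha>) \<cdot> Src ?X) =
    icmp E ?Y (Cmpt (VComp (Cat2 E) \<beta> \<alpha>) \<cdot> Tgt ?X) (OnAr (TDom (VComp (Cat2 E) \<beta> \<alpha>)))"
    unfolding n(2) by simp
qed (use assms in \<open>simp_all add: hom_iff\<close>)

text \<open>This is naturality of \<open>\<beta>\<close> at the arrows \<open>Cmpt \<alpha>\<close>:
  the two candidate formulas for the horizontal composite agree.\<close>

lemma whisker_natural: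
  assumes \<alpha>: "is_itrans E \<alpha>" and \<beta>: "is_itrans E \<beta>" and c: "IDom (TDom \<beta>) = ICod (TDom \<alpha>)"
  shows "icmp E (ICod (TDom \<beta>)) (OnAr (TCod \<beta>) \<cdot> Cmpt \<alpha>) (Cmpt \<beta> \<cdot> OnOb (TDom \<alpha>))
    = icmp E (ICod (TDom \<beta>)) (Cmpt \<beta> \<cdot> OnOb (TCod \<alpha>)) (OnAr (TDom \<beta>) \<cdot> Cmpt \<alpha>)"
  using itrans_natural[OF \<beta>, of "Cmpt \<alpha>"] assms by simp

text \<open>Two squares are pasted: \<open>n1\<close> is naturality of \<open>\<beta>\<close> at the
  arrows in the image of \<open>?G\<close>, and \<open>n2\<close> is the naturality square of
  \<open>\<alpha>\<close> carried along \<open>?H\<close>.\<close>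

lemma is_itrans_HComp [simp]:
  assumes \<alpha>: "is_itrans E \<alpha>" and \<beta>: "is_itrans E \<beta>" and c: "IDom (TDom \<beta>) = ICod (TDom \<alpha>)"
  shows "is_itrans E (HComp (Cat2 E) \<beta> \<alpha>)"
proof (rule is_itransI)
  let ?X = "IDom (TDom \<alpha>)" and ?Y = "ICod (TDom \<alpha>)" and ?Z = "ICod (TDom \<beta>)"
  let ?F = "TDom \<alpha>" and ?G = "TCod \<alpha>" and ?H = "TDom \<beta>" and ?K = "TCod \<beta>"
  note [simp] = \<alpha> \<beta> c
  have n1: "icmp E ?Z (OnAr ?K \<cdot> OnAr ?G) (Cmpt \<beta> \<cdot> (OnOb ?G \<cdot> Src ?X)) = icmp E ?Z (Cmpt \<beta> \<cdot> (OnOb ?G \<cdot> Tgt ?X)) (OnAr ?H \<cdot> OnAr ?G)"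
    using itrans_natural[OF \<beta>, of "OnAr ?G"] by simp
  have "icmp E ?Y (OnAr ?G) (Cmpt \<alpha> \<cdot> Src ?X) = icmp E ?Y (Cmpt \<alpha> \<cdot> Tgt ?X) (OnAr ?F)"
    using itrans_natural[OF \<alpha>, of "Idt E (IAr ?X)"] by simp
  from arg_cong[OF this, of "\<lambda>x. OnAr ?H \<cdot> x"]
  have n2: "icmp E ?Z (OnAr ?H \<cdot> OnAr ?G) (OnAr ?H \<cdot> (Cmpt \<alpha> \<cdot> Src ?X)) = icmp E ?Z (OnAr ?H \<cdot> (Cmpt \<alpha> \<cdot> Tgt ?X)) (OnAr ?H \<cdot> OnAr ?F)"
    by simp
  have "icmp E ?Z (icmp E ?Z (OnAr ?K \<cdot> OnAr ?G) (Cmpt \<beta> \<cdot> (OnOb ?G \<cdot> Src ?X))) (OnAr ?H \<cdot> (Cmpt \<alpha> \<cdot> Src ?X))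
      = icmp E ?Z (Cmpt \<beta> \<cdot> (OnOb ?G \<cdot> Tgt ?X)) (icmp E ?Z (OnAr ?H \<cdot> OnAr ?G) (OnAr ?H \<cdot> (Cmpt \<alpha> \<cdot> Src ?X)))"
    unfolding n1 by simp
  then show "icmp E ?Z (OnAr (TCod (HComp (Cat2 E) \<beta> \<alpha>))) (Cmpt (HComp (Cat2 E) \<beta> \<alpha>) \<cdot> Src ?X) =
    icmp E ?Z (Cmpt (HComp (Cat2 E) \<beta> \<alpha>) \<cdot> Tgt ?X) (OnAr (TDom (HComp (Cat2 E) \<beta> \<alpha>)))"
    unfolding n2 by simp
qed (use assms in \<open>simp_all add: hom_iff\<close>)

lemma category_vertical: "category (vertical (Cat2 E))"
  unfolding category_def
proof (intro conjI ballI impI)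
  have v [simp]: "Obj (vertical (Cat2 E)) = {F. is_ifun E F}" "Arr (vertical (Cat2 E)) = {\<alpha>. is_itrans E \<alpha>}"
    "Dom (vertical (Cat2 E)) = TDom" "Cod (vertical (Cat2 E)) = TCod" "Idt (vertical (Cat2 E)) = CIdt (Cat2 E)"
    "Comp (vertical (Cat2 E)) = VComp (Cat2 E)"
    by (auto simp: vertical_def)
  {
    fix f assume "f \<in> Arr (vertical (Cat2 E))"
    then have [simp]: "is_itrans E f" by simp
    show "Dom (vertical (Cat2 E)) f \<in> Obj (vertical (Cat2 E))" "Cod (vertical (Cat2 E)) f \<in> Obj (vertical (Cat2 E))"
      by simp_all
    show "f \<cdot>\<^bsub>vertical (Cat2 E)\<^esub> Idt (vertical (Cat2 E)) (Dom (vertical (Cat2 E)) f) = f"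
      "Idt (vertical (Cat2 E)) (Cod (vertical (Cat2 E)) f) \<cdot>\<^bsub>vertical (Cat2 E)\<^esub> f = f"
      by (rule itrans_eqI; simp)+
    fix g assume "g \<in> Arr (vertical (Cat2 E))" and c: "Dom (vertical (Cat2 E)) g = Cod (vertical (Cat2 E)) f"
    then have [simp]: "is_itrans E g" "TDom g = TCod f" by simp_all
    show "g \<cdot>\<^bsub>vertical (Cat2 E)\<^esub> f
        \<in> hom (vertical (Cat2 E)) (Dom (vertical (Cat2 E)) f) (Cod (vertical (Cat2 E)) g)"
      by (simp add: hom_iff)
    fix h assume "h \<in> Arr (vertical (Cat2 E))" and d: "Dom (vertical (Cat2 E)) h = Cod (vertical (Cat2 E)) g"
    then have [simp]: "is_itrans E h" "TDom h = TCod g" by simp_all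
    show "(h \<cdot>\<^bsub>vertical (Cat2 E)\<^esub> g) \<cdot>\<^bsub>vertical (Cat2 E)\<^esub> f
        = h \<cdot>\<^bsub>vertical (Cat2 E)\<^esub> (g \<cdot>\<^bsub>vertical (Cat2 E)\<^esub> f)"
      by (rule itrans_eqI) simp_all
  }
  fix F assume "F \<in> Obj (vertical (Cat2 E))"
  then show "Idt (vertical (Cat2 E)) F \<in> hom (vertical (Cat2 E)) F F" by (simp add: hom_iff)
qed

lemma Cat2_interchange:
  assumes \<alpha>: "is_itrans E \<alpha>" "is_itrans E \<alpha>'" "TDom \<alpha>' = TCod \<alpha>"
    and \<beta>: "is_itrans E \<beta>" "is_itrans E \<beta>'" "TDom \<beta>' = TCod \<beta>"
    and c: "IDom (TDom \<beta>) = ICod (TDom \<alpha>)"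
  shows "HComp (Cat2 E) (VComp (Cat2 E) \<beta>' \<beta>) (VComp (Cat2 E) \<alpha>' \<alpha>)
    = VComp (Cat2 E) (HComp (Cat2 E) \<beta>' \<alpha>') (HComp (Cat2 E) \<beta> \<alpha>)"
proof (rule itrans_eqI)
  let ?Z = "ICod (TDom \<beta>)" and ?H = "TDom \<beta>" and ?K = "TCod \<beta>" and ?F = "TDom \<alpha>" and ?G = "TCod \<alpha>" and ?G' = "TCod \<alpha>'"
  note [simp] = \<alpha> \<beta> c
  \<comment> \<open>Up to associativity the two sides differ only in the order of
    \<open>\<beta>\<close> and \<open>\<alpha>'\<close> in the middle, and naturality of
    \<open>\<beta>\<close> at \<open>\<alpha>'\<close> exchanges them.\<close>
  have n: "icmp E ?Z (OnAr ?K \<cdot> Cmpt \<alpha>') (Cmpt \<beta> \<cdot> OnOb ?G) = icmp E ?Z (Cmpt \<beta> \<cdot> OnOb ?G') (OnAr ?H \<cdot> Cmpt \<alpha>')"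
    using whisker_natural[OF \<alpha>(2) \<beta>(1)] by simp
  have "icmp E ?Z (Cmpt \<beta>' \<cdot> OnOb ?G') (icmp E ?Z (icmp E ?Z (OnAr ?K \<cdot> Cmpt \<alpha>') (Cmpt \<beta> \<cdot> OnOb ?G)) (OnAr ?H \<cdot> Cmpt \<alpha>))
     = icmp E ?Z (icmp E ?Z (Cmpt \<beta>' \<cdot> OnOb ?G') (Cmpt \<beta> \<cdot> OnOb ?G')) (icmp E ?Z (OnAr ?H \<cdot> Cmpt \<alpha>') (OnAr ?H \<cdot> Cmpt \<alpha>))"
    unfolding n by simp
  then show "Cmpt (HComp (Cat2 E) (VComp (Cat2 E) \<beta>' \<beta>) (VComp (Cat2 E) \<alpha>' \<alpha>)) =
    Cmpt (VComp (Cat2 E) (HComp (Cat2 E) \<beta>' \<alpha>') (HComp (Cat2 E) \<beta> \<alpha>))"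
    by simp
qed simp_all

lemma two_category_Cat2: "two_category (Cat2 E)"
  unfolding two_category_def
proof (intro conjI)
  show "category (vertical (Cat2 E))" by (rule category_vertical)
  show "\<forall>\<alpha>\<in>Cell (Cat2 E).
    HComp (Cat2 E) (CIdt (Cat2 E) (Idt (Und (Cat2 E)) (Cod (Und (Cat2 E)) (CDom (Cat2 E) \<alpha>)))) \<alpha> = \<alpha> \<and>
    HComp (Cat2 E) \<alpha> (CIdt (Cat2 E) (Idt (Und (Cat2 E)) (Dom (Und (Cat2 E)) (CDom (Cat2 E) \<alpha>)))) = \<alpha>"
  proof (intro ballI conjI)
    fix \<alpha> assume "\<alpha> \<in> Cell (Cat2 E)"
    then have \<alpha>: "is_itrans E \<alpha>" by simp
    show "HComp (Cat2 E) (CIdt (Cat2 E) (Idt (Und (Cat2 E)) (Cod (Und (Cat2 E)) (CDom (Cat2 E) \<alpha>)))) \<alpha> = \<alpha>"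
      by (rule itrans_eqI) (simp_all add: \<alpha>)
    show "HComp (Cat2 E) \<alpha> (CIdt (Cat2 E) (Idt (Und (Cat2 E)) (Dom (Und (Cat2 E)) (CDom (Cat2 E) \<alpha>)))) = \<alpha>"
      by (rule itrans_eqI) (simp_all add: \<alpha>)
  qed
  show "\<forall>\<alpha> \<beta> \<gamma>. hcomposable (Cat2 E) \<beta> \<alpha> \<and> hcomposable (Cat2 E) \<gamma> \<beta> \<longrightarrow>
      HComp (Cat2 E) (HComp (Cat2 E) \<gamma> \<beta>) \<alpha> = HComp (Cat2 E) \<gamma> (HComp (Cat2 E) \<beta> \<alpha>)"
  proof (intro allI impI)
    fix \<alpha> \<beta> \<gamma> assume "hcomposable (Cat2 E) \<beta> \<alpha> \<and> hcomposable (Cat2 E) \<gamma> \<beta>"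
    then have [simp]: "is_itrans E \<alpha>" "is_itrans E \<beta>" "is_itrans E \<gamma>" "IDom (TDom \<beta>) = ICod (TDom \<alpha>)"
      "IDom (TDom \<gamma>) = ICod (TDom \<beta>)" by (auto simp: hcomposable_def)
    show "HComp (Cat2 E) (HComp (Cat2 E) \<gamma> \<beta>) \<alpha> = HComp (Cat2 E) \<gamma> (HComp (Cat2 E) \<beta> \<alpha>)"
      by (rule itrans_eqI) simp_all
  qed
  show "\<forall>f\<in>Arr (Und (Cat2 E)). \<forall>g\<in>Arr (Und (Cat2 E)). Dom (Und (Cat2 E)) g = Cod (Und (Cat2 E)) f \<longrightarrow>
      HComp (Cat2 E) (CIdt (Cat2 E) g) (CIdt (Cat2 E) f) = CIdt (Cat2 E) (g \<cdot>\<^bsub>Und (Cat2 E)\<^esub> f)"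
  proof (intro ballI impI)
    fix f g assume "f \<in> Arr (Und (Cat2 E))" "g \<in> Arr (Und (Cat2 E))" "Dom (Und (Cat2 E)) g = Cod (Und (Cat2 E)) f"
    then have [simp]: "is_ifun E f" "is_ifun E g" "IDom g = ICod f" by simp_all
    show "HComp (Cat2 E) (CIdt (Cat2 E) g) (CIdt (Cat2 E) f) = CIdt (Cat2 E) (g \<cdot>\<^bsub>Und (Cat2 E)\<^esub> f)"
      by (rule itrans_eqI) simp_all
  qed
  show "\<forall>\<alpha>\<in>Cell (Cat2 E). \<forall>\<alpha>'\<in>Cell (Cat2 E). \<forall>\<beta>\<in>Cell (Cat2 E). \<forall>\<beta>'\<in>Cell (Cat2 E).
      CDom (Cat2 E) \<alpha>' = CCod (Cat2 E) \<alpha> \<and> CDom (Cat2 E) \<beta>' = CCod (Cat2 E) \<beta> \<and> hcomposable (Cat2 E) \<beta> \<alpha> \<longrightarrow>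
      HComp (Cat2 E) (VComp (Cat2 E) \<beta>' \<beta>) (VComp (Cat2 E) \<alpha>' \<alpha>) =
      VComp (Cat2 E) (HComp (Cat2 E) \<beta>' \<alpha>') (HComp (Cat2 E) \<beta> \<alpha>)"
    using Cat2_interchange by (simp add: hcomposable_def)
qed (simp_all add: category_Cat1 hcomposable_def cells_def)

sublocale Cat2: twocat "Cat2 E"
  rewrites "Und (Cat2 E) = Cat1 E"
  by unfold_locales (simp_all add: two_category_Cat2)

section \<open>Products and discrete internal categories\<close>

text \<open>The structure is componentwise. \<open>Cmp\<close> is the componentwise composite of the
  generic composable pair \<open>(g, f)\<close>, the shape that \<open>icatI\<close>
  expects.\<close>

definition prod_icat :: "('o, 'a) icat \<Rightarrow> ('o, 'a) icat \<Rightarrow> ('o, 'a) icat" where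
  "prod_icat X Y =
     (let p = prod_fst E (IAr X) (IAr Y); q = prod_snd E (IAr X) (IAr Y);
          l0 = lift E (prod_fst E (IOb X) (IOb Y)) (prod_snd E (IOb X) (IOb Y)); l1 = lift E p q;
          s = l0 (Src X \<cdot> p) (Src Y \<cdot> q); t = l0 (Tgt X \<cdot> p) (Tgt Y \<cdot> q);
          g = pb_fst E s t; f = pb_snd E s t
      in \<lparr>IOb = prod_ob E (IOb X) (IOb Y), IAr = prod_ob E (IAr X) (IAr Y), Src = s, Tgt = t,
          Idn = l1 (Idn X \<cdot> prod_fst E (IOb X) (IOb Y)) (Idn Y \<cdot> prod_snd E (IOb X) (IOb Y)),
          Cmp = l1 (icmp E X (p \<cdot> g) (p \<cdot> f)) (icmp E Y (q \<cdot> g) (q \<cdot> f))\<rparr>)"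

lemma prod_icat_sel [simp]:
  "IOb (prod_icat X Y) = prod_ob E (IOb X) (IOb Y)" "IAr (prod_icat X Y) = prod_ob E (IAr X) (IAr Y)"
  by (simp_all add: prod_icat_def Let_def)

lemma prod_icat:
  assumes X: "is_icat E X" and Y: "is_icat E Y"
  defines "p \<equiv> prod_fst E (IAr X) (IAr Y)" and "q \<equiv> prod_snd E (IAr X) (IAr Y)"
  defines "p0 \<equiv> prod_fst E (IOb X) (IOb Y)" and "q0 \<equiv> prod_snd E (IOb X) (IOb Y)"
  shows is_icat_prod: "is_icat E (prod_icat X Y)"
    and Src_prod: "p0 \<cdot> Src (prod_icat X Y) = Src X \<cdot> p" "q0 \<cdot> Src (prod_icat X Y) = Src Y \<cdot> q"
    and Tgt_prod: "p0 \<cdot> Tgt (prod_icat X Y) = Tgt X \<cdot> p" "q0 \<cdot> Tgt (prod_icat X Y) = Tgt Y \<cdot> q"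
    and Idn_prod: "p \<cdot> Idn (prod_icat X Y) = Idn X \<cdot> p0" "q \<cdot> Idn (prod_icat X Y) = Idn Y \<cdot> q0"
    and icmp_prod: "\<And>g f. \<lbrakk>g \<in> Arr E; f \<in> Arr E; Dom E g = Dom E f; Cod E g = prod_ob E (IAr X) (IAr Y);
        Cod E f = prod_ob E (IAr X) (IAr Y); Src (prod_icat X Y) \<cdot> g = Tgt (prod_icat X Y) \<cdot> f\<rbrakk>
      \<Longrightarrow> icmp E (prod_icat X Y) g f = lift E p q (icmp E X (p \<cdot> g) (p \<cdot> f)) (icmp E Y (q \<cdot> g) (q \<cdot> f))"
proof -
  note [simp] = X Y
  let ?A = "prod_ob E (IAr X) (IAr Y)" and ?O = "prod_ob E (IOb X) (IOb Y)"
  let ?lO = "lift E p0 q0" and ?lA = "lift E p q"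
  note pr1 = prod_is_product[of "IAr X" "IAr Y", folded p_def q_def, simplified]
    and pr0 = prod_is_product[of "IOb X" "IOb Y", folded p0_def q0_def, simplified]
  note [simp] = product_proj[OF pr1] lift_props[OF pr1] fst_lift_comp[OF pr1]
    product_proj[OF pr0] lift_props[OF pr0] fst_lift_comp[OF pr0]
  define s t i where sti: "s = ?lO (Src X \<cdot> p) (Src Y \<cdot> q)" "t = ?lO (Tgt X \<cdot> p) (Tgt Y \<cdot> q)"
    "i = ?lA (Idn X \<cdot> p0) (Idn Y \<cdot> q0)"
  define m where "m = (\<lambda>g f. ?lA (icmp E X (p \<cdot> g) (p \<cdot> f)) (icmp E Y (q \<cdot> g) (q \<cdot> f)))"
  let ?C = "\<lparr>IOb = ?O, IAr = ?A, Src = s, Tgt = t, Idn = i, Cmp = m (pb_fst E s t) (pb_snd E s t)\<rparr>"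
  have C: "prod_icat X Y = ?C"
    by (simp add: prod_icat_def Let_def m_def sti p_def q_def p0_def q0_def)
  \<comment> \<open>A pair composable in the product is composable in each factor, so that the two
    composites inside \<open>m\<close> are meaningful.\<close>
  have s: "Src X \<cdot> (p \<cdot> g) = Tgt X \<cdot> (p \<cdot> f) \<and> Src Y \<cdot> (q \<cdot> g) = Tgt Y \<cdot> (q \<cdot> f)"
    if "g \<in> Arr E" "f \<in> Arr E" "Dom E g = Dom E f" "Cod E g = ?A" "Cod E f = ?A" "s \<cdot> g = t \<cdot> f" for g f
    using that(1-5) arg_cong[OF that(6), of "\<lambda>x. p0 \<cdot> x"] arg_cong[OF that(6), of "\<lambda>x. q0 \<cdot> x"] by (simp add: sti)
  have "is_icat E ?C \<and> (\<forall>g f. g \<in> Arr E \<longrightarrow> f \<in> Arr E \<longrightarrow> Dom E g = Dom E f \<longrightarrow> Cod E g = ?A \<longrightarrow> Cod E f = ?A \<longrightarrow> s \<cdot> g = t \<cdot> f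
      \<longrightarrow> icmp E ?C g f = m g f)"
  proof (intro conjI allI impI)
    have 1: "s \<in> hom E ?A ?O" "t \<in> hom E ?A ?O" "i \<in> hom E ?O ?A" by (simp_all add: hom_iff sti)
    have 2: "s \<cdot> i = Idt E ?O" "t \<cdot> i = Idt E ?O"
      by (rule product_eqI[OF pr0]; simp add: sti)+
    have 3: "m g f \<in> hom E (Dom E f) ?A \<and> s \<cdot> m g f = s \<cdot> f \<and> t \<cdot> m g f = t \<cdot> g"
      if "g \<in> Arr E" "f \<in> Arr E" "Dom E g = Dom E f" "Cod E g = ?A" "Cod E f = ?A" "s \<cdot> g = t \<cdot> f" for g f
    proof -
      note [simp] = that(1-5) conjunct1[OF s[OF that]] conjunct2[OF s[OF that]]
      have "s \<cdot> m g f = s \<cdot> f" "t \<cdot> m g f = t \<cdot> g"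
        by (rule product_eqI[OF pr0]; simp add: sti m_def)+
      then show ?thesis by (simp add: hom_iff m_def)
    qed
    have 4: "m g f \<cdot> w = m (g \<cdot> w) (f \<cdot> w)"
      if "g \<in> Arr E" "f \<in> Arr E" "Dom E g = Dom E f" "Cod E g = ?A" "Cod E f = ?A" "s \<cdot> g = t \<cdot> f"
        "w \<in> Arr E" "Cod E w = Dom E f" for g f w
      using that(1-5,7-) s[OF that(1-6)] by (simp add: m_def lift_comp[OF pr1])
    have 5: "m (i \<cdot> t) (Idt E ?A) = Idt E ?A" "m (Idt E ?A) (i \<cdot> s) = Idt E ?A"
      by (rule product_eqI[OF pr1]; simp add: m_def sti)+
    have 6: "m (m h g) f = m h (m g f)"
      if "h \<in> Arr E" "g \<in> Arr E" "f \<in> Arr E" "Dom E h = Dom E f" "Dom E g = Dom E f" "Cod E h = ?A"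
        "Cod E g = ?A" "Cod E f = ?A" "s \<cdot> h = t \<cdot> g" "s \<cdot> g = t \<cdot> f" for h g f
      using that(1-8) s[of h g] s[of g f] that(9,10) by (simp add: m_def)
    note I = icatI[of s ?A ?O t i m, OF 1 2 3 4 5 6]
    show "is_icat E ?C" by (rule I(1))
    fix g f assume "g \<in> Arr E" "f \<in> Arr E" "Dom E g = Dom E f" "Cod E g = ?A" "Cod E f = ?A" "s \<cdot> g = t \<cdot> f"
    then show "icmp E ?C g f = m g f" by - (rule I(2))
  qed
  then show "is_icat E (prod_icat X Y)" "p0 \<cdot> Src (prod_icat X Y) = Src X \<cdot> p" "q0 \<cdot> Src (prod_icat X Y) = Src Y \<cdot> q"
    "p0 \<cdot> Tgt (prod_icat X Y) = Tgt X \<cdot> p" "q0 \<cdot> Tgt (prod_icat X Y) = Tgt Y \<cdot> q"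
    "p \<cdot> Idn (prod_icat X Y) = Idn X \<cdot> p0" "q \<cdot> Idn (prod_icat X Y) = Idn Y \<cdot> q0"
    "\<And>g f. \<lbrakk>g \<in> Arr E; f \<in> Arr E; Dom E g = Dom E f; Cod E g = ?A;
        Cod E f = ?A; Src (prod_icat X Y) \<cdot> g = Tgt (prod_icat X Y) \<cdot> f\<rbrakk>
      \<Longrightarrow> icmp E (prod_icat X Y) g f = lift E p q (icmp E X (p \<cdot> g) (p \<cdot> f)) (icmp E Y (q \<cdot> g) (q \<cdot> f))"
    unfolding C by (simp_all add: m_def sti)
qed

definition prod_icat_fst :: "('o, 'a) icat \<Rightarrow> ('o, 'a) icat \<Rightarrow> ('o, 'a) ifun" where
  "prod_icat_fst X Y = \<lparr>IDom = prod_icat X Y, ICod = X, OnOb = prod_fst E (IOb X) (IOb Y), OnAr = prod_fst E (IAr X) (IAr Y)\<rparr>"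

definition prod_icat_snd :: "('o, 'a) icat \<Rightarrow> ('o, 'a) icat \<Rightarrow> ('o, 'a) ifun" where
  "prod_icat_snd X Y = \<lparr>IDom = prod_icat X Y, ICod = Y, OnOb = prod_snd E (IOb X) (IOb Y), OnAr = prod_snd E (IAr X) (IAr Y)\<rparr>"

lemma prod_icat_proj:
  assumes X: "is_icat E X" and Y: "is_icat E Y"
  shows "is_ifun E (prod_icat_fst X Y)" "is_ifun E (prod_icat_snd X Y)"
proof -
  note [simp] = X Y is_icat_prod[OF X Y] Src_prod[OF X Y] Tgt_prod[OF X Y] Idn_prod[OF X Y] icmp_prod[OF X Y]
  have s: "Src X \<cdot> (prod_fst E (IAr X) (IAr Y) \<cdot> g) = Tgt X \<cdot> (prod_fst E (IAr X) (IAr Y) \<cdot> f) \<and>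
       Src Y \<cdot> (prod_snd E (IAr X) (IAr Y) \<cdot> g) = Tgt Y \<cdot> (prod_snd E (IAr X) (IAr Y) \<cdot> f)"
    if g: "g \<in> Arr E" "Cod E g = prod_ob E (IAr X) (IAr Y)" and f: "f \<in> Arr E" "Cod E f = prod_ob E (IAr X) (IAr Y)"
      and "Src (prod_icat X Y) \<cdot> g = Tgt (prod_icat X Y) \<cdot> f" for g f
    using g f arg_cong[OF that(5), of "\<lambda>x. prod_fst E (IOb X) (IOb Y) \<cdot> x"]
      arg_cong[OF that(5), of "\<lambda>x. prod_snd E (IOb X) (IOb Y) \<cdot> x"]
    by (simp add: comp_ext[OF Src_prod(1)[OF X Y]] comp_ext[OF Src_prod(2)[OF X Y]]
        comp_ext[OF Tgt_prod(1)[OF X Y]] comp_ext[OF Tgt_prod(2)[OF X Y]])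
  show "is_ifun E (prod_icat_fst X Y)"
    by (rule is_ifunI) (use s in \<open>simp_all add: prod_icat_fst_def hom_iff\<close>)
  show "is_ifun E (prod_icat_snd X Y)"
    by (rule is_ifunI) (use s in \<open>simp_all add: prod_icat_snd_def hom_iff\<close>)
qed

lemma prod_icat_is_product:
  assumes X: "is_icat E X" and Y: "is_icat E Y"
  shows "is_product (Cat1 E) X Y (prod_icat X Y) (prod_icat_fst X Y) (prod_icat_snd X Y)"
proof (rule Cat.is_productI)
  note [simp] = X Y is_icat_prod[OF X Y] Src_prod[OF X Y] Tgt_prod[OF X Y] Idn_prod[OF X Y] icmp_prod[OF X Y]
    comp_ext[OF Src_prod(1)[OF X Y]] comp_ext[OF Src_prod(2)[OF X Y]]
    comp_ext[OF Tgt_prod(1)[OF X Y]] comp_ext[OF Tgt_prod(2)[OF X Y]]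
    comp_ext[OF Idn_prod(1)[OF X Y]] comp_ext[OF Idn_prod(2)[OF X Y]]
  let ?p = "prod_icat_fst X Y" and ?q = "prod_icat_snd X Y"
  have pq [simp]: "IDom ?p = prod_icat X Y" "ICod ?p = X" "OnOb ?p = prod_fst E (IOb X) (IOb Y)" "OnAr ?p = prod_fst E (IAr X) (IAr Y)"
    "IDom ?q = prod_icat X Y" "ICod ?q = Y" "OnOb ?q = prod_snd E (IOb X) (IOb Y)" "OnAr ?q = prod_snd E (IAr X) (IAr Y)"
    by (simp_all add: prod_icat_fst_def prod_icat_snd_def)
  show "prod_icat X Y \<in> Obj (Cat1 E)" "?p \<in> hom (Cat1 E) (prod_icat X Y) X" "?q \<in> hom (Cat1 E) (prod_icat X Y) Y"
    by (simp_all add: hom_iff prod_icat_proj)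
  {
    fix Z F G assume "F \<in> hom (Cat1 E) Z X" "G \<in> hom (Cat1 E) Z Y"
    then have FG [simp]: "is_ifun E F" "IDom F = Z" "ICod F = X" "is_ifun E G" "IDom G = Z" "ICod G = Y"
      by (simp_all add: hom_iff)
    have [simp]: "is_icat E Z" using ifun_simps(1)[OF FG(1)] by simp
    let ?kO = "lift E (prod_fst E (IOb X) (IOb Y)) (prod_snd E (IOb X) (IOb Y)) (OnOb F) (OnOb G)"
    let ?kA = "lift E (prod_fst E (IAr X) (IAr Y)) (prod_snd E (IAr X) (IAr Y)) (OnAr F) (OnAr G)"
    let ?K = "\<lparr>IDom = Z, ICod = prod_icat X Y, OnOb = ?kO, OnAr = ?kA\<rparr>"
    have 1: "Src (prod_icat X Y) \<cdot> ?kA = ?kO \<cdot> Src Z" "Tgt (prod_icat X Y) \<cdot> ?kA = ?kO \<cdot> Tgt Z"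
      by (rule prod_eqI[of "IOb X" "IOb Y"]; simp)+
    have "is_ifun E ?K"
    proof (rule is_ifunI; simp add: hom_iff 1)
      show "?kA \<cdot> Idn Z = Idn (prod_icat X Y) \<cdot> ?kO"
        by (rule prod_eqI[of "IAr X" "IAr Y"]) simp_all
      fix g f assume [simp]: "g \<in> Arr E" "f \<in> Arr E" "Dom E g = Dom E f" "Cod E g = IAr Z" "Cod E f = IAr Z" "Src Z \<cdot> g = Tgt Z \<cdot> f"
      have "Src (prod_icat X Y) \<cdot> (?kA \<cdot> g) = Tgt (prod_icat X Y) \<cdot> (?kA \<cdot> f)"
        by (simp add: comp_ext[OF 1(1)] comp_ext[OF 1(2)])
      then show "?kA \<cdot> icmp E Z g f = icmp E (prod_icat X Y) (?kA \<cdot> g) (?kA \<cdot> f)"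
        by - (rule prod_eqI[of "IAr X" "IAr Y"], simp_all)
    qed
    then show "\<exists>u\<in>hom (Cat1 E) Z (prod_icat X Y). ?p \<odot> u = F \<and> ?q \<odot> u = G"
      by (intro bexI[of _ ?K] conjI; (intro ifun_eqI)?) (simp_all add: hom_iff)
  }
  fix Z u v assume "u \<in> hom (Cat1 E) Z (prod_icat X Y)" "v \<in> hom (Cat1 E) Z (prod_icat X Y)"
    and e: "?p \<odot> u = ?p \<odot> v" "?q \<odot> u = ?q \<odot> v"
  then have uv [simp]: "is_ifun E u" "IDom u = Z" "ICod u = prod_icat X Y" "is_ifun E v" "IDom v = Z" "ICod v = prod_icat X Y"
    by (simp_all add: hom_iff)
  show "u = v"
  proof (rule ifun_eqI)
    show "OnOb u = OnOb v"
      by (rule prod_eqI[of "IOb X" "IOb Y"]) (use arg_cong[OF e(1), of OnOb] arg_cong[OF e(2), of OnOb] in simp_all)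
    show "OnAr u = OnAr v"
      by (rule prod_eqI[of "IAr X" "IAr Y"]) (use arg_cong[OF e(1), of OnAr] arg_cong[OF e(2), of OnAr] in simp_all)
  qed simp_all
qed

sublocale Cat: prod_cat "Cat1 E"
  by unfold_locales (use prod_icat_is_product in \<open>simp, blast\<close>)

text \<open>An arbitrary product in \<open>Cat1 E\<close> need not be \<open>prod_icat X Y\<close>.
  The isomorphism between the two is invertible on objects and on arrows, and the levelwise product
  structure is transported along both.\<close>

lemma product_levelwise:
  assumes pr: "is_product (Cat1 E) X Y P p q"
  shows "is_product E (IOb X) (IOb Y) (IOb P) (OnOb p) (OnOb q)"
    and "is_product E (IAr X) (IAr Y) (IAr P) (OnAr p) (OnAr q)"
proof -
  have X: "is_icat E X" and Y: "is_icat E Y"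
    using Cat.product_proj[OF pr] Cat.cod_obj[of p] Cat.cod_obj[of q] by auto
  obtain k l where kl: "k \<in> hom (Cat1 E) P (prod_icat X Y)" "l \<in> hom (Cat1 E) (prod_icat X Y) P"
    "prod_icat_fst X Y \<odot> k = p" "prod_icat_snd X Y \<odot> k = q"
    "l \<odot> k = Idt (Cat1 E) P" "k \<odot> l = Idt (Cat1 E) (prod_icat X Y)"
    by (rule Cat.product_comparison[OF pr prod_icat_is_product[OF X Y]]) blast
  have [simp]: "is_ifun E k" "IDom k = P" "ICod k = prod_icat X Y" "is_ifun E l" "ICod l = P" "IDom l = prod_icat X Y"
    using kl by (simp_all add: hom_iff)
  note c = arg_cong[OF kl(3), of OnOb] arg_cong[OF kl(4), of OnOb] arg_cong[OF kl(3), of OnAr] arg_cong[OF kl(4), of OnAr]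
  note i = arg_cong[OF kl(5), of OnOb] arg_cong[OF kl(6), of OnOb] arg_cong[OF kl(5), of OnAr] arg_cong[OF kl(6), of OnAr]
  have "is_product E (IOb X) (IOb Y) (IOb P) (prod_fst E (IOb X) (IOb Y) \<cdot> OnOb k) (prod_snd E (IOb X) (IOb Y) \<cdot> OnOb k)"
    by (rule product_transport[OF prod_is_product, where l = "OnOb l"]) (use X Y i in \<open>simp_all add: hom_iff\<close>)
  with c show "is_product E (IOb X) (IOb Y) (IOb P) (OnOb p) (OnOb q)"
    by (simp add: prod_icat_fst_def prod_icat_snd_def)
  have "is_product E (IAr X) (IAr Y) (IAr P) (prod_fst E (IAr X) (IAr Y) \<cdot> OnAr k) (prod_snd E (IAr X) (IAr Y) \<cdot> OnAr k)"
    by (rule product_transport[OF prod_is_product, where l = "OnAr l"]) (use X Y i in \<open>simp_all add: hom_iff\<close>)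
  with c show "is_product E (IAr X) (IAr Y) (IAr P) (OnAr p) (OnAr q)"
    by (simp add: prod_icat_fst_def prod_icat_snd_def)
qed

lemma Cat_prod_simps [simp]:
  assumes "is_icat E X" "is_icat E Y"
  shows "is_icat E (prod_ob (Cat1 E) X Y)"
    "is_ifun E (prod_fst (Cat1 E) X Y)" "IDom (prod_fst (Cat1 E) X Y) = prod_ob (Cat1 E) X Y" "ICod (prod_fst (Cat1 E) X Y) = X"
    "is_ifun E (prod_snd (Cat1 E) X Y)" "IDom (prod_snd (Cat1 E) X Y) = prod_ob (Cat1 E) X Y" "ICod (prod_snd (Cat1 E) X Y) = Y"
  using Cat.prod_simps[of X Y] assms by simp_all

lemmas prod_levelwise = product_levelwise[OF Cat.prod_is_product, unfolded Cat1_simps(1)]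
lemmas Cat_pair_simps [simp] =
  lift_props[OF prod_levelwise(1)] fst_lift_comp[OF prod_levelwise(1)] lift_comp[OF prod_levelwise(1)]
  lift_props[OF prod_levelwise(2)] fst_lift_comp[OF prod_levelwise(2)] lift_comp[OF prod_levelwise(2)]

lemma Cat_pair_proj [simp]:
  assumes "is_icat E X" "is_icat E Y"
  shows "lift E (OnOb (prod_fst (Cat1 E) X Y)) (OnOb (prod_snd (Cat1 E) X Y)) (OnOb (prod_fst (Cat1 E) X Y)) (OnOb (prod_snd (Cat1 E) X Y))
      = Idt E (IOb (prod_ob (Cat1 E) X Y))"
    and "lift E (OnAr (prod_fst (Cat1 E) X Y)) (OnAr (prod_snd (Cat1 E) X Y)) (OnAr (prod_fst (Cat1 E) X Y)) (OnAr (prod_snd (Cat1 E) X Y))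
      = Idt E (IAr (prod_ob (Cat1 E) X Y))"
  using assms by (simp_all add: product_eqI[OF prod_levelwise(1)[OF assms]] product_eqI[OF prod_levelwise(2)[OF assms]])

lemma FAr_Cat_prod [simp]:
  assumes "is_ifun E u" "is_icat E B"
  shows "is_ifun E (FAr (prod_functor (Cat1 E) B) u)"
    "IDom (FAr (prod_functor (Cat1 E) B) u) = prod_ob (Cat1 E) (IDom u) B"
    "ICod (FAr (prod_functor (Cat1 E) B) u) = prod_ob (Cat1 E) (ICod u) B"
  using Cat.FAr_prod[of u B] assms by simp_all

lemma proj_FAr_Cat_prod:
  assumes "is_ifun E u" "is_icat E B" "ICod u = H"
  shows "OnOb (prod_fst (Cat1 E) H B) \<cdot> OnOb (FAr (prod_functor (Cat1 E) B) u) = OnOb u \<cdot> OnOb (prod_fst (Cat1 E) (IDom u) B)"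
    "OnOb (prod_snd (Cat1 E) H B) \<cdot> OnOb (FAr (prod_functor (Cat1 E) B) u) = OnOb (prod_snd (Cat1 E) (IDom u) B)"
    "OnAr (prod_fst (Cat1 E) H B) \<cdot> OnAr (FAr (prod_functor (Cat1 E) B) u) = OnAr u \<cdot> OnAr (prod_fst (Cat1 E) (IDom u) B)"
    "OnAr (prod_snd (Cat1 E) H B) \<cdot> OnAr (FAr (prod_functor (Cat1 E) B) u) = OnAr (prod_snd (Cat1 E) (IDom u) B)"
proof -
  have e: "prod_fst (Cat1 E) H B \<odot> FAr (prod_functor (Cat1 E) B) u = u \<odot> prod_fst (Cat1 E) (IDom u) B"
    "prod_snd (Cat1 E) H B \<odot> FAr (prod_functor (Cat1 E) B) u = prod_snd (Cat1 E) (IDom u) B"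
    using Cat.proj_FAr_prod[of u B H] assms by simp_all
  show "OnOb (prod_fst (Cat1 E) H B) \<cdot> OnOb (FAr (prod_functor (Cat1 E) B) u) = OnOb u \<cdot> OnOb (prod_fst (Cat1 E) (IDom u) B)"
    "OnAr (prod_fst (Cat1 E) H B) \<cdot> OnAr (FAr (prod_functor (Cat1 E) B) u) = OnAr u \<cdot> OnAr (prod_fst (Cat1 E) (IDom u) B)"
    using arg_cong[OF e(1), of OnOb] arg_cong[OF e(1), of OnAr] by (simp_all del: Cat.proj_FAr_prod)
  show "OnOb (prod_snd (Cat1 E) H B) \<cdot> OnOb (FAr (prod_functor (Cat1 E) B) u) = OnOb (prod_snd (Cat1 E) (IDom u) B)"
    "OnAr (prod_snd (Cat1 E) H B) \<cdot> OnAr (FAr (prod_functor (Cat1 E) B) u) = OnAr (prod_snd (Cat1 E) (IDom u) B)"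
    using arg_cong[OF e(2), of OnOb] arg_cong[OF e(2), of OnAr] by (simp_all del: Cat.proj_FAr_prod)
qed

lemmas proj_FAr_Cat_prod_simps [simp] = proj_FAr_Cat_prod
  comp_ext[OF proj_FAr_Cat_prod(1)] comp_ext[OF proj_FAr_Cat_prod(2)]
  comp_ext[OF proj_FAr_Cat_prod(3)] comp_ext[OF proj_FAr_Cat_prod(4)]

abbreviation elts :: "'o \<Rightarrow> 'o \<Rightarrow> 'a \<Rightarrow> 'a \<Rightarrow> bool" where
  "elts Z T w y \<equiv> w \<in> Arr E \<and> y \<in> Arr E \<and> Dom E w = Dom E y \<and> Cod E w = Z \<and> Cod E y = T"

text \<open>The projections are functors and are jointly monic at each level, so the structure of
  any product, not just of \<open>prod_icat\<close>, is componentwise.\<close>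

lemma product_icat:
  assumes pr: "is_product (Cat1 E) X Y P p q" and X: "is_icat E X" and Y: "is_icat E Y"
  shows "elts (IAr X) (IAr Y) n f \<Longrightarrow> Src P \<cdot> lift E (OnAr p) (OnAr q) n f = lift E (OnOb p) (OnOb q) (Src X \<cdot> n) (Src Y \<cdot> f)"
    and "elts (IAr X) (IAr Y) n f \<Longrightarrow> Tgt P \<cdot> lift E (OnAr p) (OnAr q) n f = lift E (OnOb p) (OnOb q) (Tgt X \<cdot> n) (Tgt Y \<cdot> f)"
    and "elts (IOb X) (IOb Y) x y \<Longrightarrow> Idn P \<cdot> lift E (OnOb p) (OnOb q) x y = lift E (OnAr p) (OnAr q) (Idn X \<cdot> x) (Idn Y \<cdot> y)"
    and "\<lbrakk>elts (IAr X) (IAr Y) n f; elts (IAr X) (IAr Y) n' f'; Dom E f = Dom E f'; Src X \<cdot> n' = Tgt X \<cdot> n; Src Y \<cdot> f' = Tgt Y \<cdot> f\<rbrakk>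
      \<Longrightarrow> icmp E P (lift E (OnAr p) (OnAr q) n' f') (lift E (OnAr p) (OnAr q) n f)
        = lift E (OnAr p) (OnAr q) (icmp E X n' n) (icmp E Y f' f)"
proof -
  note pr0 = product_levelwise(1)[OF pr] and pr1 = product_levelwise(2)[OF pr]
  have pq [simp]: "is_ifun E p" "IDom p = P" "ICod p = X" "is_ifun E q" "IDom q = P" "ICod q = Y" "is_icat E P"
    using Cat.product_proj[OF pr] by simp_all
  note [simp] = X Y lift_props[OF pr0] fst_lift_comp[OF pr0] lift_props[OF pr1] fst_lift_comp[OF pr1]
  note Src = ifun_comp_simps(1)[of p P X, symmetric] ifun_comp_simps(1)[of q P Y, symmetric]
  note Tgt = ifun_comp_simps(2)[of p P X, symmetric] ifun_comp_simps(2)[of q P Y, symmetric]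
  {
    fix n f assume "elts (IAr X) (IAr Y) n f"
    then show "Src P \<cdot> lift E (OnAr p) (OnAr q) n f = lift E (OnOb p) (OnOb q) (Src X \<cdot> n) (Src Y \<cdot> f)"
      "Tgt P \<cdot> lift E (OnAr p) (OnAr q) n f = lift E (OnOb p) (OnOb q) (Tgt X \<cdot> n) (Tgt Y \<cdot> f)"
      by - (rule product_eqI[OF pr0]; simp del: ifun_comp_simps(1,2) add: Src Tgt)+
  }
  note st = this
  show "elts (IOb X) (IOb Y) x y \<Longrightarrow> Idn P \<cdot> lift E (OnOb p) (OnOb q) x y = lift E (OnAr p) (OnAr q) (Idn X \<cdot> x) (Idn Y \<cdot> y)"
    by (rule product_eqI[OF pr1]) simp_all
  show "\<lbrakk>elts (IAr X) (IAr Y) n f; elts (IAr X) (IAr Y) n' f'; Dom E f = Dom E f'; Src X \<cdot> n' = Tgt X \<cdot> n; Src Y \<cdot> f' = Tgt Y \<cdot> f\<rbrakk>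
      \<Longrightarrow> icmp E P (lift E (OnAr p) (OnAr q) n' f') (lift E (OnAr p) (OnAr q) n f)
        = lift E (OnAr p) (OnAr q) (icmp E X n' n) (icmp E Y f' f)"
    by (rule product_eqI[OF pr1]) (simp_all add: st)
qed

lemmas Cat_product_icat [simp] = product_icat[OF Cat.prod_is_product, unfolded Cat1_simps(1)]

lemma HComp_CIdt_left:
  assumes "is_ifun E F" "is_itrans E \<alpha>" "IDom F = ICod (TDom \<alpha>)"
  shows "Cmpt (HComp (Cat2 E) (CIdt (Cat2 E) F) \<alpha>) = OnAr F \<cdot> Cmpt \<alpha>"
  using assms by simp

lemma HComp_CIdt_right:
  assumes "is_ifun E F" "is_itrans E \<alpha>" "IDom (TDom \<alpha>) = ICod F"
  shows "Cmpt (HComp (Cat2 E) \<alpha> (CIdt (Cat2 E) F)) = Cmpt \<alpha> \<cdot> OnOb F"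
  using assms by simp

text \<open>The component of a cell is an arrow into \<open>IAr P\<close>, itself a product. Hence a
  cell into \<open>P\<close> is the pair of its projections, and its source, target and naturality
  can be checked on them.\<close>

lemma product_is_2product:
  assumes pr: "is_product (Cat1 E) X Y P p q"
  shows "is_2product (Cat2 E) X Y P p q"
  unfolding is_2product_def
proof (intro conjI ballI)
  show "is_product (Und (Cat2 E)) X Y P p q" using pr by simp
  note pr0 = product_levelwise(1)[OF pr] and pr1 = product_levelwise(2)[OF pr]
  have pq [simp]: "is_ifun E p" "IDom p = P" "ICod p = X" "is_ifun E q" "IDom q = P" "ICod q = Y" "is_icat E P"
    using Cat.product_proj[OF pr] by simp_all
  note [simp] = lift_props[OF pr0] fst_lift_comp[OF pr0] lift_props[OF pr1] fst_lift_comp[OF pr1]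
  fix Z u v \<alpha> \<beta>
  assume "u \<in> hom (Und (Cat2 E)) Z P" "v \<in> hom (Und (Cat2 E)) Z P"
    and "\<alpha> \<in> cells (Cat2 E) (p \<cdot>\<^bsub>Und (Cat2 E)\<^esub> u) (p \<cdot>\<^bsub>Und (Cat2 E)\<^esub> v)"
    and "\<beta> \<in> cells (Cat2 E) (q \<cdot>\<^bsub>Und (Cat2 E)\<^esub> u) (q \<cdot>\<^bsub>Und (Cat2 E)\<^esub> v)"
  then have uv [simp]: "is_ifun E u" "IDom u = Z" "ICod u = P" "is_ifun E v" "IDom v = Z" "ICod v = P"
    and ab [simp]: "is_itrans E \<alpha>" "TDom \<alpha> = p \<odot> u" "TCod \<alpha> = p \<odot> v"
     "is_itrans E \<beta>" "TDom \<beta> = q \<odot> u" "TCod \<beta> = q \<odot> v"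
    by (simp_all add: hom_iff cells_def)
  have [simp]: "is_icat E Z" using ifun_simps(1)[OF uv(1)] by simp
  let ?c = "lift E (OnAr p) (OnAr q) (Cmpt \<alpha>) (Cmpt \<beta>)"
  let ?\<gamma> = "\<lparr>TDom = u, TCod = v, Cmpt = ?c\<rparr>"
  have st: "Src P \<cdot> ?c = OnOb u" "Tgt P \<cdot> ?c = OnOb v"
    using ifun_comp_simps(1)[of p P X ?c, symmetric] ifun_comp_simps(1)[of q P Y ?c, symmetric]
      ifun_comp_simps(2)[of p P X ?c, symmetric] ifun_comp_simps(2)[of q P Y ?c, symmetric]
    by - (rule product_eqI[OF pr0]; simp del: ifun_comp_simps)+
  note [simp] = st comp_ext[OF st(1)] comp_ext[OF st(2)]
  have \<gamma>: "is_itrans E ?\<gamma>"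
  proof (rule is_itransI)
    show "icmp E P (OnAr (TCod ?\<gamma>)) (Cmpt ?\<gamma> \<cdot> Src Z) = icmp E P (Cmpt ?\<gamma> \<cdot> Tgt Z) (OnAr (TDom ?\<gamma>))"
      using itrans_natural[of \<alpha> "Idt E (IAr Z)"] itrans_natural[of \<beta> "Idt E (IAr Z)"]
      by - (rule product_eqI[OF pr1], simp_all)
  qed (simp_all add: hom_iff)
  show "\<exists>!\<gamma>. \<gamma> \<in> cells (Cat2 E) u v \<and> HComp (Cat2 E) (CIdt (Cat2 E) p) \<gamma> = \<alpha> \<and> HComp (Cat2 E) (CIdt (Cat2 E) q) \<gamma> = \<beta>"
  proof (rule ex1I)
    have "HComp (Cat2 E) (CIdt (Cat2 E) p) ?\<gamma> = \<alpha>" "HComp (Cat2 E) (CIdt (Cat2 E) q) ?\<gamma> = \<beta>"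
      by (rule itrans_eqI; simp add: HComp_CIdt_left[OF _ \<gamma>] del: Cat2_simps(13))+
    then show "?\<gamma> \<in> cells (Cat2 E) u v \<and> HComp (Cat2 E) (CIdt (Cat2 E) p) ?\<gamma> = \<alpha> \<and> HComp (Cat2 E) (CIdt (Cat2 E) q) ?\<gamma> = \<beta>"
      using \<gamma> by (simp add: cells_def)
    fix \<delta> assume \<delta>: "\<delta> \<in> cells (Cat2 E) u v \<and> HComp (Cat2 E) (CIdt (Cat2 E) p) \<delta> = \<alpha> \<and> HComp (Cat2 E) (CIdt (Cat2 E) q) \<delta> = \<beta>"
    then have d [simp]: "is_itrans E \<delta>" "TDom \<delta> = u" "TCod \<delta> = v" by (simp_all add: cells_def)
    have dp: "OnAr p \<cdot> Cmpt \<delta> = Cmpt \<alpha>" "OnAr q \<cdot> Cmpt \<delta> = Cmpt \<beta>"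
      using \<delta> HComp_CIdt_left[of p \<delta>] HComp_CIdt_left[of q \<delta>] by auto
    have "Cmpt \<delta> = ?c"
      by (rule product_eqI[OF pr1]) (simp_all add: dp)
    then show "\<delta> = ?\<gamma>" by (intro itrans_eqI) simp_all
  qed
qed

sublocale Cat2: twoprod "Cat2 E"
  by unfold_locales (simp_all add: product_is_2product Cat.products)

lemma FCell_prod [simp]:
  assumes B: "is_icat E B" and \<alpha>: "is_itrans E \<alpha>"
  defines "\<gamma> \<equiv> FCell (prod_2functor (Cat2 E) B) \<alpha>"
  shows "is_itrans E \<gamma>" "TDom \<gamma> = FAr (prod_functor (Cat1 E) B) (TDom \<alpha>)"
    "TCod \<gamma> = FAr (prod_functor (Cat1 E) B) (TCod \<alpha>)"
    "ICod (TDom \<alpha>) = H \<Longrightarrow> OnAr (prod_fst (Cat1 E) H B) \<cdot> Cmpt \<gamma> = Cmpt \<alpha> \<cdot> OnOb (prod_fst (Cat1 E) (IDom (TDom \<alpha>)) B)"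
    "ICod (TDom \<alpha>) = H \<Longrightarrow> OnAr (prod_snd (Cat1 E) H B) \<cdot> Cmpt \<gamma> = Idn B \<cdot> OnOb (prod_snd (Cat1 E) (IDom (TDom \<alpha>)) B)"
proof -
  note [simp] = B \<alpha>
  note F = Cat2.prod_FCell[of B \<alpha>, simplified, folded \<gamma>_def]
  show \<gamma>: "is_itrans E \<gamma>" "TDom \<gamma> = FAr (prod_functor (Cat1 E) B) (TDom \<alpha>)"
    "TCod \<gamma> = FAr (prod_functor (Cat1 E) B) (TCod \<alpha>)"
    using F(1-3) by simp_all
  assume H: "ICod (TDom \<alpha>) = H"
  have [simp]: "is_icat E H" using H by auto
  show "OnAr (prod_fst (Cat1 E) H B) \<cdot> Cmpt \<gamma> = Cmpt \<alpha> \<cdot> OnOb (prod_fst (Cat1 E) (IDom (TDom \<alpha>)) B)"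
    using arg_cong[OF F(4)[OF H], of Cmpt] \<gamma> H by (simp add: HComp_CIdt_left HComp_CIdt_right del: Cat2_simps(13))
  show "OnAr (prod_snd (Cat1 E) H B) \<cdot> Cmpt \<gamma> = Idn B \<cdot> OnOb (prod_snd (Cat1 E) (IDom (TDom \<alpha>)) B)"
    using arg_cong[OF F(5)[OF H], of Cmpt] \<gamma> H by (simp add: HComp_CIdt_left del: Cat2_simps(13))
qed

section \<open>Discrete internal categories\<close>

lemma is_icat_disc [simp]: "X \<in> Obj E \<Longrightarrow> is_icat E (disc_ob E X)"
  and icmp_disc: "\<lbrakk>X \<in> Obj E; f \<in> Arr E; Cod E f = X\<rbrakk> \<Longrightarrow> icmp E (disc_ob E X) f f = f"
proof -
  assume X: "X \<in> Obj E"
  \<comment> \<open>Composable pairs have equal entries here, so returning either entry is a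
    composition; returning the first one matches the \<open>pb_fst\<close> in
    \<open>disc_ob\<close>.\<close>
  note I = icatI[of "Idt E X" X X "Idt E X" "Idt E X" "\<lambda>g f. g", folded disc_ob_def]
  show "is_icat E (disc_ob E X)"
    by (rule I(1)) (use X in \<open>auto simp: hom_iff\<close>)
  assume "f \<in> Arr E" "Cod E f = X"
  then show "icmp E (disc_ob E X) f f = f"
    by - (rule I(2), use X in \<open>auto simp: hom_iff\<close>)
qed

lemma disc_ob_simps [simp]:
  "IOb (disc_ob E X) = X" "IAr (disc_ob E X) = X" "Src (disc_ob E X) = Idt E X"
  "Tgt (disc_ob E X) = Idt E X" "Idn (disc_ob E X) = Idt E X"
  by (simp_all add: disc_ob_def)

lemma disc_simps [simp]:
  "FOb (disc E) = disc_ob E"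
  "IDom (FAr (disc E) f) = disc_ob E (Dom E f)" "ICod (FAr (disc E) f) = disc_ob E (Cod E f)"
  "OnOb (FAr (disc E) f) = f" "OnAr (FAr (disc E) f) = f"
  by (simp_all add: disc_def)

text \<open>Every arrow of a discrete category is an identity, so a functor into it amounts to a map
  of objects that takes equal values at the two ends of each arrow; its arrow part is the common
  value.\<close>

lemma is_ifun_into_disc:
  assumes "is_icat E Z" "f \<in> hom E (IOb Z) Y" "f \<cdot> Src Z = f \<cdot> Tgt Z"
  shows "is_ifun E \<lparr>IDom = Z, ICod = disc_ob E Y, OnOb = f, OnAr = f \<cdot> Src Z\<rparr>"
proof -
  have [simp]: "is_icat E Z" "f \<in> Arr E" "Dom E f = IOb Z" "Cod E f = Y" using assms by (simp_all add: hom_iff)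
  have [simp]: "Y \<in> Obj E" using cod_obj[of f] by simp
  show ?thesis
  proof (rule is_ifunI; simp add: hom_iff assms(3))
    fix g h assume [simp]: "g \<in> Arr E" "h \<in> Arr E" "Dom E g = Dom E h" "Cod E g = IAr Z" "Cod E h = IAr Z" "Src Z \<cdot> g = Tgt Z \<cdot> h"
    have "f \<cdot> (Tgt Z \<cdot> h) = f \<cdot> (Tgt Z \<cdot> g)"
      using comp_ext[OF assms(3), of g] by simp
    then show "f \<cdot> (Tgt Z \<cdot> g) = icmp E (disc_ob E Y) (f \<cdot> (Tgt Z \<cdot> g)) (f \<cdot> (Tgt Z \<cdot> h))"
      by (simp add: icmp_disc)
  qed
qed

lemma ifun_into_disc:
  assumes "is_ifun E F" "ICod F = disc_ob E Y" "IDom F = Z"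
  shows "OnAr F = OnOb F \<cdot> Src Z" "OnAr F = OnOb F \<cdot> Tgt Z"
  using assms Src_OnAr[of F "disc_ob E Y"] Tgt_OnAr[of F "disc_ob E Y"] by auto

text \<open>The only possible arrow part sends each arrow, being an identity, to an identity. This
  is the transposition for \<open>disc\<close> as left adjoint of the functor of objects.\<close>

lemma is_ifun_from_disc:
  assumes "is_icat E Z" "x \<in> hom E A (IOb Z)"
  shows "is_ifun E \<lparr>IDom = disc_ob E A, ICod = Z, OnOb = x, OnAr = Idn Z \<cdot> x\<rparr>"
proof -
  have [simp]: "is_icat E Z" "x \<in> Arr E" "Dom E x = A" "Cod E x = IOb Z" using assms by (simp_all add: hom_iff)
  have [simp]: "A \<in> Obj E" using dom_obj[of x] by simp
  show ?thesis
    by (rule is_ifunI) (auto simp: hom_iff icmp_disc)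
qed

lemma is_functor_disc: "is_functor E (Cat1 E) (disc E)"
proof -
  have i: "is_ifun E (FAr (disc E) f)" if "f \<in> Arr E" for f
    using that is_ifun_into_disc[of "disc_ob E (Dom E f)" f "Cod E f"] by (simp add: disc_def hom_iff)
  show ?thesis
    unfolding is_functor_def by (auto simp: hom_iff i intro!: ifun_eqI)
qed

text \<open>A functor into a discrete category is a map of objects coequalizing source and target,
  and a pairing coequalizes them as soon as its entries do.\<close>

lemma disc_is_product:
  assumes pr: "is_product E A B P p q"
  shows "is_product (Cat1 E) (disc_ob E A) (disc_ob E B) (disc_ob E P) (FAr (disc E) p) (FAr (disc E) q)"
proof -
  interpret D: functor_loc E "Cat1 E" "disc E" by unfold_locales (rule is_functor_disc)
  note [simp] = product_proj[OF pr] lift_props[OF pr] fst_lift_comp[OF pr]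
  have [simp]: "is_ifun E (FAr (disc E) p)" "is_ifun E (FAr (disc E) q)"
    using D.functor_simps(2)[of p] D.functor_simps(2)[of q] by simp_all
  show ?thesis
  proof (rule Cat.is_productI)
    fix Z F G assume "F \<in> hom (Cat1 E) Z (disc_ob E A)" "G \<in> hom (Cat1 E) Z (disc_ob E B)"
    then have FG [simp]: "is_ifun E F" "IDom F = Z" "ICod F = disc_ob E A" "is_ifun E G" "IDom G = Z" "ICod G = disc_ob E B"
      by (simp_all add: hom_iff)
    have [simp]: "is_icat E Z" using ifun_simps(1)[OF FG(1)] by simp
    let ?k = "lift E p q (OnOb F) (OnOb G)"
    have "OnOb F \<cdot> Src Z = OnOb F \<cdot> Tgt Z" "OnOb G \<cdot> Src Z = OnOb G \<cdot> Tgt Z"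
      using ifun_into_disc[of F A Z] ifun_into_disc[of G B Z] by simp_all
    then have "?k \<cdot> Src Z = ?k \<cdot> Tgt Z" by (simp add: lift_comp[OF pr])
    from is_ifun_into_disc[OF _ _ this, of P]
    have k: "is_ifun E \<lparr>IDom = Z, ICod = disc_ob E P, OnOb = ?k, OnAr = ?k \<cdot> Src Z\<rparr>" by (simp add: hom_iff)
    show "\<exists>u\<in>hom (Cat1 E) Z (disc_ob E P). FAr (disc E) p \<odot> u = F \<and> FAr (disc E) q \<odot> u = G"
      using k ifun_into_disc(1)[of F A Z] ifun_into_disc(1)[of G B Z]
      by (intro bexI[of _ "\<lparr>IDom = Z, ICod = disc_ob E P, OnOb = ?k, OnAr = ?k \<cdot> Src Z\<rparr>"] conjI; (intro ifun_eqI)?)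
        (simp_all add: hom_iff)
  next
    fix Z u v assume "u \<in> hom (Cat1 E) Z (disc_ob E P)" "v \<in> hom (Cat1 E) Z (disc_ob E P)"
      and e: "FAr (disc E) p \<odot> u = FAr (disc E) p \<odot> v" "FAr (disc E) q \<odot> u = FAr (disc E) q \<odot> v"
    then have [simp]: "is_ifun E u" "IDom u = Z" "ICod u = disc_ob E P" "is_ifun E v" "IDom v = Z" "ICod v = disc_ob E P"
      by (simp_all add: hom_iff)
    show "u = v"
    proof (rule ifun_eqI)
      show "OnOb u = OnOb v"
        by (rule product_eqI[OF pr]) (use arg_cong[OF e(1), of OnOb] arg_cong[OF e(2), of OnOb] in simp_all)
      show "OnAr u = OnAr v"
        by (rule product_eqI[OF pr]) (use arg_cong[OF e(1), of OnAr] arg_cong[OF e(2), of OnAr] in simp_all)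
    qed simp_all
  qed (simp_all add: hom_iff)
qed

text \<open>The object part, the arrow part and the components of cells are all arrows into
  \<open>T\<close>, so each of them is unique.\<close>

lemma disc_terminal_2terminal:
  assumes T: "is_terminal E T"
  shows "is_2terminal (Cat2 E) (disc_ob E T)"
proof -
  have [simp]: "T \<in> Obj E" using T by (simp add: is_terminal_def)
  have uniq: "f = g" if "f \<in> hom E X T" "g \<in> hom E X T" for X f g
  proof -
    have "X \<in> Obj E" using that by (auto simp: hom_iff)
    then show ?thesis using T that unfolding is_terminal_def by blast
  qed
  have iuniq: "F = G" if "F \<in> hom (Cat1 E) X (disc_ob E T)" "G \<in> hom (Cat1 E) X (disc_ob E T)" for X F G
    using that by (intro ifun_eqI uniq[of _ "IOb X"] uniq[of _ "IAr X"]) (auto simp: hom_iff)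
  show ?thesis
    unfolding is_2terminal_def is_terminal_def
  proof (intro conjI ballI)
    fix X assume "X \<in> Obj (Und (Cat2 E))"
    then have X [simp]: "is_icat E X" by simp
    obtain f where f: "f \<in> hom E (IOb X) T" using T X unfolding is_terminal_def by (meson icat_simps(1))
    have "f \<cdot> Src X = f \<cdot> Tgt X" using f by (intro uniq[of _ "IAr X"]) (simp_all add: hom_iff)
    from is_ifun_into_disc[OF X f this] 
    have k: "\<lparr>IDom = X, ICod = disc_ob E T, OnOb = f, OnAr = f \<cdot> Src X\<rparr> \<in> hom (Cat1 E) X (disc_ob E T)"
      by (simp add: hom_iff)
    then show "\<exists>!f. f \<in> hom (Und (Cat2 E)) X (disc_ob E T)" using iuniq by auto
  next
    fix X F G assume X: "X \<in> Obj (Und (Cat2 E))" and F: "F \<in> hom (Und (Cat2 E)) X (disc_ob E T)" and G: "G \<in> hom (Und (Cat2 E)) X (disc_ob E T)"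
    then have "G = F" using iuniq by simp
    moreover have "CIdt (Cat2 E) F \<in> cells (Cat2 E) F F" using F by (simp add: cells_def hom_iff)
    moreover have "\<alpha> = \<beta>" if "\<alpha> \<in> cells (Cat2 E) F F" "\<beta> \<in> cells (Cat2 E) F F" for \<alpha> \<beta>
    proof (rule itrans_eqI)
      have "Cmpt \<alpha> \<in> hom E (IOb X) T" "Cmpt \<beta> \<in> hom E (IOb X) T"
        using that F by (auto simp: cells_def hom_iff)
      then show "Cmpt \<alpha> = Cmpt \<beta>" by (rule uniq)
    qed (use that in \<open>simp_all add: cells_def\<close>)
    ultimately show "\<exists>!\<alpha>. \<alpha> \<in> cells (Cat2 E) F G" by blast
  qed simp
qed

section \<open>Exponentials of internal categories\<close>

text \<open>By the Yoneda lemma these natural families are the arrows \<open>Z \<times> T \<rightarrow> W\<close>, but no product has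
  to be chosen.\<close>

definition nat_family :: "'o \<Rightarrow> 'o \<Rightarrow> 'o \<Rightarrow> ('a \<Rightarrow> 'a \<Rightarrow> 'a) \<Rightarrow> bool" where
  "nat_family Z T W a \<longleftrightarrow> (\<forall>w y. elts Z T w y \<longrightarrow>
     a w y \<in> Arr E \<and> Dom E (a w y) = Dom E y \<and> Cod E (a w y) = W \<and>
     (\<forall>v. v \<in> Arr E \<and> Cod E v = Dom E y \<longrightarrow> a w y \<cdot> v = a (w \<cdot> v) (y \<cdot> v)))"

text \<open>The families of internal functors \<open>B \<rightarrow> Y\<close> parametrised by the object \<open>Z\<close>, that is, the
  internal functors from the product of \<open>B\<close> with the discrete category on \<open>Z\<close> to \<open>Y\<close>; and the
  families of internal transformations between two of them.\<close>

definition fun_family :: "('o, 'a) icat \<Rightarrow> ('o, 'a) icat \<Rightarrow> 'o \<Rightarrow> ('a \<Rightarrow> 'a \<Rightarrow> 'a) \<Rightarrow> ('a \<Rightarrow> 'a \<Rightarrow> 'a) \<Rightarrow> bool" where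
  "fun_family B Y Z a m \<longleftrightarrow> nat_family Z (IOb B) (IOb Y) a \<and> nat_family Z (IAr B) (IAr Y) m \<and>
     (\<forall>w f. elts Z (IAr B) w f \<longrightarrow> Src Y \<cdot> m w f = a w (Src B \<cdot> f) \<and> Tgt Y \<cdot> m w f = a w (Tgt B \<cdot> f)) \<and>
     (\<forall>w y. elts Z (IOb B) w y \<longrightarrow> m w (Idn B \<cdot> y) = Idn Y \<cdot> a w y) \<and>
     (\<forall>w g f. elts Z (IAr B) w g \<and> elts Z (IAr B) w f \<and> Src B \<cdot> g = Tgt B \<cdot> f \<longrightarrow>
        m w (icmp E B g f) = icmp E Y (m w g) (m w f))"

definition trans_family :: "('o, 'a) icat \<Rightarrow> ('o, 'a) icat \<Rightarrow> 'o \<Rightarrow> ('a \<Rightarrow> 'a \<Rightarrow> 'a) \<Rightarrow> ('a \<Rightarrow> 'a \<Rightarrow> 'a) \<Rightarrow>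
    ('a \<Rightarrow> 'a \<Rightarrow> 'a) \<Rightarrow> ('a \<Rightarrow> 'a \<Rightarrow> 'a) \<Rightarrow> ('a \<Rightarrow> 'a \<Rightarrow> 'a) \<Rightarrow> bool" where
  "trans_family B Y Z a m a' m' c \<longleftrightarrow> nat_family Z (IOb B) (IAr Y) c \<and>
     (\<forall>w y. elts Z (IOb B) w y \<longrightarrow> Src Y \<cdot> c w y = a w y \<and> Tgt Y \<cdot> c w y = a' w y) \<and>
     (\<forall>w f. elts Z (IAr B) w f \<longrightarrow>
        icmp E Y (m' w f) (c w (Src B \<cdot> f)) = icmp E Y (c w (Tgt B \<cdot> f)) (m w f))"

lemma nat_familyD:
  assumes "nat_family Z T W a" "elts Z T w y"
  shows "a w y \<in> Arr E" "Dom E (a w y) = Dom E y" "Cod E (a w y) = W"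
    "\<lbrakk>v \<in> Arr E; Cod E v = Dom E y\<rbrakk> \<Longrightarrow> a w y \<cdot> v = a (w \<cdot> v) (y \<cdot> v)"
  using assms by (simp_all add: nat_family_def)

lemma fun_family_ob:
  assumes "fun_family B Y Z a m" "h \<in> Arr E" "y \<in> Arr E" "Dom E h = Dom E y" "Cod E h = Z" "Cod E y = IOb B"
  shows "a h y \<in> Arr E" "Dom E (a h y) = Dom E y" "Cod E (a h y) = IOb Y"
    "\<lbrakk>v \<in> Arr E; Cod E v = Dom E y\<rbrakk> \<Longrightarrow> a h y \<cdot> v = a (h \<cdot> v) (y \<cdot> v)"
    "m h (Idn B \<cdot> y) = Idn Y \<cdot> a h y"
  using assms nat_familyD[of Z "IOb B" "IOb Y" a h y] by (simp_all add: fun_family_def)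

lemma fun_family_ar:
  assumes "fun_family B Y Z a m" "h \<in> Arr E" "y \<in> Arr E" "Dom E h = Dom E y" "Cod E h = Z" "Cod E y = IAr B"
  shows "m h y \<in> Arr E" "Dom E (m h y) = Dom E y" "Cod E (m h y) = IAr Y"
    "\<lbrakk>v \<in> Arr E; Cod E v = Dom E y\<rbrakk> \<Longrightarrow> m h y \<cdot> v = m (h \<cdot> v) (y \<cdot> v)"
    "Src Y \<cdot> m h y = a h (Src B \<cdot> y)" "Tgt Y \<cdot> m h y = a h (Tgt B \<cdot> y)"
    "\<lbrakk>g \<in> Arr E; Dom E g = Dom E y; Cod E g = IAr B; Src B \<cdot> g = Tgt B \<cdot> y\<rbrakk> \<Longrightarrow>
      m h (icmp E B g y) = icmp E Y (m h g) (m h y)"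
  using assms nat_familyD[of Z "IAr B" "IAr Y" m h y] by (simp_all add: fun_family_def)

end

text \<open>\<open>H0\<close> represents the families of functors, and \<open>H1\<close> below the families of transformations. An
  element \<open>h\<close> of \<open>H0\<close> acts on objects and arrows of \<open>B\<close> by \<open>A h\<close> and \<open>M h\<close>, an element \<open>n\<close> of
  \<open>H1\<close> is a transformation from \<open>\<sigma> \<cdot> n\<close> to \<open>\<tau> \<cdot> n\<close> with components \<open>C n\<close>.\<close>

locale funs_represented = fincat E for E :: "('o, 'a) cat" (structure) +
  fixes B Y :: "('o, 'a) icat" and H0 :: 'o and A M :: "'a \<Rightarrow> 'a \<Rightarrow> 'a"
  assumes B [simp]: "is_icat E B" and Y [simp]: "is_icat E Y"
    and H0 [simp]: "H0 \<in> Obj E"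
    and H0_fam: "fun_family B Y H0 A M"
    and H0_ex: "\<And>Z a m. \<lbrakk>Z \<in> Obj E; fun_family B Y Z a m\<rbrakk> \<Longrightarrow> \<exists>h \<in> hom E Z H0.
      (\<forall>w y. elts Z (IOb B) w y \<longrightarrow> A (h \<cdot> w) y = a w y) \<and> (\<forall>w f. elts Z (IAr B) w f \<longrightarrow> M (h \<cdot> w) f = m w f)"
    and H0_ext: "\<And>h h'. \<lbrakk>h \<in> Arr E; h' \<in> Arr E; Dom E h' = Dom E h; Cod E h = H0; Cod E h' = H0;
      \<And>w y. elts (Dom E h) (IOb B) w y \<Longrightarrow> A (h \<cdot> w) y = A (h' \<cdot> w) y;
      \<And>w f. elts (Dom E h) (IAr B) w f \<Longrightarrow> M (h \<cdot> w) f = M (h' \<cdot> w) f\<rbrakk> \<Longrightarrow> h = h'"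
begin

lemmas A_simps [simp] = fun_family_ob[OF H0_fam]
lemmas M_simps [simp] = fun_family_ar[OF H0_fam]

end

locale iexp = funs_represented E B Y H0 A M for E :: "('o, 'a) cat" (structure) and B Y H0 A M +
  fixes H1 :: 'o and C :: "'a \<Rightarrow> 'a \<Rightarrow> 'a" and \<sigma> \<tau> :: 'a
  assumes \<sigma>: "\<sigma> \<in> hom E H1 H0" and \<tau>: "\<tau> \<in> hom E H1 H0"
    and H1_fam: "trans_family B Y H1 (\<lambda>w. A (\<sigma> \<cdot> w)) (\<lambda>w. M (\<sigma> \<cdot> w)) (\<lambda>w. A (\<tau> \<cdot> w)) (\<lambda>w. M (\<tau> \<cdot> w)) C"
    and H1_ex: "\<And>Z h h' c. \<lbrakk>h \<in> hom E Z H0; h' \<in> hom E Z H0;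
      trans_family B Y Z (\<lambda>w. A (h \<cdot> w)) (\<lambda>w. M (h \<cdot> w)) (\<lambda>w. A (h' \<cdot> w)) (\<lambda>w. M (h' \<cdot> w)) c\<rbrakk> \<Longrightarrow>
      \<exists>n \<in> hom E Z H1. \<sigma> \<cdot> n = h \<and> \<tau> \<cdot> n = h' \<and> (\<forall>w y. elts Z (IOb B) w y \<longrightarrow> C (n \<cdot> w) y = c w y)"
    and H1_ext: "\<And>n n'. \<lbrakk>n \<in> Arr E; n' \<in> Arr E; Dom E n' = Dom E n; Cod E n = H1; Cod E n' = H1;
      \<sigma> \<cdot> n = \<sigma> \<cdot> n'; \<tau> \<cdot> n = \<tau> \<cdot> n';
      \<And>w y. elts (Dom E n) (IOb B) w y \<Longrightarrow> C (n \<cdot> w) y = C (n' \<cdot> w) y\<rbrakk> \<Longrightarrow> n = n'"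
begin

lemma endpoints [simp]: "\<sigma> \<in> Arr E" "Dom E \<sigma> = H1" "Cod E \<sigma> = H0" "\<tau> \<in> Arr E" "Dom E \<tau> = H1" "Cod E \<tau> = H0"
  using \<sigma> \<tau> by (simp_all add: hom_iff)

lemma H1_obj [simp]: "H1 \<in> Obj E"
  using dom_obj[of \<sigma>] by simp

lemma C_simps [simp]:
  assumes "n \<in> Arr E" "y \<in> Arr E" "Dom E n = Dom E y" "Cod E n = H1" "Cod E y = IOb B"
  shows "C n y \<in> Arr E" "Dom E (C n y) = Dom E y" "Cod E (C n y) = IAr Y"
    "\<lbrakk>v \<in> Arr E; Cod E v = Dom E y\<rbrakk> \<Longrightarrow> C n y \<cdot> v = C (n \<cdot> v) (y \<cdot> v)"
    "Src Y \<cdot> C n y = A (\<sigma> \<cdot> n) y" "Tgt Y \<cdot> C n y = A (\<tau> \<cdot> n) y"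
  using H1_fam assms nat_familyD[of H1 "IOb B" "IAr Y" C n y] by (simp_all add: trans_family_def)

lemma C_natural:
  assumes "elts H1 (IAr B) n f"
  shows "icmp E Y (M (\<tau> \<cdot> n) f) (C n (Src B \<cdot> f)) = icmp E Y (C n (Tgt B \<cdot> f)) (M (\<sigma> \<cdot> n) f)"
  using H1_fam assms by (simp add: trans_family_def)

text \<open>The naturality square with a further arrow \<open>z\<close> composed first, as needed
  inside right-nested composites.\<close>

lemma C_natural_comp:
  assumes "elts H1 (IAr B) n f" "z \<in> Arr E" "Dom E z = Dom E f" "Cod E z = IAr Y" "Tgt Y \<cdot> z = A (\<sigma> \<cdot> n) (Src B \<cdot> f)"
  shows "icmp E Y (M (\<tau> \<cdot> n) f) (icmp E Y (C n (Src B \<cdot> f)) z) = icmp E Y (C n (Tgt B \<cdot> f)) (icmp E Y (M (\<sigma> \<cdot> n) f) z)"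
proof -
  have "icmp E Y (icmp E Y (M (\<tau> \<cdot> n) f) (C n (Src B \<cdot> f))) z = icmp E Y (icmp E Y (C n (Tgt B \<cdot> f)) (M (\<sigma> \<cdot> n) f)) z"
    using C_natural[OF assms(1)] by simp
  then show ?thesis using assms by simp
qed

text \<open>The name of the transformation \<open>c\<close> as an element of \<open>H1\<close>; by
  \<open>H1_ext\<close> there is at most one.\<close>

definition trans_elt :: "'o \<Rightarrow> 'a \<Rightarrow> 'a \<Rightarrow> ('a \<Rightarrow> 'a \<Rightarrow> 'a) \<Rightarrow> 'a" where
  "trans_elt Z h h' c = (SOME n. n \<in> hom E Z H1 \<and> \<sigma> \<cdot> n = h \<and> \<tau> \<cdot> n = h' \<and>
     (\<forall>w y. elts Z (IOb B) w y \<longrightarrow> C (n \<cdot> w) y = c w y))"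

lemma trans_elt:
  assumes "h \<in> hom E Z H0" "h' \<in> hom E Z H0"
    "trans_family B Y Z (\<lambda>w. A (h \<cdot> w)) (\<lambda>w. M (h \<cdot> w)) (\<lambda>w. A (h' \<cdot> w)) (\<lambda>w. M (h' \<cdot> w)) c"
  shows "trans_elt Z h h' c \<in> Arr E" "Dom E (trans_elt Z h h' c) = Z" "Cod E (trans_elt Z h h' c) = H1"
    "\<sigma> \<cdot> trans_elt Z h h' c = h" "\<tau> \<cdot> trans_elt Z h h' c = h'"
    "elts Z (IOb B) w y \<Longrightarrow> C (trans_elt Z h h' c \<cdot> w) y = c w y"
proof -
  have "\<exists>n. n \<in> hom E Z H1 \<and> \<sigma> \<cdot> n = h \<and> \<tau> \<cdot> n = h' \<and> (\<forall>w y. elts Z (IOb B) w y \<longrightarrow> C (n \<cdot> w) y = c w y)"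
    using H1_ex[OF assms] by blast
  from someI_ex[OF this, folded trans_elt_def]
  show "trans_elt Z h h' c \<in> Arr E" "Dom E (trans_elt Z h h' c) = Z" "Cod E (trans_elt Z h h' c) = H1"
    "\<sigma> \<cdot> trans_elt Z h h' c = h" "\<tau> \<cdot> trans_elt Z h h' c = h'"
    "elts Z (IOb B) w y \<Longrightarrow> C (trans_elt Z h h' c \<cdot> w) y = c w y"
    by (simp_all add: hom_iff)
qed

text \<open>The identity transformation of the generic functor, that is, of the identity of
  \<open>H0\<close> as an element of \<open>H0\<close>.\<close>

definition idn :: 'a where
  "idn = trans_elt H0 (Idt E H0) (Idt E H0) (\<lambda>h y. Idn Y \<cdot> A h y)"

lemma idn_simps [simp]:
  shows "idn \<in> Arr E" "Dom E idn = H0" "Cod E idn = H1" "\<sigma> \<cdot> idn = Idt E H0" "\<tau> \<cdot> idn = Idt E H0"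
    "\<lbrakk>h \<in> Arr E; y \<in> Arr E; Dom E h = Dom E y; Cod E h = H0; Cod E y = IOb B\<rbrakk> \<Longrightarrow> C (idn \<cdot> h) y = Idn Y \<cdot> A h y"
proof -
  have "Idt E H0 \<in> hom E H0 H0" by (simp add: hom_iff)
  moreover have "trans_family B Y H0 (\<lambda>w. A (Idt E H0 \<cdot> w)) (\<lambda>w. M (Idt E H0 \<cdot> w)) (\<lambda>w. A (Idt E H0 \<cdot> w))
      (\<lambda>w. M (Idt E H0 \<cdot> w)) (\<lambda>h y. Idn Y \<cdot> A h y)"
    by (simp add: trans_family_def nat_family_def)
  ultimately show "idn \<in> Arr E" "Dom E idn = H0" "Cod E idn = H1" "\<sigma> \<cdot> idn = Idt E H0" "\<tau> \<cdot> idn = Idt E H0"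
    "\<lbrakk>h \<in> Arr E; y \<in> Arr E; Dom E h = Dom E y; Cod E h = H0; Cod E y = IOb B\<rbrakk> \<Longrightarrow> C (idn \<cdot> h) y = Idn Y \<cdot> A h y"
    unfolding idn_def by (simp_all add: trans_elt)
qed

lemma idn_comp [simp]:
  assumes "h \<in> Arr E" "Cod E h = H0"
  shows "\<sigma> \<cdot> (idn \<cdot> h) = h" "\<tau> \<cdot> (idn \<cdot> h) = h"
  using assms comp_ext[OF idn_simps(4)] comp_ext[OF idn_simps(5)] by simp_all

definition cmp :: "'a \<Rightarrow> 'a \<Rightarrow> 'a" where
  "cmp g f = trans_elt (Dom E f) (\<sigma> \<cdot> f) (\<tau> \<cdot> g) (\<lambda>w y. icmp E Y (C (g \<cdot> w) y) (C (f \<cdot> w) y))"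

lemma cmp_simps:
  assumes gf: "g \<in> Arr E" "f \<in> Arr E" "Dom E g = Dom E f" "Cod E g = H1" "Cod E f = H1" "\<sigma> \<cdot> g = \<tau> \<cdot> f"
  shows "cmp g f \<in> Arr E" "Dom E (cmp g f) = Dom E f" "Cod E (cmp g f) = H1"
    "\<sigma> \<cdot> cmp g f = \<sigma> \<cdot> f" "\<tau> \<cdot> cmp g f = \<tau> \<cdot> g"
    "elts (Dom E f) (IOb B) w y \<Longrightarrow> C (cmp g f \<cdot> w) y = icmp E Y (C (g \<cdot> w) y) (C (f \<cdot> w) y)"
proof -
  note [simp] = gf comp_ext[OF gf(6)]
  let ?c = "\<lambda>w y. icmp E Y (C (g \<cdot> w) y) (C (f \<cdot> w) y)"
  have "\<sigma> \<cdot> f \<in> hom E (Dom E f) H0" "\<tau> \<cdot> g \<in> hom E (Dom E f) H0" by (simp_all add: hom_iff)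
  moreover have "trans_family B Y (Dom E f) (\<lambda>w. A ((\<sigma> \<cdot> f) \<cdot> w)) (\<lambda>w. M ((\<sigma> \<cdot> f) \<cdot> w)) (\<lambda>w. A ((\<tau> \<cdot> g) \<cdot> w))
      (\<lambda>w. M ((\<tau> \<cdot> g) \<cdot> w)) ?c"
    unfolding trans_family_def
  proof (intro conjI allI impI)
    fix w z assume "elts (Dom E f) (IAr B) w z"
    then have [simp]: "w \<in> Arr E" "z \<in> Arr E" "Dom E w = Dom E z" "Cod E w = Dom E f" "Cod E z = IAr B" by simp_all
    \<comment> \<open>Naturality of the componentwise composite: the square of \<open>g\<close> is
      used first, under the component of \<open>f\<close>, and then the square of
      \<open>f\<close>.\<close>
    have "icmp E Y (M (\<tau> \<cdot> (g \<cdot> w)) z) (icmp E Y (C (g \<cdot> w) (Src B \<cdot> z)) (C (f \<cdot> w) (Src B \<cdot> z)))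
      = icmp E Y (C (g \<cdot> w) (Tgt B \<cdot> z)) (icmp E Y (M (\<tau> \<cdot> (f \<cdot> w)) z) (C (f \<cdot> w) (Src B \<cdot> z)))"
      using C_natural_comp[of "g \<cdot> w" z "C (f \<cdot> w) (Src B \<cdot> z)"] by simp
    then show "icmp E Y (M ((\<tau> \<cdot> g) \<cdot> w) z) (?c w (Src B \<cdot> z)) = icmp E Y (?c w (Tgt B \<cdot> z)) (M ((\<sigma> \<cdot> f) \<cdot> w) z)"
      using C_natural[of "f \<cdot> w" z] by simp
  qed (simp_all add: nat_family_def)
  ultimately show "cmp g f \<in> Arr E" "Dom E (cmp g f) = Dom E f" "Cod E (cmp g f) = H1"
    "\<sigma> \<cdot> cmp g f = \<sigma> \<cdot> f" "\<tau> \<cdot> cmp g f = \<tau> \<cdot> g"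
    "elts (Dom E f) (IOb B) w y \<Longrightarrow> C (cmp g f \<cdot> w) y = icmp E Y (C (g \<cdot> w) y) (C (f \<cdot> w) y)"
    unfolding cmp_def by (simp_all add: trans_elt)
qed

text \<open>\<open>cmp\<close> is chosen at each stage separately, so its naturality in the stage
  needs proof: both sides have the same ends and the same components.\<close>

lemma cmp_comp:
  assumes gf: "g \<in> Arr E" "f \<in> Arr E" "Dom E g = Dom E f" "Cod E g = H1" "Cod E f = H1" "\<sigma> \<cdot> g = \<tau> \<cdot> f"
    and w: "w \<in> Arr E" "Cod E w = Dom E f"
  shows "cmp g f \<cdot> w = cmp (g \<cdot> w) (f \<cdot> w)"
proof -
  have e: "\<sigma> \<cdot> (g \<cdot> w) = \<tau> \<cdot> (f \<cdot> w)" using gf w comp_ext[OF gf(6) gf(1), of w] by simp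
  have e': "\<sigma> \<cdot> (cmp g f \<cdot> w) = \<sigma> \<cdot> (f \<cdot> w)" "\<tau> \<cdot> (cmp g f \<cdot> w) = \<tau> \<cdot> (g \<cdot> w)"
    using gf w comp_ext[OF cmp_simps(4)[OF gf], of w] comp_ext[OF cmp_simps(5)[OF gf], of w] cmp_simps[OF gf] by simp_all
  show ?thesis
    by (rule H1_ext) (use gf w e e' in \<open>simp_all add: cmp_simps\<close>)
qed

lemma C_cmp:
  assumes gf: "g \<in> Arr E" "f \<in> Arr E" "Dom E g = Dom E f" "Cod E g = H1" "Cod E f = H1" "\<sigma> \<cdot> g = \<tau> \<cdot> f"
    and y: "y \<in> Arr E" "Dom E y = Dom E f" "Cod E y = IOb B"
  shows "C (cmp g f) y = icmp E Y (C g y) (C f y)"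
  using cmp_simps(6)[OF gf, of "Idt E (Dom E f)" y] cmp_simps(1-3)[OF gf] gf y by simp

definition expo :: "('o, 'a) icat" where
  "expo = \<lparr>IOb = H0, IAr = H1, Src = \<sigma>, Tgt = \<tau>, Idn = idn, Cmp = cmp (pb_fst E \<sigma> \<tau>) (pb_snd E \<sigma> \<tau>)\<rparr>"

lemma expo_sel [simp]: "IOb expo = H0" "IAr expo = H1" "Src expo = \<sigma>" "Tgt expo = \<tau>" "Idn expo = idn"
  by (simp_all add: expo_def)

text \<open>By \<open>H1_ext\<close> the unit and associativity laws reduce to those of
  \<open>Y\<close> at the components.\<close>

lemma is_icat_expo [simp]: "is_icat E expo"
  and icmp_expo: "\<lbrakk>g \<in> Arr E; f \<in> Arr E; Dom E g = Dom E f; Cod E g = H1; Cod E f = H1; \<sigma> \<cdot> g = \<tau> \<cdot> f\<rbrakk>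
    \<Longrightarrow> icmp E expo g f = cmp g f"
proof -
  have 3: "cmp g f \<in> hom E (Dom E f) H1 \<and> \<sigma> \<cdot> cmp g f = \<sigma> \<cdot> f \<and> \<tau> \<cdot> cmp g f = \<tau> \<cdot> g"
    if "g \<in> Arr E" "f \<in> Arr E" "Dom E g = Dom E f" "Cod E g = H1" "Cod E f = H1" "\<sigma> \<cdot> g = \<tau> \<cdot> f" for g f
    using cmp_simps[OF that] by (simp add: hom_iff)
  have u: "cmp (idn \<cdot> \<tau>) (Idt E H1) = Idt E H1" "cmp (Idt E H1) (idn \<cdot> \<sigma>) = Idt E H1"
    by (rule H1_ext; simp add: cmp_simps)+
  have a: "cmp (cmp h g) f = cmp h (cmp g f)"
    if [simp]: "h \<in> Arr E" "g \<in> Arr E" "f \<in> Arr E" "Dom E h = Dom E f" "Dom E g = Dom E f" "Cod E h = H1"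
      "Cod E g = H1" "Cod E f = H1" and c: "\<sigma> \<cdot> h = \<tau> \<cdot> g" "\<sigma> \<cdot> g = \<tau> \<cdot> f" for h g f
  proof -
    note [simp] = c comp_ext[OF c(1)] comp_ext[OF c(2)]
    show ?thesis by (rule H1_ext) (simp_all add: cmp_simps)
  qed
  note I = icatI[of \<sigma> H1 H0 \<tau> idn cmp, folded expo_def]
  show "is_icat E expo"
    by (rule I(1)[OF \<sigma> \<tau> _ _ _ 3 cmp_comp u a]) (simp_all add: hom_iff)
  assume "g \<in> Arr E" "f \<in> Arr E" "Dom E g = Dom E f" "Cod E g = H1" "Cod E f = H1" "\<sigma> \<cdot> g = \<tau> \<cdot> f"
  then show "icmp E expo g f = cmp g f"
    by - (rule I(2)[OF \<sigma> \<tau> _ _ _ 3 cmp_comp u a], simp_all add: hom_iff)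
qed

lemma C_icmp_expo [simp]:
  assumes gf: "g \<in> Arr E" "f \<in> Arr E" "Dom E g = Dom E f" "Cod E g = H1" "Cod E f = H1" "\<sigma> \<cdot> g = \<tau> \<cdot> f"
    and y: "y \<in> Arr E" "Dom E y = Dom E f" "Cod E y = IOb B"
  shows "C (icmp E expo g f) y = icmp E Y (C g y) (C f y)"
  using assms by (simp add: icmp_expo C_cmp)

lemma icmp_expo_st [simp]:
  assumes "g \<in> Arr E" "f \<in> Arr E" "Dom E g = Dom E f" "Cod E g = H1" "Cod E f = H1" "\<sigma> \<cdot> g = \<tau> \<cdot> f"
  shows "icmp E expo g f \<in> Arr E" "Dom E (icmp E expo g f) = Dom E f" "Cod E (icmp E expo g f) = H1"
    "\<sigma> \<cdot> icmp E expo g f = \<sigma> \<cdot> f" "\<tau> \<cdot> icmp E expo g f = \<tau> \<cdot> g"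
  using icmp_arr[of expo g f] assms by simp_all

lemma ifun_into_expo [simp]:
  assumes "is_ifun E u" "ICod u = expo"
  shows "\<sigma> \<cdot> OnAr u = OnOb u \<cdot> Src (IDom u)" "\<tau> \<cdot> OnAr u = OnOb u \<cdot> Tgt (IDom u)"
    and "IDom u = X \<Longrightarrow> OnAr u \<cdot> Idn X = idn \<cdot> OnOb u"
    and "\<lbrakk>x \<in> Arr E; Cod E x = IAr (IDom u)\<rbrakk> \<Longrightarrow> \<sigma> \<cdot> (OnAr u \<cdot> x) = OnOb u \<cdot> (Src (IDom u) \<cdot> x)"
    and "\<lbrakk>x \<in> Arr E; Cod E x = IAr (IDom u)\<rbrakk> \<Longrightarrow> \<tau> \<cdot> (OnAr u \<cdot> x) = OnOb u \<cdot> (Tgt (IDom u) \<cdot> x)"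
    and "\<lbrakk>x \<in> Arr E; Cod E x = IOb X; IDom u = X\<rbrakk> \<Longrightarrow> OnAr u \<cdot> (Idn X \<cdot> x) = idn \<cdot> (OnOb u \<cdot> x)"
  using assms Src_OnAr[of u expo] Tgt_OnAr[of u expo] OnAr_Idn[of u X] ifun_comp_simps[of u "IDom u" expo x] by auto

lemma itrans_into_expo [simp]:
  assumes "is_itrans E \<alpha>" "ICod (TDom \<alpha>) = expo"
  shows "\<sigma> \<cdot> Cmpt \<alpha> = OnOb (TDom \<alpha>)" "\<tau> \<cdot> Cmpt \<alpha> = OnOb (TCod \<alpha>)"
    and "\<lbrakk>x \<in> Arr E; Cod E x = IOb (IDom (TDom \<alpha>))\<rbrakk> \<Longrightarrow> \<sigma> \<cdot> (Cmpt \<alpha> \<cdot> x) = OnOb (TDom \<alpha>) \<cdot> x"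
    and "\<lbrakk>x \<in> Arr E; Cod E x = IOb (IDom (TDom \<alpha>))\<rbrakk> \<Longrightarrow> \<tau> \<cdot> (Cmpt \<alpha> \<cdot> x) = OnOb (TCod \<alpha>) \<cdot> x"
  using assms Src_Cmpt[of \<alpha> expo] Tgt_Cmpt[of \<alpha> expo] itrans_comp_simps[of \<alpha> expo x] by auto

text \<open>On an arrow \<open>(n, f)\<close> this is the diagonal of the naturality square of
  \<open>n\<close> at \<open>f\<close>: the source functor \<open>\<sigma> \<cdot> n\<close> acts on
  \<open>f\<close>, followed by the component of \<open>n\<close> at the target of
  \<open>f\<close>.\<close>

definition ev :: "('o, 'a) ifun" where
  "ev = (let P = prod_ob (Cat1 E) expo B; p = prod_fst (Cat1 E) expo B; q = prod_snd (Cat1 E) expo B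
    in \<lparr>IDom = P, ICod = Y, OnOb = A (OnOb p) (OnOb q),
        OnAr = icmp E Y (C (OnAr p) (Tgt B \<cdot> OnAr q)) (M (\<sigma> \<cdot> OnAr p) (OnAr q))\<rparr>)"

lemma ev_sel [simp]: "IDom ev = prod_ob (Cat1 E) expo B" "ICod ev = Y"
  by (simp_all add: ev_def Let_def)

lemma ev_comp:
  assumes "x \<in> Arr E"
  shows "Cod E x = IOb (prod_ob (Cat1 E) expo B) \<Longrightarrow> OnOb ev \<cdot> x =
      A (OnOb (prod_fst (Cat1 E) expo B) \<cdot> x) (OnOb (prod_snd (Cat1 E) expo B) \<cdot> x)"
    and "Cod E x = IAr (prod_ob (Cat1 E) expo B) \<Longrightarrow> OnAr ev \<cdot> x =
      icmp E Y (C (OnAr (prod_fst (Cat1 E) expo B) \<cdot> x) (Tgt B \<cdot> (OnAr (prod_snd (Cat1 E) expo B) \<cdot> x)))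
        (M (\<sigma> \<cdot> (OnAr (prod_fst (Cat1 E) expo B) \<cdot> x)) (OnAr (prod_snd (Cat1 E) expo B) \<cdot> x))"
  using assms by (simp_all add: ev_def Let_def)

lemma is_ifun_ev [simp]: "is_ifun E ev"
proof -
  let ?P = "prod_ob (Cat1 E) expo B" and ?p = "prod_fst (Cat1 E) expo B" and ?q = "prod_snd (Cat1 E) expo B"
  show ?thesis
    apply (rule is_ifunI; simp add: ev_def Let_def hom_iff)
    \<comment> \<open>Preservation of composition: naturality moves the component of the
      transformation in \<open>f\<close> past the action on the \<open>B\<close>-part of
      \<open>g\<close>.\<close>
    subgoal for g f
      using C_natural_comp[of "OnAr ?p \<cdot> f" "OnAr ?q \<cdot> g" "M (OnOb ?p \<cdot> (Src ?P \<cdot> f)) (OnAr ?q \<cdot> f)"] by simp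
    done
qed

text \<open>This is the uncurrying of \<open>u\<close>, computed at generalized elements.\<close>

lemma ev_prod:
  assumes u [simp]: "is_ifun E u" "IDom u = X" "ICod u = expo"
  defines "F \<equiv> ev \<odot> FAr (prod_functor (Cat1 E) B) u"
    and "Q \<equiv> prod_ob (Cat1 E) X B" and "p \<equiv> prod_fst (Cat1 E) X B" and "q \<equiv> prod_snd (Cat1 E) X B"
  shows "is_ifun E F" "IDom F = Q" "ICod F = Y"
    and "\<lbrakk>x \<in> Arr E; Cod E x = IOb Q\<rbrakk> \<Longrightarrow> OnOb F \<cdot> x = A (OnOb u \<cdot> (OnOb p \<cdot> x)) (OnOb q \<cdot> x)"
    and "\<lbrakk>x \<in> Arr E; Cod E x = IAr Q\<rbrakk> \<Longrightarrow> OnAr F \<cdot> x =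
      icmp E Y (C (OnAr u \<cdot> (OnAr p \<cdot> x)) (Tgt B \<cdot> (OnAr q \<cdot> x))) (M (OnOb u \<cdot> (Src X \<cdot> (OnAr p \<cdot> x))) (OnAr q \<cdot> x))"
proof -
  have [simp]: "is_icat E X" using ifun_simps(1)[OF u(1)] by simp
  show "is_ifun E F" "IDom F = Q" "ICod F = Y" by (simp_all add: F_def Q_def)
  show "OnOb F \<cdot> x = A (OnOb u \<cdot> (OnOb p \<cdot> x)) (OnOb q \<cdot> x)" if "x \<in> Arr E" "Cod E x = IOb Q"
    using that by (simp add: F_def Q_def p_def q_def ev_comp)
  show "OnAr F \<cdot> x =
      icmp E Y (C (OnAr u \<cdot> (OnAr p \<cdot> x)) (Tgt B \<cdot> (OnAr q \<cdot> x))) (M (OnOb u \<cdot> (Src X \<cdot> (OnAr p \<cdot> x))) (OnAr q \<cdot> x))"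
    if "x \<in> Arr E" "Cod E x = IAr Q"
    using that by (simp add: F_def Q_def p_def q_def ev_comp)
qed

lemma ev_universal: "is_universal (Cat1 E) (Cat1 E) (prod_functor (Cat1 E) B) Y expo ev"
  unfolding is_universal_def
proof (intro conjI ballI)
  show "expo \<in> Obj (Cat1 E)" "ev \<in> hom (Cat1 E) (FOb (prod_functor (Cat1 E) B) expo) Y"
    by (simp_all add: hom_iff is_ifun_ev)
  fix X F assume X: "X \<in> Obj (Cat1 E)" and "F \<in> hom (Cat1 E) (FOb (prod_functor (Cat1 E) B) X) Y"
  let ?Q = "prod_ob (Cat1 E) X B" and ?p = "prod_fst (Cat1 E) X B" and ?q = "prod_snd (Cat1 E) X B"
  have X [simp]: "is_icat E X" and F [simp]: "is_ifun E F" "IDom F = ?Q" "ICod F = Y"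
    using X \<open>F \<in> _\<close> by (simp_all add: hom_iff)
  let ?l0 = "lift E (OnOb ?p) (OnOb ?q)" and ?lA = "lift E (OnAr ?p) (OnAr ?q)"
  \<comment> \<open>The currying of \<open>F\<close>: an object \<open>w\<close> of \<open>X\<close>
    gives the functor \<open>(a w, m w)\<close> on \<open>B\<close>, and an arrow \<open>n\<close>
    of \<open>X\<close> gives the transformation \<open>c n\<close>.\<close>
  define a m c where "a = (\<lambda>w y. OnOb F \<cdot> ?l0 w y)" "m = (\<lambda>w f. OnAr F \<cdot> ?lA (Idn X \<cdot> w) f)"
    "c = (\<lambda>n y. OnAr F \<cdot> ?lA n (Idn B \<cdot> y))"
  note amc = this
  have icmpF: "icmp E Y (OnAr F \<cdot> g) (OnAr F \<cdot> f) = OnAr F \<cdot> icmp E ?Q g f"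
    if "g \<in> Arr E" "f \<in> Arr E" "Dom E g = Dom E f" "Cod E g = IAr ?Q" "Cod E f = IAr ?Q" "Src ?Q \<cdot> g = Tgt ?Q \<cdot> f" for g f
    using OnAr_icmp[of F ?Q g f] that by simp
  have [simp]: "OnAr F \<cdot> ?lA (Idn X \<cdot> w) (Idn B \<cdot> y) = Idn Y \<cdot> (OnOb F \<cdot> ?l0 w y)"
    if "elts (IOb X) (IOb B) w y" for w y
    using that ifun_comp_simps(3)[of F ?Q Y "?l0 w y"] by (simp del: ifun_comp_simps(3))
  \<comment> \<open>The arrow \<open>(n, f)\<close> factors through arrows with one identity entry
    in two ways. The first factorization recovers \<open>F\<close> from the curried data; the
    agreement of both is naturality of \<open>c n\<close>.\<close>
  have split: "icmp E Y (c n (Tgt B \<cdot> f)) (m (Src X \<cdot> n) f) = OnAr F \<cdot> ?lA n f"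
    "icmp E Y (m (Tgt X \<cdot> n) f) (c n (Src B \<cdot> f)) = OnAr F \<cdot> ?lA n f"
    if "elts (IAr X) (IAr B) n f" for n f
    using that by (simp_all add: amc icmpF del: OnAr_icmp)
  have "fun_family B Y (IOb X) a m"
    unfolding fun_family_def nat_family_def
    by (auto simp: amc icmpF simp del: OnAr_icmp)
  then obtain h where h [simp]: "h \<in> Arr E" "Dom E h = IOb X" "Cod E h = H0"
    and hA: "\<And>w y. elts (IOb X) (IOb B) w y \<Longrightarrow> A (h \<cdot> w) y = a w y"
    and hM: "\<And>w f. elts (IOb X) (IAr B) w f \<Longrightarrow> M (h \<cdot> w) f = m w f"
    using H0_ex[of "IOb X" a m] by (auto simp: hom_iff)
  \<comment> \<open>The arrow part of the transpose: over the generic arrow of \<open>X\<close>,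
    \<open>c\<close> is a transformation from the functor at its source to the functor at its
    target.\<close>
  have "trans_family B Y (IAr X) (\<lambda>w. A ((h \<cdot> Src X) \<cdot> w)) (\<lambda>w. M ((h \<cdot> Src X) \<cdot> w))
     (\<lambda>w. A ((h \<cdot> Tgt X) \<cdot> w)) (\<lambda>w. M ((h \<cdot> Tgt X) \<cdot> w)) c"
    unfolding trans_family_def
  proof (intro conjI allI impI)
    fix w f assume "elts (IAr X) (IAr B) w f"
    then show "icmp E Y (M ((h \<cdot> Tgt X) \<cdot> w) f) (c w (Src B \<cdot> f)) = icmp E Y (c w (Tgt B \<cdot> f)) (M ((h \<cdot> Src X) \<cdot> w) f)"
      by (simp add: hM split)
  next
    show "nat_family (IAr X) (IOb B) (IAr Y) c" by (simp add: nat_family_def amc)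
  qed (simp_all add: hA, simp_all add: amc)
  moreover have "h \<cdot> Src X \<in> hom E (IAr X) H0" "h \<cdot> Tgt X \<in> hom E (IAr X) H0" by (simp_all add: hom_iff)
  ultimately obtain n where n [simp]: "n \<in> Arr E" "Dom E n = IAr X" "Cod E n = H1" "\<sigma> \<cdot> n = h \<cdot> Src X" "\<tau> \<cdot> n = h \<cdot> Tgt X"
    and nC: "\<And>w y. elts (IAr X) (IOb B) w y \<Longrightarrow> C (n \<cdot> w) y = c w y"
    using H1_ex[of "h \<cdot> Src X" "IAr X" "h \<cdot> Tgt X" c] by (auto simp: hom_iff)
  note [simp] = comp_ext[OF n(4)] comp_ext[OF n(5)]
  let ?u = "\<lparr>IDom = X, ICod = expo, OnOb = h, OnAr = n\<rparr>"
  have u: "is_ifun E ?u"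
  proof (rule is_ifunI; simp add: hom_iff)
    show "n \<cdot> Idn X = idn \<cdot> h"
      by (rule H1_ext) (simp_all add: nC hA, simp_all add: amc)
    fix g f assume [simp]: "g \<in> Arr E" "f \<in> Arr E" "Dom E g = Dom E f" "Cod E g = IAr X" "Cod E f = IAr X" "Src X \<cdot> g = Tgt X \<cdot> f"
    note [simp] = comp_ext[OF this(6)]
    show "n \<cdot> icmp E X g f = icmp E expo (n \<cdot> g) (n \<cdot> f)"
      by (rule H1_ext) (simp_all add: nC, simp_all add: amc icmpF del: OnAr_icmp)
  qed
  show "\<exists>!u. u \<in> hom (Cat1 E) X expo \<and> ev \<odot> FAr (prod_functor (Cat1 E) B) u = F"
  proof (rule ex1I)
    have "IDom ?u = X" "ICod ?u = expo" by simp_all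
    note e = ev_prod[OF u this, simplified ifun.simps]
    have "ev \<odot> FAr (prod_functor (Cat1 E) B) ?u = F"
    proof (rule ifun_eqI)
      show "OnOb (ev \<odot> FAr (prod_functor (Cat1 E) B) ?u) = OnOb F"
        using e(4)[of "Idt E (IOb ?Q)"] e(1-3) ifun_simps(3,4)[OF e(1)] by (simp add: hA amc(1) del: Cat1_simps(11))
      show "OnAr (ev \<odot> FAr (prod_functor (Cat1 E) B) ?u) = OnAr F"
        using e(5)[of "Idt E (IAr ?Q)"] e(1-3) ifun_simps(6,7)[OF e(1)] split(1)[of "OnAr ?p" "OnAr ?q"]
        by (simp add: hM nC del: Cat1_simps(12))
    qed (use e(1-3) in simp_all)
    then show "?u \<in> hom (Cat1 E) X expo \<and> ev \<odot> FAr (prod_functor (Cat1 E) B) ?u = F"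
      using u by (simp add: hom_iff)
    fix v assume v: "v \<in> hom (Cat1 E) X expo \<and> ev \<odot> FAr (prod_functor (Cat1 E) B) v = F"
    then have v' [simp]: "is_ifun E v" "IDom v = X" "ICod v = expo" by (simp_all add: hom_iff)
    note f = ev_prod(4,5)[OF v', unfolded conjunct2[OF v]]
    \<comment> \<open>Evaluating the given equation at pairs of objects, and at pairs of arrows with
      one identity entry, shows that any solution \<open>v\<close> has the curried data
      \<open>a\<close>, \<open>m\<close>, \<open>c\<close>.\<close>
    have A: "A (OnOb v \<cdot> w) y = a w y" if "elts (IOb X) (IOb B) w y" for w y
      using that f(1)[of "?l0 w y"] by (simp add: amc(1))
    have M: "M (OnOb v \<cdot> w) f = m w f" if "elts (IOb X) (IAr B) w f" for w f
      using that f(2)[of "?lA (Idn X \<cdot> w) f"] by (simp add: amc(2))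
    have C: "C (OnAr v \<cdot> w) y = c w y" if "elts (IAr X) (IOb B) w y" for w y
      using that f(2)[of "?lA w (Idn B \<cdot> y)"] by (simp add: amc(3))
    have "OnOb v = h" by (rule H0_ext) (simp_all add: A M hA hM)
    moreover from this have "OnAr v = n" by - (rule H1_ext, simp_all add: C nC)
    ultimately show "v = ?u" by (intro ifun_eqI) simp_all
  qed
qed

text \<open>The second component of the cell \<open>\<alpha> \<times> B\<close> is an identity, and
  on an arrow \<open>(n, 1)\<close> evaluation is just the component of \<open>n\<close>.\<close>

lemma ev_whisker:
  assumes \<alpha> [simp]: "is_itrans E \<alpha>" "IDom (TDom \<alpha>) = X" "ICod (TDom \<alpha>) = expo"
  shows "Cmpt (HComp (Cat2 E) (CIdt (Cat2 E) ev) (FCell (prod_2functor (Cat2 E) B) \<alpha>))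
    = C (Cmpt \<alpha> \<cdot> OnOb (prod_fst (Cat1 E) X B)) (OnOb (prod_snd (Cat1 E) X B))"
proof -
  have [simp]: "is_icat E X" using ifun_simps(1)[of "TDom \<alpha>"] itrans_simps(1)[OF \<alpha>(1)] by simp
  show ?thesis by (simp add: HComp_CIdt_left ev_comp del: Cat2_simps(13))
qed

text \<open>Naturality of \<open>\<beta>\<close> splits in two. At arrows with an identity in
  \<open>X\<close> it is naturality in \<open>B\<close>, which makes \<open>\<beta>\<close> a family
  of transformations and so an arrow into \<open>H1\<close>; at arrows with an identity in
  \<open>B\<close> it is naturality of the resulting cell in \<open>X\<close>.\<close>

lemma ev_2universal: "is_2universal (Cat2 E) (Cat2 E) (prod_2functor (Cat2 E) B) Y expo ev"
  unfolding is_2universal_def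
proof (intro conjI ballI)
  show "is_universal (Und (Cat2 E)) (Und (Cat2 E)) (FUnd (prod_2functor (Cat2 E) B)) Y expo ev"
    using ev_universal by simp
  fix X u v \<beta>
  assume "X \<in> Obj (Und (Cat2 E))" "u \<in> hom (Und (Cat2 E)) X expo" "v \<in> hom (Und (Cat2 E)) X expo"
    and \<beta>: "\<beta> \<in> cells (Cat2 E) (ev \<cdot>\<^bsub>Und (Cat2 E)\<^esub> FAr (FUnd (prod_2functor (Cat2 E) B)) u)
      (ev \<cdot>\<^bsub>Und (Cat2 E)\<^esub> FAr (FUnd (prod_2functor (Cat2 E) B)) v)"
  then have X [simp]: "is_icat E X" and u [simp]: "is_ifun E u" "IDom u = X" "ICod u = expo"
    and v [simp]: "is_ifun E v" "IDom v = X" "ICod v = expo" by (simp_all add: hom_iff)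
  let ?Q = "prod_ob (Cat1 E) X B" and ?p = "prod_fst (Cat1 E) X B" and ?q = "prod_snd (Cat1 E) X B"
  let ?l0 = "lift E (OnOb ?p) (OnOb ?q)" and ?lA = "lift E (OnAr ?p) (OnAr ?q)"
  let ?F = "ev \<odot> FAr (prod_functor (Cat1 E) B) u" and ?G = "ev \<odot> FAr (prod_functor (Cat1 E) B) v"
  define F G where "F = ?F" "G = ?G"
  note FG = ev_prod[OF u, folded F_G_def] ev_prod[OF v, folded F_G_def]
  have \<beta>' [simp]: "is_itrans E \<beta>" "TDom \<beta> = F" "TCod \<beta> = G"
    using \<beta> by (simp_all add: cells_def F_G_def)
  note [simp] = FG(1-3) FG(6-8)
  have F0: "OnOb F \<cdot> ?l0 w y = A (OnOb u \<cdot> w) y" "OnOb G \<cdot> ?l0 w y = A (OnOb v \<cdot> w) y" if "elts (IOb X) (IOb B) w y" for w y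
    using that FG(4)[of "?l0 w y"] FG(9)[of "?l0 w y"] by simp_all
  have F1: "OnAr F \<cdot> ?lA (Idn X \<cdot> w) f = M (OnOb u \<cdot> w) f" "OnAr G \<cdot> ?lA (Idn X \<cdot> w) f = M (OnOb v \<cdot> w) f"
    if "elts (IOb X) (IAr B) w f" for w f
    using that FG(5)[of "?lA (Idn X \<cdot> w) f"] FG(10)[of "?lA (Idn X \<cdot> w) f"] by simp_all
  have F2: "OnAr F \<cdot> ?lA n (Idn B \<cdot> y) = C (OnAr u \<cdot> n) y" "OnAr G \<cdot> ?lA n (Idn B \<cdot> y) = C (OnAr v \<cdot> n) y"
    if "elts (IAr X) (IOb B) n y" for n y
    using that FG(5)[of "?lA n (Idn B \<cdot> y)"] FG(10)[of "?lA n (Idn B \<cdot> y)"] by simp_all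
  have nat: "icmp E Y (OnAr G \<cdot> ?lA n f) (Cmpt \<beta> \<cdot> ?l0 (Src X \<cdot> n) (Src B \<cdot> f)) =
      icmp E Y (Cmpt \<beta> \<cdot> ?l0 (Tgt X \<cdot> n) (Tgt B \<cdot> f)) (OnAr F \<cdot> ?lA n f)" if "elts (IAr X) (IAr B) n f" for n f
    using that itrans_natural[OF \<beta>'(1), of "?lA n f"] by simp
  have \<beta>st [simp]: "Src Y \<cdot> (Cmpt \<beta> \<cdot> ?l0 w y) = A (OnOb u \<cdot> w) y" "Tgt Y \<cdot> (Cmpt \<beta> \<cdot> ?l0 w y) = A (OnOb v \<cdot> w) y"
    if "elts (IOb X) (IOb B) w y" for w y
    using that itrans_comp_simps[OF \<beta>'(1), of Y "?l0 w y"] F0[of w y] by simp_all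
  let ?c = "\<lambda>w y. Cmpt \<beta> \<cdot> ?l0 w y"
  have "trans_family B Y (IOb X) (\<lambda>w. A (OnOb u \<cdot> w)) (\<lambda>w. M (OnOb u \<cdot> w)) (\<lambda>w. A (OnOb v \<cdot> w)) (\<lambda>w. M (OnOb v \<cdot> w)) ?c"
    unfolding trans_family_def
  proof (intro conjI allI impI)
    fix w f assume "elts (IOb X) (IAr B) w f"
    then show "icmp E Y (M (OnOb v \<cdot> w) f) (?c w (Src B \<cdot> f)) = icmp E Y (?c w (Tgt B \<cdot> f)) (M (OnOb u \<cdot> w) f)"
      using nat[of "Idn X \<cdot> w" f] by (simp add: F1)
  next
    show "nat_family (IOb X) (IOb B) (IAr Y) ?c" by (simp add: nat_family_def)
  qed (simp_all add: F0)
  moreover have "OnOb u \<in> hom E (IOb X) H0" "OnOb v \<in> hom E (IOb X) H0"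
    using ifun_simps(3-5)[OF u(1)] ifun_simps(3-5)[OF v(1)] by (simp_all add: hom_iff)
  ultimately obtain n where n [simp]: "n \<in> Arr E" "Dom E n = IOb X" "Cod E n = H1" "\<sigma> \<cdot> n = OnOb u" "\<tau> \<cdot> n = OnOb v"
    and nC: "\<And>w y. elts (IOb X) (IOb B) w y \<Longrightarrow> C (n \<cdot> w) y = ?c w y"
    using H1_ex[of "OnOb u" "IOb X" "OnOb v" ?c] by (auto simp: hom_iff)
  note [simp] = comp_ext[OF n(4)] comp_ext[OF n(5)]
  let ?\<alpha> = "\<lparr>TDom = u, TCod = v, Cmpt = n\<rparr>"
  have \<alpha>: "is_itrans E ?\<alpha>"
  proof (rule is_itransI[where X = X and Y = expo])
    have "icmp E expo (OnAr v) (n \<cdot> Src X) = icmp E expo (n \<cdot> Tgt X) (OnAr u)"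
    proof (rule H1_ext)
      fix w y assume "elts (Dom E (icmp E expo (OnAr v) (n \<cdot> Src X))) (IOb B) w y"
      then show "C (icmp E expo (OnAr v) (n \<cdot> Src X) \<cdot> w) y = C (icmp E expo (n \<cdot> Tgt X) (OnAr u) \<cdot> w) y"
        using nat[of w "Idn B \<cdot> y"] by (simp add: nC F2)
    qed simp_all
    then show "icmp E expo (OnAr (TCod ?\<alpha>)) (Cmpt ?\<alpha> \<cdot> Src X) = icmp E expo (Cmpt ?\<alpha> \<cdot> Tgt X) (OnAr (TDom ?\<alpha>))"
      by simp
  qed (simp_all add: hom_iff)
  show "\<exists>!\<alpha>. \<alpha> \<in> cells (Cat2 E) u v \<and> HComp (Cat2 E) (CIdt (Cat2 E) ev) (FCell (prod_2functor (Cat2 E) B) \<alpha>) = \<beta>"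
  proof (rule ex1I)
    have "HComp (Cat2 E) (CIdt (Cat2 E) ev) (FCell (prod_2functor (Cat2 E) B) ?\<alpha>) = \<beta>"
    proof (rule itrans_eqI)
      show "Cmpt (HComp (Cat2 E) (CIdt (Cat2 E) ev) (FCell (prod_2functor (Cat2 E) B) ?\<alpha>)) = Cmpt \<beta>"
        by (subst ev_whisker[OF \<alpha>, of X]) (simp_all add: nC)
    qed (use FCell_prod(2,3)[OF B \<alpha>] in \<open>simp_all add: F_G_def\<close>)
    then show "?\<alpha> \<in> cells (Cat2 E) u v \<and> HComp (Cat2 E) (CIdt (Cat2 E) ev) (FCell (prod_2functor (Cat2 E) B) ?\<alpha>) = \<beta>"
      using \<alpha> by (simp add: cells_def)
    fix \<delta> assume d: "\<delta> \<in> cells (Cat2 E) u v \<and> HComp (Cat2 E) (CIdt (Cat2 E) ev) (FCell (prod_2functor (Cat2 E) B) \<delta>) = \<beta>"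
    then have \<delta> [simp]: "is_itrans E \<delta>" "TDom \<delta> = u" "TCod \<delta> = v" by (simp_all add: cells_def)
    have dC: "C (Cmpt \<delta> \<cdot> OnOb ?p) (OnOb ?q) = Cmpt \<beta>"
      using ev_whisker[OF \<delta>(1), of X] d by simp
    have "C (Cmpt \<delta> \<cdot> w) y = ?c w y" if "elts (IOb X) (IOb B) w y" for w y
      using that arg_cong[OF dC, of "\<lambda>x. x \<cdot> ?l0 w y"] by simp
    then have "Cmpt \<delta> = n"
      by - (rule H1_ext, simp_all add: nC)
    then show "\<delta> = ?\<alpha>" by (intro itrans_eqI) simp_all
  qed
qed

end

section \<open>Representing objects in a cartesian closed category\<close>

locale ccc = fincat E for E :: "('o, 'a) cat" (structure) +
  assumes closed: "cartesian_closed E"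
begin

text \<open>The exponential \<open>W^T\<close> as a representing object for natural families, with
  \<open>app\<close> as evaluation at generalized elements; the last clause is uniqueness of
  transposes.\<close>

definition exponent :: "'o \<Rightarrow> 'o \<Rightarrow> 'o \<Rightarrow> ('a \<Rightarrow> 'a \<Rightarrow> 'a) \<Rightarrow> bool" where
  "exponent T W K app \<longleftrightarrow> K \<in> Obj E \<and> nat_family K T W app \<and>
     (\<forall>Z a. Z \<in> Obj E \<and> nat_family Z T W a \<longrightarrow>
        (\<exists>k \<in> hom E Z K. \<forall>w y. elts Z T w y \<longrightarrow> app (k \<cdot> w) y = a w y)) \<and>
     (\<forall>k k'. elts K K k k' \<and> (\<forall>w y. elts (Dom E k) T w y \<longrightarrow> app (k \<cdot> w) y = app (k' \<cdot> w) y) \<longrightarrow> k = k')"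

lemma exponent_ex:
  assumes "exponent T W K app" "Z \<in> Obj E" "nat_family Z T W a"
  obtains k where "k \<in> hom E Z K" "\<And>w y. elts Z T w y \<Longrightarrow> app (k \<cdot> w) y = a w y"
proof -
  have "\<exists>k \<in> hom E Z K. \<forall>w y. elts Z T w y \<longrightarrow> app (k \<cdot> w) y = a w y"
    using assms unfolding exponent_def by simp
  then show thesis using that by blast
qed

lemma exponent_ext:
  assumes "exponent T W K app" "k \<in> Arr E" "k' \<in> Arr E" "Dom E k' = Dom E k" "Cod E k = K" "Cod E k' = K"
    "\<And>w y. elts (Dom E k) T w y \<Longrightarrow> app (k \<cdot> w) y = app (k' \<cdot> w) y"
  shows "k = k'"
proof -
  have "elts K K k k'" "\<forall>w y. elts (Dom E k) T w y \<longrightarrow> app (k \<cdot> w) y = app (k' \<cdot> w) y"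
    using assms(2-) by simp_all
  with assms(1) show ?thesis unfolding exponent_def by simp
qed

text \<open>By Yoneda a natural family is determined by its value at the two projections of
  \<open>Z \<times> T\<close>, an arrow that the universal arrow of the adjunction transposes.
  Uniqueness is likewise tested at the projections.\<close>

lemma exponent_exists:
  assumes T [simp]: "T \<in> Obj E" and W [simp]: "W \<in> Obj E"
  obtains K app where "exponent T W K app"
proof -
  interpret F: functor_loc E E "prod_functor E T" by unfold_locales (rule is_functor_prod[OF T])
  obtain G \<eta> \<epsilon> where "is_adjunction E E (prod_functor E T) G \<eta> \<epsilon>"
    using closed T unfolding cartesian_closed_def by blast
  then have U: "is_universal E E (prod_functor E T) W (FOb G W) (\<epsilon> W)"
    by (rule F.adjunction_universal) simp
  let ?K = "FOb G W" and ?e = "\<epsilon> W"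
  have K [simp]: "?K \<in> Obj E" "?e \<in> Arr E" "Dom E ?e = prod_ob E ?K T" "Cod E ?e = W"
    using U by (simp_all add: is_universal_def hom_iff)
  define app where "app = (\<lambda>k y. ?e \<cdot> lift E (prod_fst E ?K T) (prod_snd E ?K T) k y)"
  have fam: "nat_family ?K T W app"
    by (simp add: nat_family_def app_def pair_comp)
  have lift: "FAr (prod_functor E T) k \<cdot> lift E (prod_fst E Z T) (prod_snd E Z T) w y =
      lift E (prod_fst E ?K T) (prod_snd E ?K T) (k \<cdot> w) y"
    if "k \<in> hom E Z ?K" "elts Z T w y" for k Z w y
  proof -
    have [simp]: "Z \<in> Obj E" using that(1) dom_obj[of k] by (simp add: hom_iff)
    show ?thesis using that by - (rule prod_eqI[of ?K T], simp_all add: hom_iff)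
  qed
  have "exponent T W ?K app"
    unfolding exponent_def
  proof (intro conjI allI impI)
    fix Z a assume a: "Z \<in> Obj E \<and> nat_family Z T W a"
    then have [simp]: "Z \<in> Obj E" by simp
    let ?f = "a (prod_fst E Z T) (prod_snd E Z T)"
    note af = nat_familyD[OF conjunct2[OF a], of "prod_fst E Z T" "prod_snd E Z T", simplified]
    have "?f \<in> hom E (prod_ob E Z T) W" using af by (simp add: hom_iff)
    then obtain k where k: "k \<in> hom E Z ?K" "?e \<cdot> FAr (prod_functor E T) k = ?f"
      using U \<open>Z \<in> Obj E\<close> unfolding is_universal_def FOb_prod by blast
    show "\<exists>k \<in> hom E Z ?K. \<forall>w y. elts Z T w y \<longrightarrow> app (k \<cdot> w) y = a w y"
    proof (intro bexI[OF _ k(1)] allI impI)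
      fix w y assume wy: "elts Z T w y"
      have "app (k \<cdot> w) y = (?e \<cdot> FAr (prod_functor E T) k) \<cdot> lift E (prod_fst E Z T) (prod_snd E Z T) w y"
        using k(1) wy by (simp add: app_def lift[OF k(1) wy] hom_iff)
      also have "\<dots> = a w y" using k(2) wy af by simp
      finally show "app (k \<cdot> w) y = a w y" .
    qed
  next
    fix k k' assume "elts ?K ?K k k' \<and> (\<forall>w y. elts (Dom E k) T w y \<longrightarrow> app (k \<cdot> w) y = app (k' \<cdot> w) y)"
    then have [simp]: "k \<in> Arr E" "k' \<in> Arr E" "Dom E k = Dom E k'" "Cod E k = ?K" "Cod E k' = ?K"
      and e: "\<And>w y. elts (Dom E k') T w y \<Longrightarrow> app (k \<cdot> w) y = app (k' \<cdot> w) y" by simp_all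
    let ?Z = "Dom E k'"
    have "FAr (prod_functor E T) x = lift E (prod_fst E ?K T) (prod_snd E ?K T) (x \<cdot> prod_fst E ?Z T) (prod_snd E ?Z T)"
      if "x \<in> hom E ?Z ?K" for x using that by (simp add: prod_functor_def hom_iff)
    then have "?e \<cdot> FAr (prod_functor E T) x = app (x \<cdot> prod_fst E ?Z T) (prod_snd E ?Z T)" if "x \<in> hom E ?Z ?K" for x
      using that by (simp add: app_def)
    then have "?e \<cdot> FAr (prod_functor E T) k = ?e \<cdot> FAr (prod_functor E T) k'"
      using e[of "prod_fst E ?Z T" "prod_snd E ?Z T"] by (simp add: hom_iff)
    then show "k = k'" by - (rule F.universal_unique[OF U], simp_all)
  qed (simp_all add: fam)
  then show thesis by (rule that)
qed

text \<open>\<open>j\<close> is the subobject of \<open>K\<close> described by the predicate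
  \<open>S\<close> on generalized elements.\<close>

definition represents :: "'o \<Rightarrow> ('a \<Rightarrow> bool) \<Rightarrow> 'o \<Rightarrow> 'a \<Rightarrow> bool" where
  "represents K S K' j \<longleftrightarrow> j \<in> hom E K' K \<and>
     (\<forall>x y. elts K' K' x y \<and> j \<cdot> x = j \<cdot> y \<longrightarrow> x = y) \<and>
     (\<forall>k. k \<in> Arr E \<and> Cod E k = K \<longrightarrow> (S k \<longleftrightarrow> (\<exists>k' \<in> hom E (Dom E k) K'. k = j \<cdot> k')))"

lemma represents_all:
  assumes [simp]: "K \<in> Obj E"
  shows "represents K (\<lambda>k. True) K (Idt E K)"
proof -
  have "\<exists>k' \<in> hom E (Dom E k) K. k = Idt E K \<cdot> k'" if "k \<in> Arr E" "Cod E k = K" for k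
    using that by (intro bexI[of _ k]) (simp_all add: hom_iff)
  then show ?thesis by (simp add: represents_def hom_iff) (metis idt_comp)
qed

lemma representsD:
  assumes "represents K S K' j"
  shows "j \<in> Arr E" "Dom E j = K'" "Cod E j = K" "K' \<in> Obj E"
    "\<lbrakk>x \<in> Arr E; Cod E x = K'\<rbrakk> \<Longrightarrow> S (j \<cdot> x)"
    "\<lbrakk>k \<in> Arr E; Cod E k = K; S k\<rbrakk> \<Longrightarrow> \<exists>k' \<in> hom E (Dom E k) K'. k = j \<cdot> k'"
    "\<lbrakk>elts K' K' x y; j \<cdot> x = j \<cdot> y\<rbrakk> \<Longrightarrow> x = y"
proof -
  show j: "j \<in> Arr E" "Dom E j = K'" "Cod E j = K" using assms by (simp_all add: represents_def hom_iff)
  from dom_obj[OF j(1)] j(2) show "K' \<in> Obj E" by simp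
  show "S (j \<cdot> x)" if "x \<in> Arr E" "Cod E x = K'"
  proof -
    have "j \<cdot> x \<in> Arr E" "Cod E (j \<cdot> x) = K" "x \<in> hom E (Dom E (j \<cdot> x)) K'"
      using that j by (simp_all add: hom_iff)
    with assms show ?thesis unfolding represents_def by blast
  qed
  show "\<lbrakk>k \<in> Arr E; Cod E k = K; S k\<rbrakk> \<Longrightarrow> \<exists>k' \<in> hom E (Dom E k) K'. k = j \<cdot> k'"
    using assms unfolding represents_def by blast
  show "\<lbrakk>elts K' K' x y; j \<cdot> x = j \<cdot> y\<rbrakk> \<Longrightarrow> x = y"
    using assms unfolding represents_def by blast
qed

text \<open>An equation between two natural families cuts out the equalizer of their transposes.\<close>

lemma represents_refine:
  assumes R: "represents K S K' j" and T: "T \<in> Obj E" "W \<in> Obj E"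
    and u: "nat_family K' T W (\<lambda>k. u (j \<cdot> k))" and v: "nat_family K' T W (\<lambda>k. v (j \<cdot> k))"
  obtains K'' j' where
    "represents K (\<lambda>k. S k \<and> (\<forall>w y. elts (Dom E k) T w y \<longrightarrow> u (k \<cdot> w) y = v (k \<cdot> w) y)) K'' j'"
proof -
  note [simp] = representsD(1-4)[OF R]
  \<comment> \<open>The families are taken along \<open>j\<close>, hence only on elements satisfying
    \<open>S\<close>: terms with \<open>icmp\<close> are natural only where earlier equations have
    made their arguments composable.\<close>
  obtain X app where X: "exponent T W X app" by (rule exponent_exists[OF T])
  obtain u' where u': "u' \<in> hom E K' X" "\<And>w y. elts K' T w y \<Longrightarrow> app (u' \<cdot> w) y = u (j \<cdot> w) y"
    by (rule exponent_ex[OF X representsD(4)[OF R] u]) blast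
  obtain v' where v': "v' \<in> hom E K' X" "\<And>w y. elts K' T w y \<Longrightarrow> app (v' \<cdot> w) y = v (j \<cdot> w) y"
    by (rule exponent_ex[OF X representsD(4)[OF R] v]) blast
  have [simp]: "u' \<in> Arr E" "Dom E u' = K'" "Cod E u' = X" "v' \<in> Arr E" "Dom E v' = K'" "Cod E v' = X"
    using u' v' by (simp_all add: hom_iff)
  obtain K'' i where i: "i \<in> hom E K'' (Dom E u')"
    "\<And>x y. \<lbrakk>x \<in> Arr E; y \<in> Arr E; Dom E x = Dom E y; Cod E x = K''; Cod E y = K''; i \<cdot> x = i \<cdot> y\<rbrakk> \<Longrightarrow> x = y"
    "\<And>x. \<lbrakk>x \<in> Arr E; Cod E x = Dom E u'\<rbrakk> \<Longrightarrow> u' \<cdot> x = v' \<cdot> x \<longleftrightarrow> (\<exists>y \<in> hom E (Dom E x) K''. x = i \<cdot> y)"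
    by (rule equalizer_exists[of u' v']) auto
  have [simp]: "i \<in> Arr E" "Dom E i = K''" "Cod E i = K'" using i(1) by (simp_all add: hom_iff)
  let ?S = "\<lambda>k. S k \<and> (\<forall>w y. elts (Dom E k) T w y \<longrightarrow> u (k \<cdot> w) y = v (k \<cdot> w) y)"
  \<comment> \<open>Equality of the transposes at \<open>x\<close> means the equation at all later
    stages, which is why the refined predicate quantifies over \<open>w\<close>.\<close>
  have eq: "u' \<cdot> x = v' \<cdot> x \<longleftrightarrow> (\<forall>w y. elts (Dom E x) T w y \<longrightarrow> u (j \<cdot> (x \<cdot> w)) y = v (j \<cdot> (x \<cdot> w)) y)"
    if [simp]: "x \<in> Arr E" "Cod E x = K'" for x
  proof
    assume e: "u' \<cdot> x = v' \<cdot> x"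
    show "\<forall>w y. elts (Dom E x) T w y \<longrightarrow> u (j \<cdot> (x \<cdot> w)) y = v (j \<cdot> (x \<cdot> w)) y"
      using u'(2) v'(2) comp_ext[OF e] by (auto simp flip: u'(2) v'(2))
  next
    assume e: "\<forall>w y. elts (Dom E x) T w y \<longrightarrow> u (j \<cdot> (x \<cdot> w)) y = v (j \<cdot> (x \<cdot> w)) y"
    show "u' \<cdot> x = v' \<cdot> x"
      by (rule exponent_ext[OF X]) (use e in \<open>simp_all add: u' v'\<close>)
  qed
  have "represents K ?S K'' (j \<cdot> i)"
    unfolding represents_def
  proof (intro conjI allI impI)
    show "j \<cdot> i \<in> hom E K'' K" by (simp add: hom_iff)
    fix x y assume "elts K'' K'' x y \<and> (j \<cdot> i) \<cdot> x = (j \<cdot> i) \<cdot> y"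
    then have "elts K'' K'' x y" "(j \<cdot> i) \<cdot> x = (j \<cdot> i) \<cdot> y" by simp_all
    then show "x = y" using representsD(7)[OF R, of "i \<cdot> x" "i \<cdot> y"] i(2)[of x y] by simp
  next
    fix k assume "k \<in> Arr E \<and> Cod E k = K"
    then have [simp]: "k \<in> Arr E" "Cod E k = K" by simp_all
    show "?S k \<longleftrightarrow> (\<exists>k' \<in> hom E (Dom E k) K''. k = (j \<cdot> i) \<cdot> k')"
    proof
      assume S: "?S k"
      then obtain x where x: "x \<in> hom E (Dom E k) K'" "k = j \<cdot> x" using representsD(6)[OF R, of k] by auto
      from x(1) have [simp]: "x \<in> Arr E" "Dom E k = Dom E x" "Cod E x = K'" by (simp_all add: hom_iff)
      have "u' \<cdot> x = v' \<cdot> x" using S by (simp add: eq) (simp add: x(2))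
      then obtain y where y: "y \<in> hom E (Dom E x) K''" "x = i \<cdot> y" using i(3)[of x] by auto
      have "y \<in> Arr E" "Cod E y = K''" using y(1) by (simp_all add: hom_iff)
      then have "k = (j \<cdot> i) \<cdot> y" using x(2) y(2) by simp
      moreover have "y \<in> hom E (Dom E k) K''" using y(1) by simp
      ultimately show "\<exists>k' \<in> hom E (Dom E k) K''. k = (j \<cdot> i) \<cdot> k'" by blast
    next
      assume "\<exists>k' \<in> hom E (Dom E k) K''. k = (j \<cdot> i) \<cdot> k'"
      then obtain z where z: "z \<in> hom E (Dom E k) K''" "k = (j \<cdot> i) \<cdot> z" by blast
      from z(1) have [simp]: "z \<in> Arr E" "Cod E z = K''" and dk: "Dom E k = Dom E z" by (simp_all add: hom_iff)
      have kz: "k = j \<cdot> (i \<cdot> z)" using z(2) by simp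
      have "\<exists>y \<in> hom E (Dom E (i \<cdot> z)) K''. i \<cdot> z = i \<cdot> y" by (intro bexI[of _ z]) (simp_all add: hom_iff)
      then have "u' \<cdot> (i \<cdot> z) = v' \<cdot> (i \<cdot> z)" using i(3)[of "i \<cdot> z"] by simp
      then show "?S k" using eq[of "i \<cdot> z"] representsD(5)[OF R, of "i \<cdot> z"] unfolding dk kz by simp
    qed
  qed
  then show thesis by (rule that)
qed

text \<open>\<open>S1\<close> to \<open>S4\<close> are the functor laws for source, target,
  identities and composition. \<open>S4\<close> comes last because its right side composes arrows
  that are composable only by \<open>S1\<close> and \<open>S2\<close>.\<close>

lemma funs_representable:
  assumes B [simp]: "is_icat E B" and Y [simp]: "is_icat E Y"
  obtains H A M where "funs_represented E B Y H A M"
proof -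
  obtain K1 ap1 where K1: "exponent (IOb B) (IOb Y) K1 ap1" by (rule exponent_exists[of "IOb B" "IOb Y"]) simp_all
  obtain K2 ap2 where K2: "exponent (IAr B) (IAr Y) K2 ap2" by (rule exponent_exists[of "IAr B" "IAr Y"]) simp_all
  have [simp]: "K1 \<in> Obj E" "K2 \<in> Obj E" using K1 K2 by (simp_all add: exponent_def)
  have fam: "nat_family K1 (IOb B) (IOb Y) ap1" "nat_family K2 (IAr B) (IAr Y) ap2"
    using K1 K2 by (simp_all add: exponent_def)
  let ?K = "prod_ob E K1 K2" and ?p = "prod_fst E K1 K2" and ?q = "prod_snd E K1 K2"
  define a m where "a = (\<lambda>k y. ap1 (?p \<cdot> k) y)" "m = (\<lambda>k f. ap2 (?q \<cdot> k) f)"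
  note am = this
  have a [simp]: "a k y \<in> Arr E" "Dom E (a k y) = Dom E y" "Cod E (a k y) = IOb Y"
    "\<lbrakk>w \<in> Arr E; Cod E w = Dom E y\<rbrakk> \<Longrightarrow> a k y \<cdot> w = a (k \<cdot> w) (y \<cdot> w)"
    if "k \<in> Arr E" "y \<in> Arr E" "Dom E k = Dom E y" "Cod E k = ?K" "Cod E y = IOb B" for k y w
    using nat_familyD[OF fam(1), of "?p \<cdot> k" y] that by (simp_all add: am)
  have m [simp]: "m k y \<in> Arr E" "Dom E (m k y) = Dom E y" "Cod E (m k y) = IAr Y"
    "\<lbrakk>w \<in> Arr E; Cod E w = Dom E y\<rbrakk> \<Longrightarrow> m k y \<cdot> w = m (k \<cdot> w) (y \<cdot> w)"
    if "k \<in> Arr E" "y \<in> Arr E" "Dom E k = Dom E y" "Cod E k = ?K" "Cod E y = IAr B" for k y w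
    using nat_familyD[OF fam(2), of "?q \<cdot> k" y] that by (simp_all add: am)
  define S1 where "S1 k \<longleftrightarrow> (\<forall>w f. elts (Dom E k) (IAr B) w f \<longrightarrow> Src Y \<cdot> m (k \<cdot> w) f = a (k \<cdot> w) (Src B \<cdot> f))" for k
  define S2 where "S2 k \<longleftrightarrow> (\<forall>w f. elts (Dom E k) (IAr B) w f \<longrightarrow> Tgt Y \<cdot> m (k \<cdot> w) f = a (k \<cdot> w) (Tgt B \<cdot> f))" for k
  define S3 where "S3 k \<longleftrightarrow> (\<forall>w y. elts (Dom E k) (IOb B) w y \<longrightarrow> m (k \<cdot> w) (Idn B \<cdot> y) = Idn Y \<cdot> a (k \<cdot> w) y)" for k
  \<comment> \<open>A composable pair is encoded as one element \<open>z\<close> of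
    \<open>cpair_ob E B\<close>, since \<open>represents_refine\<close> compares families in a
    single parameter.\<close>
  define S4 where "S4 k \<longleftrightarrow> (\<forall>w z. elts (Dom E k) (cpair_ob E B) w z \<longrightarrow> m (k \<cdot> w) (Cmp B \<cdot> z) =
    icmp E Y (m (k \<cdot> w) (cpair_fst E B \<cdot> z)) (m (k \<cdot> w) (cpair_snd E B \<cdot> z)))" for k
  have R0: "represents ?K (\<lambda>k. True) ?K (Idt E ?K)" by (rule represents_all) simp
  obtain L1 j1 where R1: "represents ?K (\<lambda>k. True \<and> S1 k) L1 j1"
    unfolding S1_def
    by (rule represents_refine[OF R0, of "IAr B" "IOb Y" "\<lambda>k f. Src Y \<cdot> m k f" "\<lambda>k f. a k (Src B \<cdot> f)"])
      (simp_all add: nat_family_def)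
  note [simp] = representsD(1-4)[OF R1]
  obtain L2 j2 where R2: "represents ?K (\<lambda>k. (True \<and> S1 k) \<and> S2 k) L2 j2"
    unfolding S2_def
    by (rule represents_refine[OF R1, of "IAr B" "IOb Y" "\<lambda>k f. Tgt Y \<cdot> m k f" "\<lambda>k f. a k (Tgt B \<cdot> f)"])
      (simp_all add: nat_family_def)
  note [simp] = representsD(1-4)[OF R2]
  obtain L3 j3 where R3: "represents ?K (\<lambda>k. ((True \<and> S1 k) \<and> S2 k) \<and> S3 k) L3 j3"
    unfolding S3_def
    by (rule represents_refine[OF R2, of "IOb B" "IAr Y" "\<lambda>k y. m k (Idn B \<cdot> y)" "\<lambda>k y. Idn Y \<cdot> a k y"])
      (simp_all add: nat_family_def)
  note [simp] = representsD(1-4)[OF R3]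
  \<comment> \<open>Taking \<open>w\<close> to be an identity extracts the equation at the current
    stage.\<close>
  have st: "Src Y \<cdot> m k f = a k (Src B \<cdot> f)" if "S1 k" "k \<in> Arr E" "elts (Dom E k) (IAr B) (Idt E (Dom E k)) f" for k f
    using that(1)[unfolded S1_def, rule_format, OF that(3)] that(2) by simp
  have tt: "Tgt Y \<cdot> m k f = a k (Tgt B \<cdot> f)" if "S2 k" "k \<in> Arr E" "elts (Dom E k) (IAr B) (Idt E (Dom E k)) f" for k f
    using that(1)[unfolded S2_def, rule_format, OF that(3)] that(2) by simp
  \<comment> \<open>These equations on \<open>L3\<close> supply the composability that makes the
    right side of \<open>S4\<close> a natural family.\<close>
  have st3: "Src Y \<cdot> m (j3 \<cdot> x) f = a (j3 \<cdot> x) (Src B \<cdot> f)" "Tgt Y \<cdot> m (j3 \<cdot> x) f = a (j3 \<cdot> x) (Tgt B \<cdot> f)"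
    if "x \<in> Arr E" "Cod E x = L3" "f \<in> Arr E" "Dom E x = Dom E f" "Cod E f = IAr B" for x f
    using that representsD(5)[OF R3, of x] by (simp_all add: st tt)
  obtain H j where R: "represents ?K (\<lambda>k. (((True \<and> S1 k) \<and> S2 k) \<and> S3 k) \<and> S4 k) H j"
    unfolding S4_def
    by (rule represents_refine[OF R3, of "cpair_ob E B" "IAr Y" "\<lambda>k z. m k (Cmp B \<cdot> z)"
          "\<lambda>k z. icmp E Y (m k (cpair_fst E B \<cdot> z)) (m k (cpair_snd E B \<cdot> z))"])
      (simp_all add: nat_family_def st3)
  note [simp] = representsD(1-4)[OF R]
  have S: "S1 (j \<cdot> x)" "S2 (j \<cdot> x)" "S3 (j \<cdot> x)" "S4 (j \<cdot> x)" if "x \<in> Arr E" "Cod E x = H" for x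
    using representsD(5)[OF R that] by simp_all
  let ?A = "\<lambda>h y. a (j \<cdot> h) y" and ?M = "\<lambda>h f. m (j \<cdot> h) f"
  have 1: "H \<in> Obj E" by simp
  have 2: "fun_family B Y H ?A ?M"
    unfolding fun_family_def
  proof (intro conjI allI impI)
    show "nat_family H (IOb B) (IOb Y) ?A" "nat_family H (IAr B) (IAr Y) ?M" by (simp_all add: nat_family_def)
    fix w f assume "elts H (IAr B) w f"
    then show "Src Y \<cdot> m (j \<cdot> w) f = a (j \<cdot> w) (Src B \<cdot> f)" "Tgt Y \<cdot> m (j \<cdot> w) f = a (j \<cdot> w) (Tgt B \<cdot> f)"
      using S(1,2)[of w] by (simp_all add: st tt)
  next
    fix w y assume "elts H (IOb B) w y"
    then show "m (j \<cdot> w) (Idn B \<cdot> y) = Idn Y \<cdot> a (j \<cdot> w) y"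
      using S(3)[of w, unfolded S3_def, rule_format, of "Idt E (Dom E y)" y] by simp
  next
    fix w g f assume gf: "elts H (IAr B) w g \<and> elts H (IAr B) w f \<and> Src B \<cdot> g = Tgt B \<cdot> f"
    then have "composable B g f" by (auto simp: composable_def)
    note c = cpair_lift[OF B this]
    have "elts H (IAr B) w g" "elts H (IAr B) w f" using gf by blast+
    then show "m (j \<cdot> w) (icmp E B g f) = icmp E Y (m (j \<cdot> w) g) (m (j \<cdot> w) f)"
      using c S(4)[of w, unfolded S4_def, rule_format, of "Idt E (Dom E f)" "cpair E B g f"]
      by (simp add: icmp_def[of E B])
  qed
  have 3: "\<exists>h \<in> hom E Z H. (\<forall>w y. elts Z (IOb B) w y \<longrightarrow> a (j \<cdot> (h \<cdot> w)) y = a' w y) \<and>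
      (\<forall>w f. elts Z (IAr B) w f \<longrightarrow> m (j \<cdot> (h \<cdot> w)) f = m' w f)"
    if Z: "Z \<in> Obj E" and F: "fun_family B Y Z a' m'" for Z a' m'
  proof -
    obtain k1 where k1: "k1 \<in> hom E Z K1" "\<And>w y. elts Z (IOb B) w y \<Longrightarrow> ap1 (k1 \<cdot> w) y = a' w y"
      by (rule exponent_ex[OF K1 Z]) (use F in \<open>auto simp: fun_family_def\<close>)
    obtain k2 where k2: "k2 \<in> hom E Z K2" "\<And>w y. elts Z (IAr B) w y \<Longrightarrow> ap2 (k2 \<cdot> w) y = m' w y"
      by (rule exponent_ex[OF K2 Z]) (use F in \<open>auto simp: fun_family_def\<close>)
    have [simp]: "k1 \<in> Arr E" "Dom E k1 = Z" "Cod E k1 = K1" "k2 \<in> Arr E" "Dom E k2 = Z" "Cod E k2 = K2"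
      using k1 k2 by (simp_all add: hom_iff)
    let ?k = "lift E ?p ?q k1 k2"
    have am': "\<And>w y. elts Z (IOb B) w y \<Longrightarrow> a (?k \<cdot> w) y = a' w y" "\<And>w f. elts Z (IAr B) w f \<Longrightarrow> m (?k \<cdot> w) f = m' w f"
      by (simp_all add: am k1 k2)
    note [simp] = fun_family_ob[OF F] fun_family_ar[OF F]
    have "(((True \<and> S1 ?k) \<and> S2 ?k) \<and> S3 ?k) \<and> S4 ?k"
      by (simp add: S1_def S2_def S3_def S4_def am' Cmp_comp)
    from representsD(6)[OF R _ _ this] obtain h where h: "h \<in> hom E Z H" "?k = j \<cdot> h" by auto
    then have "j \<cdot> (h \<cdot> w) = ?k \<cdot> w" if "w \<in> Arr E" "Cod E w = Z" for w
      using that by (simp add: hom_iff)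
    with h(1) am' show ?thesis by (intro bexI[of _ h]) simp_all
  qed
  have 4: "h = h'"
    if [simp]: "h \<in> Arr E" "h' \<in> Arr E" "Dom E h' = Dom E h" "Cod E h = H" "Cod E h' = H"
      and e: "\<And>w y. elts (Dom E h) (IOb B) w y \<Longrightarrow> a (j \<cdot> (h \<cdot> w)) y = a (j \<cdot> (h' \<cdot> w)) y"
        "\<And>w f. elts (Dom E h) (IAr B) w f \<Longrightarrow> m (j \<cdot> (h \<cdot> w)) f = m (j \<cdot> (h' \<cdot> w)) f" for h h'
  proof -
    have "?p \<cdot> (j \<cdot> h) = ?p \<cdot> (j \<cdot> h')"
      by (rule exponent_ext[OF K1]) (use e(1) in \<open>simp_all add: am\<close>)
    moreover have "?q \<cdot> (j \<cdot> h) = ?q \<cdot> (j \<cdot> h')"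
      by (rule exponent_ext[OF K2]) (use e(2) in \<open>simp_all add: am\<close>)
    ultimately have "j \<cdot> h = j \<cdot> h'" by - (rule prod_eqI[of K1 K2], simp_all)
    then show "h = h'" using representsD(7)[OF R, of h h'] by simp
  qed
  have "funs_represented E B Y H ?A ?M"
    by unfold_locales (use 1 2 3 4 in simp_all)
  then show thesis by (rule that)
qed

text \<open>The ambient object \<open>(H \<times> H) \<times> K3\<close> holds the two end functors,
  read off by \<open>s\<close> and \<open>t\<close>, and a family of components. \<open>S1\<close>
  and \<open>S2\<close> fix the ends of the components; naturality, \<open>S3\<close>, follows
  because its composites presuppose them.\<close>

lemma trans_representable:
  assumes "funs_represented E B Y H A M"
  obtains H1 C \<sigma> \<tau> where "iexp E B Y H A M H1 C \<sigma> \<tau>"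
proof -
  interpret funs_represented E B Y H A M by fact
  obtain K3 ap where K3: "exponent (IOb B) (IAr Y) K3 ap" by (rule exponent_exists[of "IOb B" "IAr Y"]) simp_all
  have [simp]: "K3 \<in> Obj E" using K3 by (simp add: exponent_def)
  have fam: "nat_family K3 (IOb B) (IAr Y) ap" using K3 by (simp add: exponent_def)
  let ?HH = "prod_ob E H H"
  let ?K = "prod_ob E ?HH K3" and ?q = "prod_snd E ?HH K3"
  define s t where "s = prod_fst E H H \<cdot> prod_fst E ?HH K3" "t = prod_snd E H H \<cdot> prod_fst E ?HH K3"
  note st_def = this
  define c where "c = (\<lambda>k y. ap (?q \<cdot> k) y)"
  have s [simp]: "s \<in> Arr E" "Dom E s = ?K" "Cod E s = H" "t \<in> Arr E" "Dom E t = ?K" "Cod E t = H"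
    by (simp_all add: st_def)
  have K_eqI: "k = k'" if "elts ?K ?K k k'" "s \<cdot> k = s \<cdot> k'" "t \<cdot> k = t \<cdot> k'" "?q \<cdot> k = ?q \<cdot> k'" for k k'
  proof -
    have "prod_fst E ?HH K3 \<cdot> k = prod_fst E ?HH K3 \<cdot> k'"
      using that by - (rule prod_eqI[of H H], simp_all add: st_def)
    then show ?thesis using that by - (rule prod_eqI[of ?HH K3], simp_all)
  qed
  have c [simp]: "c k y \<in> Arr E" "Dom E (c k y) = Dom E y" "Cod E (c k y) = IAr Y"
    "\<lbrakk>w \<in> Arr E; Cod E w = Dom E y\<rbrakk> \<Longrightarrow> c k y \<cdot> w = c (k \<cdot> w) (y \<cdot> w)"
    if "k \<in> Arr E" "y \<in> Arr E" "Dom E k = Dom E y" "Cod E k = ?K" "Cod E y = IOb B" for k y w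
    using nat_familyD[OF fam, of "?q \<cdot> k" y] that by (simp_all add: c_def)
  define S1 where "S1 k \<longleftrightarrow> (\<forall>w y. elts (Dom E k) (IOb B) w y \<longrightarrow> Src Y \<cdot> c (k \<cdot> w) y = A (s \<cdot> (k \<cdot> w)) y)" for k
  define S2 where "S2 k \<longleftrightarrow> (\<forall>w y. elts (Dom E k) (IOb B) w y \<longrightarrow> Tgt Y \<cdot> c (k \<cdot> w) y = A (t \<cdot> (k \<cdot> w)) y)" for k
  define S3 where "S3 k \<longleftrightarrow> (\<forall>w f. elts (Dom E k) (IAr B) w f \<longrightarrow>
    icmp E Y (M (t \<cdot> (k \<cdot> w)) f) (c (k \<cdot> w) (Src B \<cdot> f)) = icmp E Y (c (k \<cdot> w) (Tgt B \<cdot> f)) (M (s \<cdot> (k \<cdot> w)) f))" for k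
  have R0: "represents ?K (\<lambda>k. True) ?K (Idt E ?K)" by (rule represents_all) simp
  obtain L1 j1 where R1: "represents ?K (\<lambda>k. True \<and> S1 k) L1 j1"
    unfolding S1_def
    by (rule represents_refine[OF R0, of "IOb B" "IOb Y" "\<lambda>k y. Src Y \<cdot> c k y" "\<lambda>k y. A (s \<cdot> k) y"])
      (simp_all add: nat_family_def)
  note [simp] = representsD(1-4)[OF R1]
  obtain L2 j2 where R2: "represents ?K (\<lambda>k. (True \<and> S1 k) \<and> S2 k) L2 j2"
    unfolding S2_def
    by (rule represents_refine[OF R1, of "IOb B" "IOb Y" "\<lambda>k y. Tgt Y \<cdot> c k y" "\<lambda>k y. A (t \<cdot> k) y"])
      (simp_all add: nat_family_def)
  note [simp] = representsD(1-4)[OF R2]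
  have st: "Src Y \<cdot> c k y = A (s \<cdot> k) y" if "S1 k" "k \<in> Arr E" "elts (Dom E k) (IOb B) (Idt E (Dom E k)) y" for k y
    using that(1)[unfolded S1_def, rule_format, OF that(3)] that(2) by simp
  have tt: "Tgt Y \<cdot> c k y = A (t \<cdot> k) y" if "S2 k" "k \<in> Arr E" "elts (Dom E k) (IOb B) (Idt E (Dom E k)) y" for k y
    using that(1)[unfolded S2_def, rule_format, OF that(3)] that(2) by simp
  have st2: "Src Y \<cdot> c (j2 \<cdot> x) y = A (s \<cdot> (j2 \<cdot> x)) y" "Tgt Y \<cdot> c (j2 \<cdot> x) y = A (t \<cdot> (j2 \<cdot> x)) y"
    if "x \<in> Arr E" "Cod E x = L2" "y \<in> Arr E" "Dom E x = Dom E y" "Cod E y = IOb B" for x y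
    using that representsD(5)[OF R2, of x] by (simp_all add: st tt)
  obtain H1 j where R: "represents ?K (\<lambda>k. ((True \<and> S1 k) \<and> S2 k) \<and> S3 k) H1 j"
    unfolding S3_def
    by (rule represents_refine[OF R2, of "IAr B" "IAr Y" "\<lambda>k f. icmp E Y (M (t \<cdot> k) f) (c k (Src B \<cdot> f))"
          "\<lambda>k f. icmp E Y (c k (Tgt B \<cdot> f)) (M (s \<cdot> k) f)"])
      (simp_all add: nat_family_def st2)
  note [simp] = representsD(1-4)[OF R]
  have S: "S1 (j \<cdot> x)" "S2 (j \<cdot> x)" "S3 (j \<cdot> x)" if "x \<in> Arr E" "Cod E x = H1" for x
    using representsD(5)[OF R that] by simp_all
  let ?s = "s \<cdot> j" and ?t = "t \<cdot> j" and ?C = "\<lambda>n y. c (j \<cdot> n) y"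
  have 1: "?s \<in> hom E H1 H" "?t \<in> hom E H1 H" by (simp_all add: hom_iff)
  have 2: "trans_family B Y H1 (\<lambda>w. A (?s \<cdot> w)) (\<lambda>w. M (?s \<cdot> w)) (\<lambda>w. A (?t \<cdot> w)) (\<lambda>w. M (?t \<cdot> w)) ?C"
    unfolding trans_family_def
  proof (intro conjI allI impI)
    show "nat_family H1 (IOb B) (IAr Y) ?C" by (simp add: nat_family_def)
    fix w y assume "elts H1 (IOb B) w y"
    then show "Src Y \<cdot> c (j \<cdot> w) y = A (?s \<cdot> w) y" "Tgt Y \<cdot> c (j \<cdot> w) y = A (?t \<cdot> w) y"
      using S(1,2)[of w] by (simp_all add: st tt)
  next
    fix w f assume "elts H1 (IAr B) w f"
    then show "icmp E Y (M (?t \<cdot> w) f) (?C w (Src B \<cdot> f)) = icmp E Y (?C w (Tgt B \<cdot> f)) (M (?s \<cdot> w) f)"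
      using S(3)[of w, unfolded S3_def, rule_format, of "Idt E (Dom E f)" f] by simp
  qed
  have 3: "\<exists>n \<in> hom E Z H1. ?s \<cdot> n = h \<and> ?t \<cdot> n = h' \<and> (\<forall>w y. elts Z (IOb B) w y \<longrightarrow> ?C (n \<cdot> w) y = c' w y)"
    if h: "h \<in> hom E Z H" "h' \<in> hom E Z H"
      and c': "trans_family B Y Z (\<lambda>w. A (h \<cdot> w)) (\<lambda>w. M (h \<cdot> w)) (\<lambda>w. A (h' \<cdot> w)) (\<lambda>w. M (h' \<cdot> w)) c'" for Z h h' c'
  proof -
    have [simp]: "h \<in> Arr E" "Dom E h = Z" "Cod E h = H" "h' \<in> Arr E" "Dom E h' = Z" "Cod E h' = H"
      using h by (simp_all add: hom_iff)
    have [simp]: "Z \<in> Obj E" using dom_obj[of h] by simp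
    obtain k3 where k3: "k3 \<in> hom E Z K3" "\<And>w y. elts Z (IOb B) w y \<Longrightarrow> ap (k3 \<cdot> w) y = c' w y"
      by (rule exponent_ex[OF K3 \<open>Z \<in> Obj E\<close>]) (use c' in \<open>auto simp: trans_family_def\<close>)
    have [simp]: "k3 \<in> Arr E" "Dom E k3 = Z" "Cod E k3 = K3" using k3 by (simp_all add: hom_iff)
    let ?k = "lift E (prod_fst E ?HH K3) ?q (lift E (prod_fst E H H) (prod_snd E H H) h h') k3"
    have sk: "s \<cdot> ?k = h" "t \<cdot> ?k = h'" by (simp_all add: st_def)
    note [simp] = sk comp_ext[OF sk(1)] comp_ext[OF sk(2)]
    have ck: "c (?k \<cdot> w) y = c' w y" if "elts Z (IOb B) w y" for w y
      using that by (simp add: c_def k3)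
    have "((True \<and> S1 ?k) \<and> S2 ?k) \<and> S3 ?k"
      using c' by (simp add: S1_def S2_def S3_def ck trans_family_def)
    from representsD(6)[OF R _ _ this] obtain n where n: "n \<in> hom E Z H1" "?k = j \<cdot> n" by auto
    have [simp]: "n \<in> Arr E" "Dom E n = Z" "Cod E n = H1" using n by (simp_all add: hom_iff)
    have "j \<cdot> (n \<cdot> w) = ?k \<cdot> w" if "w \<in> Arr E" "Cod E w = Z" for w
      using that by (simp add: n(2))
    moreover have "s \<cdot> (j \<cdot> n) = h" "t \<cdot> (j \<cdot> n) = h'" unfolding n(2)[symmetric] by (rule sk)+
    ultimately show ?thesis using n(1) ck by (intro bexI[of _ n]) simp_all
  qed
  have 4: "n = n'"
    if [simp]: "n \<in> Arr E" "n' \<in> Arr E" "Dom E n' = Dom E n" "Cod E n = H1" "Cod E n' = H1"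
      and e: "?s \<cdot> n = ?s \<cdot> n'" "?t \<cdot> n = ?t \<cdot> n'"
        "\<And>w y. elts (Dom E n) (IOb B) w y \<Longrightarrow> c (j \<cdot> (n \<cdot> w)) y = c (j \<cdot> (n' \<cdot> w)) y" for n n'
  proof -
    have "?q \<cdot> (j \<cdot> n) = ?q \<cdot> (j \<cdot> n')"
      by (rule exponent_ext[OF K3]) (use e(3) in \<open>simp_all add: c_def\<close>)
    then have "j \<cdot> n = j \<cdot> n'" using e by - (rule K_eqI, simp_all)
    then show "n = n'" using representsD(7)[OF R, of n n'] by simp
  qed
  have "iexp E B Y H A M H1 ?C ?s ?t"
    by unfold_locales (use 1 2 3 4 in simp_all)
  then show thesis by (rule that)
qed

text \<open>The exponential is built for each pair \<open>B\<close>, \<open>Y\<close> separately; a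
  choice of these 2-universal arrows for all \<open>Y\<close> is what
  \<open>two_universal_arrows\<close> turns into a right 2-adjoint.\<close>

lemma Cat2_closed: "two_cartesian_closed (Cat2 E)"
  unfolding two_cartesian_closed_def
proof (intro conjI ballI)
  show "two_category (Cat2 E)" by (rule two_category_Cat2)
  show "\<exists>T. is_2terminal (Cat2 E) T" using terminal_exists disc_terminal_2terminal by blast
  fix B assume "B \<in> Obj (Und (Cat2 E))"
  then have B: "is_icat E B" by simp
  {
    fix A assume "A \<in> Obj (Und (Cat2 E))"
    then have "is_2product (Cat2 E) A B (prod_icat A B) (prod_icat_fst A B) (prod_icat_snd A B)"
      using product_is_2product[OF prod_icat_is_product] B by simp
    then show "\<exists>P p q. is_2product (Cat2 E) A B P p q" by blast
  }
  have "\<exists>H e. is_2universal (Cat2 E) (Cat2 E) (prod_2functor (Cat2 E) B) Y H e" if Y: "is_icat E Y" for Y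
  proof -
    obtain H A M where "funs_represented E B Y H A M" by (rule funs_representable[OF B Y])
    then obtain H1 C \<sigma> \<tau> where "iexp E B Y H A M H1 C \<sigma> \<tau>" by (rule trans_representable)
    from iexp.ev_2universal[OF this] show ?thesis by blast
  qed
  then obtain H e where "\<And>Y. is_icat E Y \<Longrightarrow> is_2universal (Cat2 E) (Cat2 E) (prod_2functor (Cat2 E) B) Y (H Y) (e Y)"
    by metis
  then interpret two_universal_arrows "Cat2 E" "Cat2 E" "prod_2functor (Cat2 E) B" H e
    by unfold_locales (simp_all add: two_category_Cat2 Cat2.is_2functor_prod B)
  show "\<exists>G \<eta> \<epsilon>. is_2adjunction (Cat2 E) (Cat2 E) (prod_2functor (Cat2 E) B) G \<eta> \<epsilon>"
    using is_2adjunction by blast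
qed

end

section \<open>Discrete categories and internal homs\<close>

context fincat
begin

lemma OnOb_FAr_prod:
  assumes u: "is_ifun E u" "IDom u = X" "ICod u = H" and D: "is_icat E D"
  shows "OnOb (FAr (prod_functor (Cat1 E) D) u) =
    lift E (OnOb (prod_fst (Cat1 E) H D)) (OnOb (prod_snd (Cat1 E) H D))
      (OnOb u \<cdot> OnOb (prod_fst (Cat1 E) X D)) (OnOb (prod_snd (Cat1 E) X D))"
proof -
  let ?Fu = "FAr (prod_functor (Cat1 E) D) u"
  have [simp]: "is_icat E X" "is_icat E H" using ifun_simps(1,2)[OF u(1)] u by simp_all
  note [simp] = u D
  show "OnOb ?Fu = lift E (OnOb (prod_fst (Cat1 E) H D)) (OnOb (prod_snd (Cat1 E) H D))
      (OnOb u \<cdot> OnOb (prod_fst (Cat1 E) X D)) (OnOb (prod_snd (Cat1 E) X D))"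
    by (rule product_eqI[OF prod_levelwise(1)[of H D]]) simp_all
qed

lemma ifun_into_disc_eqI:
  assumes "is_ifun E F" "is_ifun E G" "IDom F = IDom G" "ICod F = disc_ob E Y" "ICod G = disc_ob E Y" "OnOb F = OnOb G"
  shows "F = G"
  using assms ifun_into_disc(1)[of F Y "IDom F"] ifun_into_disc(1)[of G Y "IDom G"] by (intro ifun_eqI) simp_all

text \<open>The universal property of \<open>H\<close> is tested on discrete \<open>Z\<close>:
  functors \<open>disc Z \<rightarrow> H\<close> are arrows \<open>Z \<rightarrow> IOb H\<close>,
  and functors \<open>disc Z \<times> disc B \<rightarrow> disc Y\<close> are arrows
  \<open>Z \<times> B \<rightarrow> Y\<close>.\<close>

lemma universal_of_disc:
  assumes B [simp]: "B \<in> Obj E" and Y [simp]: "Y \<in> Obj E"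
    and U: "is_universal (Cat1 E) (Cat1 E) (prod_functor (Cat1 E) (disc_ob E B)) (disc_ob E Y) H \<epsilon>"
  defines "P \<equiv> prod_ob (Cat1 E) H (disc_ob E B)" and "p \<equiv> prod_fst (Cat1 E) H (disc_ob E B)"
    and "q \<equiv> prod_snd (Cat1 E) H (disc_ob E B)"
  shows "is_universal E E (prod_functor E B) Y (IOb H)
    (OnOb \<epsilon> \<cdot> lift E (OnOb p) (OnOb q) (prod_fst E (IOb H) B) (prod_snd E (IOb H) B))"
proof -
  interpret F: functor_loc "Cat1 E" "Cat1 E" "prod_functor (Cat1 E) (disc_ob E B)"
    by unfold_locales (simp add: Cat.is_functor_prod)
  have H [simp]: "is_icat E H" and \<epsilon> [simp]: "is_ifun E \<epsilon>" "IDom \<epsilon> = P" "ICod \<epsilon> = disc_ob E Y"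
    using U by (simp_all add: is_universal_def hom_iff P_def)
  note pq [simp] = P_def p_def q_def
  let ?lP = "lift E (OnOb p) (OnOb q)"
  let ?e = "OnOb \<epsilon> \<cdot> ?lP (prod_fst E (IOb H) B) (prod_snd E (IOb H) B)"
  have main: "?e \<cdot> FAr (prod_functor E B) u = OnOb \<epsilon> \<cdot> ?lP (u \<cdot> prod_fst E Z B) (prod_snd E Z B)" if "u \<in> hom E Z (IOb H)" for u Z
    using that by (simp add: hom_iff)
  \<comment> \<open>The functor on the discrete category that corresponds to the element
    \<open>u\<close> of the objects of \<open>H\<close>.\<close>
  define up where "up = (\<lambda>Z u. \<lparr>IDom = disc_ob E Z, ICod = H, OnOb = u, OnAr = Idn H \<cdot> u\<rparr>)"
  have up [simp]: "is_ifun E (up Z u)" "IDom (up Z u) = disc_ob E Z" "ICod (up Z u) = H" "OnOb (up Z u) = u"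
    if "u \<in> hom E Z (IOb H)" for Z u
    using that by (simp_all add: up_def is_ifun_from_disc)
  have up_eq: "OnOb (\<epsilon> \<odot> FAr (prod_functor (Cat1 E) (disc_ob E B)) w) =
      OnOb \<epsilon> \<cdot> ?lP (OnOb w \<cdot> OnOb (prod_fst (Cat1 E) (disc_ob E Z) (disc_ob E B)))
        (OnOb (prod_snd (Cat1 E) (disc_ob E Z) (disc_ob E B)))"
    if "is_ifun E w" "IDom w = disc_ob E Z" "ICod w = H" for w Z
    using OnOb_FAr_prod(1)[OF that is_icat_disc[OF B]] that by simp
  show ?thesis
    unfolding is_universal_def
  proof (intro conjI ballI)
    show "IOb H \<in> Obj E" "?e \<in> hom E (FOb (prod_functor E B) (IOb H)) Y" by (simp_all add: hom_iff)
    fix Z f assume Z [simp]: "Z \<in> Obj E" and "f \<in> hom E (FOb (prod_functor E B) Z) Y"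
    then have f [simp]: "f \<in> Arr E" "Dom E f = prod_ob E Z B" "Cod E f = Y" by (simp_all add: hom_iff)
    let ?Q = "prod_ob (Cat1 E) (disc_ob E Z) (disc_ob E B)" and ?p = "prod_fst (Cat1 E) (disc_ob E Z) (disc_ob E B)"
      and ?q = "prod_snd (Cat1 E) (disc_ob E Z) (disc_ob E B)"
    let ?lQ = "lift E (OnOb ?p) (OnOb ?q)" and ?lE = "lift E (prod_fst E Z B) (prod_snd E Z B)"
    show "\<exists>!u. u \<in> hom E Z (IOb H) \<and> ?e \<cdot> FAr (prod_functor E B) u = f"
    proof (rule ex_ex1I)
      \<comment> \<open>\<open>?Q\<close> is a chosen product and need not be of the form
        \<open>disc_ob\<close>. Since its projections land in discrete categories, they coequalize
        its source and target, and so does \<open>f\<close> after the comparison.\<close>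
      have "OnOb ?p \<cdot> Src ?Q = OnOb ?p \<cdot> Tgt ?Q" "OnOb ?q \<cdot> Src ?Q = OnOb ?q \<cdot> Tgt ?Q"
        using ifun_into_disc[of ?p Z ?Q] ifun_into_disc[of ?q B ?Q] by simp_all
      then have "?lE (OnOb ?p) (OnOb ?q) \<cdot> Src ?Q = ?lE (OnOb ?p) (OnOb ?q) \<cdot> Tgt ?Q"
        by (simp add: pair_comp)
      then have st: "(f \<cdot> ?lE (OnOb ?p) (OnOb ?q)) \<cdot> Src ?Q = (f \<cdot> ?lE (OnOb ?p) (OnOb ?q)) \<cdot> Tgt ?Q" by simp
      let ?f = "f \<cdot> ?lE (OnOb ?p) (OnOb ?q)"
      let ?F = "\<lparr>IDom = ?Q, ICod = disc_ob E Y, OnOb = ?f, OnAr = ?f \<cdot> Src ?Q\<rparr>"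
      have "is_ifun E ?F" by (rule is_ifun_into_disc[OF _ _ st]) (simp_all add: hom_iff)
      then have "?F \<in> hom (Cat1 E) (FOb (prod_functor (Cat1 E) (disc_ob E B)) (disc_ob E Z)) (disc_ob E Y)"
        by (simp add: hom_iff)
      moreover have "disc_ob E Z \<in> Obj (Cat1 E)" by simp
      ultimately obtain w where w: "w \<in> hom (Cat1 E) (disc_ob E Z) H" "\<epsilon> \<odot> FAr (prod_functor (Cat1 E) (disc_ob E B)) w = ?F"
        using U unfolding is_universal_def by blast
      then have w' [simp]: "is_ifun E w" "IDom w = disc_ob E Z" "ICod w = H" by (simp_all add: hom_iff)
      have "OnOb \<epsilon> \<cdot> ?lP (OnOb w \<cdot> OnOb ?p) (OnOb ?q) = ?f"
        using up_eq[OF w'] w(2) by simp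
      \<comment> \<open>Precomposition with the comparison of the two products of \<open>Z\<close>
        and \<open>B\<close> passes from the one underlying \<open>?Q\<close> to the one chosen in
        \<open>E\<close>.\<close>
      from arg_cong[OF this, of "\<lambda>x. x \<cdot> ?lQ (prod_fst E Z B) (prod_snd E Z B)"]
      have "OnOb \<epsilon> \<cdot> ?lP (OnOb w \<cdot> prod_fst E Z B) (prod_snd E Z B) = f \<cdot> ?lE (prod_fst E Z B) (prod_snd E Z B)"
        by (simp add: pair_comp)
      moreover have "?lE (prod_fst E Z B) (prod_snd E Z B) = Idt E (prod_ob E Z B)"
        by (rule prod_eqI[of Z B]) simp_all
      ultimately have "?e \<cdot> FAr (prod_functor E B) (OnOb w) = f"
        using main[of "OnOb w" Z] by (simp add: hom_iff)
      then show "\<exists>u. u \<in> hom E Z (IOb H) \<and> ?e \<cdot> FAr (prod_functor E B) u = f"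
        by (intro exI[of _ "OnOb w"]) (simp add: hom_iff)
    next
      fix u v assume u: "u \<in> hom E Z (IOb H) \<and> ?e \<cdot> FAr (prod_functor E B) u = f"
        and v: "v \<in> hom E Z (IOb H) \<and> ?e \<cdot> FAr (prod_functor E B) v = f"
      then have uv [simp]: "u \<in> hom E Z (IOb H)" "v \<in> hom E Z (IOb H)" by simp_all
      then have uv' [simp]: "u \<in> Arr E" "Dom E u = Z" "Cod E u = IOb H" "v \<in> Arr E" "Dom E v = Z" "Cod E v = IOb H"
        by (simp_all add: hom_iff)
      have "OnOb \<epsilon> \<cdot> ?lP (u \<cdot> prod_fst E Z B) (prod_snd E Z B) = OnOb \<epsilon> \<cdot> ?lP (v \<cdot> prod_fst E Z B) (prod_snd E Z B)"
        using u v main[of u Z] main[of v Z] by simp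
      from arg_cong[OF this, of "\<lambda>x. x \<cdot> ?lE (OnOb ?p) (OnOb ?q)"]
      have 1: "OnOb \<epsilon> \<cdot> ?lP (u \<cdot> OnOb ?p) (OnOb ?q) = OnOb \<epsilon> \<cdot> ?lP (v \<cdot> OnOb ?p) (OnOb ?q)"
        by simp
      have "\<epsilon> \<odot> FAr (prod_functor (Cat1 E) (disc_ob E B)) (up Z u) = \<epsilon> \<odot> FAr (prod_functor (Cat1 E) (disc_ob E B)) (up Z v)"
      proof (rule ifun_into_disc_eqI[where Y = Y])
        show "OnOb (\<epsilon> \<odot> FAr (prod_functor (Cat1 E) (disc_ob E B)) (up Z u)) = OnOb (\<epsilon> \<odot> FAr (prod_functor (Cat1 E) (disc_ob E B)) (up Z v))"
          using 1 up_eq[of "up Z u" Z] up_eq[of "up Z v" Z] by simp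
      qed simp_all
      then have "up Z u = up Z v"
        by - (rule F.universal_unique[OF U], simp_all)
      then have "OnOb (up Z u) = OnOb (up Z v)" by simp
      then show "u = v" by simp
    qed
  qed
qed

lemma closed_of_Cat1:
  assumes "cartesian_closed (Cat1 E)"
  shows "cartesian_closed E"
  unfolding cartesian_closed_def
proof (intro conjI ballI)
  show "category E" by (rule category)
  show "\<exists>T. is_terminal E T" by (rule terminal_exists)
  show "\<exists>P p q. is_product E A B P p q" if "A \<in> Obj E" "B \<in> Obj E" for A B using that by (rule product_exists)
  fix B assume B: "B \<in> Obj E"
  then have "disc_ob E B \<in> Obj (Cat1 E)" by simp
  then obtain G \<eta> \<epsilon> where adj: "is_adjunction (Cat1 E) (Cat1 E) (prod_functor (Cat1 E) (disc_ob E B)) G \<eta> \<epsilon>"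
    using assms unfolding cartesian_closed_def by blast
  interpret F: functor_loc "Cat1 E" "Cat1 E" "prod_functor (Cat1 E) (disc_ob E B)"
    by unfold_locales (simp add: Cat.is_functor_prod B)
  have "\<exists>H e. is_universal E E (prod_functor E B) Y H e" if Y: "Y \<in> Obj E" for Y
    using universal_of_disc[OF B Y F.adjunction_universal[OF adj]] Y by auto
  then obtain H e where "\<And>Y. Y \<in> Obj E \<Longrightarrow> is_universal E E (prod_functor E B) Y (H Y) (e Y)" by metis
  then interpret universal_arrows E E "prod_functor E B" H e
    by unfold_locales (simp_all add: is_functor_prod B)
  show "\<exists>G \<eta> \<epsilon>. is_adjunction E E (prod_functor E B) G \<eta> \<epsilon>" using is_adjunction by blast
qed

text \<open>The universal arrow is written with the same \<open>\<theta>\<close> as in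
  \<open>hom_comparison\<close>, so that the comparison arrow is exactly its transpose.\<close>

lemma disc_universal:
  assumes A [simp]: "A \<in> Obj E" and Y [simp]: "Y \<in> Obj E"
    and U: "is_universal E E (prod_functor E A) Y H \<epsilon>"
  defines "P \<equiv> prod_ob (Cat1 E) (disc_ob E H) (disc_ob E A)"
  defines "\<theta> \<equiv> lift (Cat1 E) (FAr (disc E) (prod_fst E H A)) (FAr (disc E) (prod_snd E H A))
      (prod_fst (Cat1 E) (disc_ob E H) (disc_ob E A)) (prod_snd (Cat1 E) (disc_ob E H) (disc_ob E A))"
  shows "is_universal (Cat1 E) (Cat1 E) (prod_functor (Cat1 E) (disc_ob E A)) (disc_ob E Y) (disc_ob E H)
    (FAr (disc E) \<epsilon> \<odot> \<theta>)"
proof -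
  interpret F: functor_loc E E "prod_functor E A"
    by unfold_locales (simp add: is_functor_prod)
  interpret D: functor_loc E "Cat1 E" "disc E" by unfold_locales (rule is_functor_disc)
  have H [simp]: "H \<in> Obj E" and \<epsilon> [simp]: "\<epsilon> \<in> Arr E" "Dom E \<epsilon> = prod_ob E H A" "Cod E \<epsilon> = Y"
    using U by (simp_all add: is_universal_def hom_iff)
  let ?p = "prod_fst (Cat1 E) (disc_ob E H) (disc_ob E A)" and ?q = "prod_snd (Cat1 E) (disc_ob E H) (disc_ob E A)"
  note prd = disc_is_product[OF prod_is_product[OF H A]]
  have "\<theta> \<in> Arr (Cat1 E)" "Dom (Cat1 E) \<theta> = P" "Cod (Cat1 E) \<theta> = disc_ob E (prod_ob E H A)"
    and t: "FAr (disc E) (prod_fst E H A) \<odot> \<theta> = ?p" "FAr (disc E) (prod_snd E H A) \<odot> \<theta> = ?q"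
    unfolding \<theta>_def using Cat.lift_props[OF prd, of ?p ?q] by (simp_all add: P_def)
  then have \<theta> [simp]: "is_ifun E \<theta>" "IDom \<theta> = P" "ICod \<theta> = disc_ob E (prod_ob E H A)" by simp_all
  have o\<theta> [simp]: "OnOb \<theta> \<in> Arr E" "Dom E (OnOb \<theta>) = IOb P" "Cod E (OnOb \<theta>) = prod_ob E H A"
    using ifun_simps(3-5)[OF \<theta>(1)] by simp_all
  have t0: "prod_fst E H A \<cdot> OnOb \<theta> = OnOb ?p" "prod_snd E H A \<cdot> OnOb \<theta> = OnOb ?q"
    using arg_cong[OF t(1), of OnOb] arg_cong[OF t(2), of OnOb] by simp_all
  let ?e = "FAr (disc E) \<epsilon> \<odot> \<theta>"
  have \<epsilon>i [simp]: "is_ifun E (FAr (disc E) \<epsilon>)" using D.functor_simps(2)[of \<epsilon>] by simp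
  have e [simp]: "is_ifun E ?e" "IDom ?e = P" "ICod ?e = disc_ob E Y" by simp_all
  show ?thesis
    unfolding is_universal_def
  proof (intro conjI ballI)
    show "disc_ob E H \<in> Obj (Cat1 E)" "?e \<in> hom (Cat1 E) (FOb (prod_functor (Cat1 E) (disc_ob E A)) (disc_ob E H)) (disc_ob E Y)"
      using e by (simp_all add: hom_iff P_def[symmetric])
    fix Z F assume Z: "Z \<in> Obj (Cat1 E)" and F: "F \<in> hom (Cat1 E) (FOb (prod_functor (Cat1 E) (disc_ob E A)) Z) (disc_ob E Y)"
    let ?Q = "prod_ob (Cat1 E) Z (disc_ob E A)" and ?p' = "prod_fst (Cat1 E) Z (disc_ob E A)"
      and ?q' = "prod_snd (Cat1 E) Z (disc_ob E A)"
    have Z [simp]: "is_icat E Z" and F [simp]: "is_ifun E F" "IDom F = ?Q" "ICod F = disc_ob E Y"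
      using Z F by (simp_all add: hom_iff)
    let ?lQ = "lift E (OnOb ?p') (OnOb ?q')" and ?lA = "lift E (OnAr ?p') (OnAr ?q')"
    let ?lE = "lift E (prod_fst E (IOb Z) A) (prod_snd E (IOb Z) A)"
    let ?f = "OnOb F \<cdot> ?lQ (prod_fst E (IOb Z) A) (prod_snd E (IOb Z) A)"
    have Fid: "?f \<cdot> ?lE (OnOb ?p') (OnOb ?q') = OnOb F" by simp
    \<comment> \<open>\<open>OnOb \<theta>\<close> and \<open>?lE\<close> compare the products
      underlying those of \<open>Cat1 E\<close> with those chosen in \<open>E\<close>, over
      \<open>H\<close> and over \<open>IOb Z\<close>. Naturality of this comparison reduces the
      composite to one in \<open>E\<close>.\<close>
    have key: "OnOb (?e \<odot> FAr (prod_functor (Cat1 E) (disc_ob E A)) w)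
        = (\<epsilon> \<cdot> FAr (prod_functor E A) (OnOb w)) \<cdot> ?lE (OnOb ?p') (OnOb ?q')"
      if w: "is_ifun E w" "IDom w = Z" "ICod w = disc_ob E H" for w
    proof -
      have "OnOb \<theta> \<cdot> OnOb (FAr (prod_functor (Cat1 E) (disc_ob E A)) w) =
          FAr (prod_functor E A) (OnOb w) \<cdot> ?lE (OnOb ?p') (OnOb ?q')"
        by (rule prod_eqI[of H A]) (simp_all add: w P_def comp_ext[OF t0(1)] comp_ext[OF t0(2)])
      then show ?thesis by (simp add: w P_def)
    qed
    show "\<exists>!u. u \<in> hom (Cat1 E) Z (disc_ob E H) \<and> ?e \<odot> FAr (prod_functor (Cat1 E) (disc_ob E A)) u = F"
    proof (rule ex_ex1I)
      have "?f \<in> hom E (FOb (prod_functor E A) (IOb Z)) Y" by (simp add: hom_iff)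
      moreover have "IOb Z \<in> Obj E" by simp
      ultimately obtain u where u: "u \<in> hom E (IOb Z) H" "\<epsilon> \<cdot> FAr (prod_functor E A) u = ?f"
        using U unfolding is_universal_def by blast
      have [simp]: "u \<in> Arr E" "Dom E u = IOb Z" "Cod E u = H" using u by (simp_all add: hom_iff)
      have FQ: "OnOb F \<cdot> Src ?Q = OnOb F \<cdot> Tgt ?Q"
        using ifun_into_disc[of F Y ?Q] by simp
      \<comment> \<open>\<open>F\<close> coequalizes source and target of \<open>?Q\<close>;
        restricting to pairs of an arrow of \<open>Z\<close> and an element of \<open>A\<close>
        leaves only source and target of \<open>Z\<close>.\<close>
      have st: "?f \<cdot> FAr (prod_functor E A) (Src Z) = ?f \<cdot> FAr (prod_functor E A) (Tgt Z)"
        using comp_ext[OF FQ, of "?lA (prod_fst E (IAr Z) A) (prod_snd E (IAr Z) A)"] by simp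
      have "\<epsilon> \<cdot> FAr (prod_functor E A) (u \<cdot> Src Z) = ?f \<cdot> FAr (prod_functor E A) (Src Z)"
        "\<epsilon> \<cdot> FAr (prod_functor E A) (u \<cdot> Tgt Z) = ?f \<cdot> FAr (prod_functor E A) (Tgt Z)"
        using comp_ext[OF u(2)] by simp_all
      \<comment> \<open>Transposition is injective, so \<open>u\<close> inherits the coequalizing
        property from \<open>?f\<close> and therefore extends to a functor into
        \<open>disc_ob E H\<close>.\<close>
      with st have "u \<cdot> Src Z = u \<cdot> Tgt Z"
        by - (rule F.universal_unique[OF U], simp_all)
      then have w: "is_ifun E \<lparr>IDom = Z, ICod = disc_ob E H, OnOb = u, OnAr = u \<cdot> Src Z\<rparr>" (is "is_ifun E ?w")
        by (rule is_ifun_into_disc[OF Z u(1)])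
      have "?e \<odot> FAr (prod_functor (Cat1 E) (disc_ob E A)) ?w = F"
      proof (rule ifun_into_disc_eqI[where Y = Y])
        have "OnOb (?e \<odot> FAr (prod_functor (Cat1 E) (disc_ob E A)) ?w) = ?f \<cdot> ?lE (OnOb ?p') (OnOb ?q')"
          using key[OF w] u(2) by simp
        then show "OnOb (?e \<odot> FAr (prod_functor (Cat1 E) (disc_ob E A)) ?w) = OnOb F"
          unfolding Fid .
      qed (use w in \<open>simp_all add: P_def\<close>)
      then show "\<exists>u. u \<in> hom (Cat1 E) Z (disc_ob E H) \<and> ?e \<odot> FAr (prod_functor (Cat1 E) (disc_ob E A)) u = F"
        using w by (intro exI[of _ ?w]) (simp add: hom_iff)
    next
      have uf: "\<epsilon> \<cdot> FAr (prod_functor E A) (OnOb u) = ?f"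
        if "u \<in> hom (Cat1 E) Z (disc_ob E H) \<and> ?e \<odot> FAr (prod_functor (Cat1 E) (disc_ob E A)) u = F" for u
      proof -
        have u: "is_ifun E u" "IDom u = Z" "ICod u = disc_ob E H" using that by (simp_all add: hom_iff)
        have [simp]: "OnOb u \<in> Arr E" "Dom E (OnOb u) = IOb Z" "Cod E (OnOb u) = H"
          using ifun_simps(3-5)[OF u(1)] u by simp_all
        have "(\<epsilon> \<cdot> FAr (prod_functor E A) (OnOb u)) \<cdot> ?lE (OnOb ?p') (OnOb ?q') = OnOb F"
          using key[OF u] that by simp
        from arg_cong[OF this, of "\<lambda>x. x \<cdot> ?lQ (prod_fst E (IOb Z) A) (prod_snd E (IOb Z) A)"]
        have "(\<epsilon> \<cdot> FAr (prod_functor E A) (OnOb u)) \<cdot> ?lE (prod_fst E (IOb Z) A) (prod_snd E (IOb Z) A) = ?f"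
          by (simp add: pair_comp)
        moreover have "?lE (prod_fst E (IOb Z) A) (prod_snd E (IOb Z) A) = Idt E (prod_ob E (IOb Z) A)"
          by (rule prod_eqI[of "IOb Z" A]) simp_all
        ultimately show ?thesis by simp
      qed
      fix u v
      assume u: "u \<in> hom (Cat1 E) Z (disc_ob E H) \<and> ?e \<odot> FAr (prod_functor (Cat1 E) (disc_ob E A)) u = F"
        and v: "v \<in> hom (Cat1 E) Z (disc_ob E H) \<and> ?e \<odot> FAr (prod_functor (Cat1 E) (disc_ob E A)) v = F"
      have uv: "is_ifun E u" "IDom u = Z" "ICod u = disc_ob E H" "is_ifun E v" "IDom v = Z" "ICod v = disc_ob E H"
        using u v by (simp_all add: hom_iff)
      have "OnOb u = OnOb v"
        by (rule F.universal_unique[OF U]) (use uf[OF u] uf[OF v] ifun_simps(3-5)[OF uv(1)] ifun_simps(3-5)[OF uv(4)] uv in simp_all)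
      then show "u = v" using uv by (intro ifun_into_disc_eqI[where Y = H]) simp_all
    qed
  qed
qed

text \<open>Both \<open>?e\<close> and \<open>\<epsilon>' (disc_ob E Y)\<close> are universal arrows
  to \<open>disc_ob E Y\<close>, and the comparison mediates between them, so
  \<open>universal_iso\<close> applies to every choice of the adjoints.\<close>

lemma disc_preserves_internal_homs:
  assumes E: "cartesian_closed E" and C: "cartesian_closed (Cat1 E)"
  shows "preserves_internal_homs E (Cat1 E) (disc E)"
  unfolding preserves_internal_homs_def
proof (intro conjI ballI allI impI)
  show "cartesian_closed E" "cartesian_closed (Cat1 E)" by fact+
  show "is_functor E (Cat1 E) (disc E)" by (rule is_functor_disc)
  show "is_product (Cat1 E) (FOb (disc E) A) (FOb (disc E) B) (FOb (disc E) (prod_ob E A B))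
      (FAr (disc E) (prod_fst E A B)) (FAr (disc E) (prod_snd E A B))" if "A \<in> Obj E" "B \<in> Obj E" for A B
    using disc_is_product[OF prod_is_product[OF that]] by simp
  fix A Y G \<eta> \<epsilon> G' \<eta>' \<epsilon>'
  assume A: "A \<in> Obj E" and Y: "Y \<in> Obj E"
    and adj: "is_adjunction E E (prod_functor E A) G \<eta> \<epsilon>"
    and "is_adjunction (Cat1 E) (Cat1 E) (prod_functor (Cat1 E) (FOb (disc E) A)) G' \<eta>' \<epsilon>'"
  then have adj': "is_adjunction (Cat1 E) (Cat1 E) (prod_functor (Cat1 E) (disc_ob E A)) G' \<eta>' \<epsilon>'" by simp
  interpret F: functor_loc E E "prod_functor E A"
    by unfold_locales (simp add: is_functor_prod A)
  interpret F': functor_loc "Cat1 E" "Cat1 E" "prod_functor (Cat1 E) (disc_ob E A)"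
    by unfold_locales (simp add: Cat.is_functor_prod A)
  note U = disc_universal[OF A Y F.adjunction_universal[OF adj Y]]
  let ?H = "disc_ob E (FOb G Y)"
  let ?e = "FAr (disc E) (\<epsilon> Y) \<odot> lift (Cat1 E) (FAr (disc E) (prod_fst E (FOb G Y) A)) (FAr (disc E) (prod_snd E (FOb G Y) A))
      (prod_fst (Cat1 E) ?H (disc_ob E A)) (prod_snd (Cat1 E) ?H (disc_ob E A))"
  have H: "?H \<in> Obj (Cat1 E)" and e: "?e \<in> hom (Cat1 E) (FOb (prod_functor (Cat1 E) (disc_ob E A)) ?H) (disc_ob E Y)"
    using U by (auto simp only: is_universal_def)
  have U': "is_universal (Cat1 E) (Cat1 E) (prod_functor (Cat1 E) (disc_ob E A)) (disc_ob E Y) (FOb G' (disc_ob E Y)) (\<epsilon>' (disc_ob E Y))"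
    using F'.adjunction_universal[OF adj'] Y by simp
  \<comment> \<open>Unfolding shows the comparison to be the transpose of \<open>?e\<close> under
    the adjunction in \<open>Cat1 E\<close>; \<open>t\<close> then gives its type and its mediating
    property.\<close>
  have c: "hom_comparison E (Cat1 E) (disc E) A G \<epsilon> G' \<eta>' Y = FAr G' ?e \<odot> \<eta>' ?H"
    by (simp add: hom_comparison_def Let_def)
  note t = F'.adjunction_transpose[OF adj' H e, folded c]
  show "hom_comparison E (Cat1 E) (disc E) A G \<epsilon> G' \<eta>' Y \<in> hom (Cat1 E) (FOb (disc E) (FOb G Y)) (FOb G' (FOb (disc E) Y))"
    using t(1) by simp
  show "is_iso (Cat1 E) (hom_comparison E (Cat1 E) (disc E) A G \<epsilon> G' \<eta>' Y)"
    by (rule F'.universal_iso[OF U U' t])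
qed

end

theorem theorem4p1:
  fixes E :: "('o, 'a) cat"
  assumes "category E" and "has_finite_limits E"
  shows "(cartesian_closed E \<longleftrightarrow> two_cartesian_closed (Cat2 E)) \<and>
         (cartesian_closed E \<longrightarrow> preserves_internal_homs E (Und (Cat2 E)) (disc E))"
proof -
  interpret fincat E by unfold_locales fact+
  have Cat2: "two_cartesian_closed (Cat2 E)" if "cartesian_closed E"
  proof -
    interpret ccc E by unfold_locales fact
    show ?thesis by (rule Cat2_closed)
  qed
  have Cat1: "cartesian_closed (Cat1 E)" if "two_cartesian_closed (Cat2 E)"
    using two_cartesian_closed_underlying[OF that] by simp
  show ?thesis
    using Cat2 Cat1 closed_of_Cat1 disc_preserves_internal_homs by auto
qed

end
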